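(* Under the standing assumptions in the context, there exists $c>0$ such that $\mathbb E\big[e^{c\log^\gamma\tau}\big]<\infty$, where $\gamma$ is the exponent in the assumed ballisticity condition; in particular $\tau<\infty$ a.s. The same holds with $\mathbb E$ replaced by expectation under $\mathbb P^{\angle}$.
   Context: Model: fix $q\in(0,1)$, $p_\circ,p_\bullet\in[0,1]$, $v_\circ=2p_\circ-1$, $v_\bullet=2p_\bullet-1$. Under $\mathbb P^\rho$: $\omega$ is a Poisson point process of intensity $\rho\sum_xP_x$ on the set $W$ of two-sided paths $w:\mathbb Z\to\mathbb Z$ with $|w(n+1)-w(n)|\le1$, where $P_x$ is the law of a two-sided lazy simple random walk (steps $-1,0,1$ with probabilities $\frac{1-q}2,q,\frac{1-q}2$) with $w(0)=x$; independently $(U_y)_{y\in\mathbb Z^2}$ are i.i.d. uniform $[0,1]$. $\mathcal T=\{(w(n),n): w\in\omega, n\in\mathbb Z\}$. For $y\in\mathbb Z^2$, $Y^y_0=y$, $Y^y_{i+1}=Y^y_i+(1,1)$ if ($Y^y_i\in\mathcal T$, $U_{Y^y_i}\le p_\bullet$) or ($Y^y_i\notin\mathcal T$, $U_{Y^y_i}\le p_\circ$), else $Y^y_{i+1}=Y^y_i+(-1,1)$; $X^y$ is its spatial coordinate; $Y=Y^{(0,0)}$, $X=X^{(0,0)}$. Standing assumptions: $v_\bullet>0$, $v_\circ>-1$, $\rho\in(0,\infty)$, and for some $v_\star\in(0,v_\bullet)$ there are $c_0>0,\gamma>1$ with $\mathbb P^\rho(\exists n\in\mathbb N: X_n<nv_\star-L)\le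 c_0^{-1}e^{-c_0\log^\gamma L}$ for all $L\in\mathbb N$. Write $\mathbb P=\mathbb P^\rho$, $\bar v=v_\star/3$. Cones: $\angle(x,n)=(x,n)+\{(x',n')\in\mathbb Z_+^2: x'\ge\bar vn'\}$ and $\angle^{\mathrm{rev}}(x,n)=(x,n)+\{(x',n')\in\mathbb Z_-^2: x'<\bar vn'\}$. The trace of $w\in W$ is $\{(w(n),n):n\in\mathbb Z\}$. $W^{\times}_y$ is the set of $w$ whose trace intersects both $\angle(y)$ and $\angle^{\mathrm{rev}}(y)$. $A^y=\{Y^y_i\in\angle(y)\ \forall i\ge0\}$. Record times: $R_k=\inf\{n\ge0: X_n\ge(1-\bar v)k+\bar vn\}$, $k\in\mathbb N$. $\mathbb P^{\angle}(\cdot)=\mathbb P(\,\cdot\mid \omega(W^\times_{(0,0)})=0,\ A^{(0,0)})$. $\mathcal I=\inf\{k\in\mathbb N: \omega(W^\times_{Y_{R_k}})=0\text{ and }A^{Y_{R_k}}\text{ occurs}\}$, $\tau=R_{\mathcal I}$. *)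

theory Defs
  imports "HOL-Probability.Probability"
begin

text \<open>Sample space. A configuration consists of
  (i)  for each starting site x a number N x of paths starting at x (i.i.d. Poisson(rho)),
  (ii) for each (x,i,n) the increment w_{x,i}(n+1) - w_{x,i}(n) of the i-th path started at x
       (i.i.d. lazy steps),
  (iii) the i.i.d. uniform variables U_y, y in Z^2.
  The point process omega = sum_x sum_{i < N x} delta_{w_{x,i}} is then a Poisson point
  process of intensity rho * sum_x P_x.\<close>

type_synonym config = "((int \<Rightarrow> nat) \<times> (int \<times> nat \<times> int \<Rightarrow> int)) \<times> (int \<times> int \<Rightarrow> real)"

definition step_pmf :: "real \<Rightarrow> int pmf" where
  "step_pmf q = bind_pmf (bernoulli_pmf q)
     (\<lambda>b. if b then return_pmf 0 else map_pmf (\<lambda>c. if c then 1 else -1) (bernoulli_pmf (1/2)))"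

definition PP :: "real \<Rightarrow> real \<Rightarrow> config measure" where
  "PP \<rho> q =
     (PiM UNIV (\<lambda>_::int. measure_pmf (poisson_pmf \<rho>))
        \<Otimes>\<^sub>M PiM UNIV (\<lambda>_::int \<times> nat \<times> int. measure_pmf (step_pmf q)))
     \<Otimes>\<^sub>M PiM UNIV (\<lambda>_::int \<times> int. uniform_measure lborel {0..1::real})"

definition Ncnt :: "config \<Rightarrow> int \<Rightarrow> nat" where "Ncnt \<omega> = fst (fst \<omega>)"
definition Steps :: "config \<Rightarrow> int \<times> nat \<times> int \<Rightarrow> int" where "Steps \<omega> = snd (fst \<omega>)"
definition Unif :: "config \<Rightarrow> int \<times> int \<Rightarrow> real" where "Unif \<omega> = snd \<omega>"

definition path :: "config \<Rightarrow> int \<Rightarrow> nat \<Rightarrow> int \<Rightarrow> int" where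
  "path \<omega> x i n = x + (if 0 \<le> n then (\<Sum>k\<in>{0..<n}. Steps \<omega> (x, i, k))
                        else - (\<Sum>k\<in>{n..<0}. Steps \<omega> (x, i, k)))"

definition trace :: "(int \<Rightarrow> int) \<Rightarrow> (int \<times> int) set" where
  "trace w = {(w n, n) | n. True}"

definition omega_count :: "config \<Rightarrow> (int \<Rightarrow> int) set \<Rightarrow> enat" where
  "omega_count \<omega> A =
     (let S = {(x, i). i < Ncnt \<omega> x \<and> path \<omega> x i \<in> A} in
      if finite S then enat (card S) else \<infinity>)"

definition Tset :: "config \<Rightarrow> (int \<times> int) set" where
  "Tset \<omega> = {(path \<omega> x i n, n) | x i n. i < Ncnt \<omega> x}"

definition cone :: "real \<Rightarrow> int \<times> int \<Rightarrow> (int \<times> int) set" where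
  "cone vb y = {(fst y + a, snd y + b) | a b. 0 \<le> a \<and> 0 \<le> b \<and> real_of_int a \<ge> vb * real_of_int b}"

definition rcone :: "real \<Rightarrow> int \<times> int \<Rightarrow> (int \<times> int) set" where
  "rcone vb y = {(fst y + a, snd y + b) | a b. a \<le> 0 \<and> b \<le> 0 \<and> real_of_int a < vb * real_of_int b}"

definition Wcross :: "real \<Rightarrow> int \<times> int \<Rightarrow> (int \<Rightarrow> int) set" where
  "Wcross vb y = {w. trace w \<inter> cone vb y \<noteq> {} \<and> trace w \<inter> rcone vb y \<noteq> {}}"

fun Ywalk :: "(int \<times> int) set \<Rightarrow> (int \<times> int \<Rightarrow> real) \<Rightarrow> real \<Rightarrow> real \<Rightarrow> int \<times> int \<Rightarrow> nat \<Rightarrow> int \<times> int" where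
  "Ywalk T U po pb y 0 = y"
| "Ywalk T U po pb y (Suc i) =
     (let z = Ywalk T U po pb y i in
      if (z \<in> T \<and> U z \<le> pb) \<or> (z \<notin> T \<and> U z \<le> po)
      then (fst z + 1, snd z + 1) else (fst z - 1, snd z + 1))"

definition Yw :: "real \<Rightarrow> real \<Rightarrow> config \<Rightarrow> int \<times> int \<Rightarrow> nat \<Rightarrow> int \<times> int" where
  "Yw po pb \<omega> y i = Ywalk (Tset \<omega>) (Unif \<omega>) po pb y i"

definition Xw :: "real \<Rightarrow> real \<Rightarrow> config \<Rightarrow> nat \<Rightarrow> int" where
  "Xw po pb \<omega> n = fst (Yw po pb \<omega> (0, 0) n)"

definition Aev :: "real \<Rightarrow> real \<Rightarrow> real \<Rightarrow> config \<Rightarrow> int \<times> int \<Rightarrow> bool" where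
  "Aev po pb vb \<omega> y \<longleftrightarrow> (\<forall>i. Yw po pb \<omega> y i \<in> cone vb y)"

definition Rtime :: "real \<Rightarrow> real \<Rightarrow> real \<Rightarrow> config \<Rightarrow> nat \<Rightarrow> enat" where
  "Rtime po pb vb \<omega> k =
     (if \<exists>n. real_of_int (Xw po pb \<omega> n) \<ge> (1 - vb) * real k + vb * real n
      then enat (LEAST n. real_of_int (Xw po pb \<omega> n) \<ge> (1 - vb) * real k + vb * real n)
      else \<infinity>)"

definition good_index :: "real \<Rightarrow> real \<Rightarrow> real \<Rightarrow> config \<Rightarrow> nat \<Rightarrow> bool" where
  "good_index po pb vb \<omega> k \<longleftrightarrow>
     (case Rtime po pb vb \<omega> k of
        enat r \<Rightarrow> omega_count \<omega> (Wcross vb (Yw po pb \<omega> (0,0) r)) = 0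
                  \<and> Aev po pb vb \<omega> (Yw po pb \<omega> (0,0) r)
      | \<infinity> \<Rightarrow> False)"

definition Iidx :: "real \<Rightarrow> real \<Rightarrow> real \<Rightarrow> config \<Rightarrow> enat" where
  "Iidx po pb vb \<omega> =
     (if \<exists>k\<ge>1. good_index po pb vb \<omega> k
      then enat (LEAST k. k \<ge> 1 \<and> good_index po pb vb \<omega> k) else \<infinity>)"

definition tau :: "real \<Rightarrow> real \<Rightarrow> real \<Rightarrow> config \<Rightarrow> enat" where
  "tau po pb vb \<omega> = (case Iidx po pb vb \<omega> of enat k \<Rightarrow> Rtime po pb vb \<omega> k | \<infinity> \<Rightarrow> \<infinity>)"

definition tail_weight :: "real \<Rightarrow> real \<Rightarrow> enat \<Rightarrow> ennreal" where
  "tail_weight c \<gamma> t = (case t of enat n \<Rightarrow> ennreal (exp (c * (ln (real n)) powr \<gamma>)) | \<infinity> \<Rightarrow> \<infinity>)"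

definition Bangle :: "real \<Rightarrow> real \<Rightarrow> real \<Rightarrow> config set" where
  "Bangle po pb vb = {\<omega>. omega_count \<omega> (Wcross vb (0,0)) = 0 \<and> Aev po pb vb \<omega> (0,0)}"

end

(*
Run the walk along its record times.  At a record at z everything the walk has seen lies in the
reverse cone of z, so by Poisson thinning the particles avoiding that cone and the uniform variables
outside it are independent of the past.  Fix a scale m and let l be a large multiple of log m.  A
trial first waits for m further records; up to an error exponentially small in m, particles known at
its start can no longer interfere, and with probability at least 1/2 no particle touching the reverse
cone of the new record z touches the cone of z + (l, l), by a union bound over the polynomially many
possible z.  Forcing the walk along the diagonal from z to z + (l, l) costs a power of 1/m, and from
there, with probability bounded below, no particle crosses and ballisticity keeps the walk in its
cone.  Hence polynomially many trials suffice: the probability that all of them fail is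
exponentially small in m.  A success that is later undone violates ballisticity at scale m somewhere
in a box of polynomial size, which has probability at most a polynomial in m times
exp (- c0 (log m)^gamma).  Since gamma > 1, polynomial factors are harmless.
*)
theory Submission
  imports Defs "HOL-Real_Asymp.Real_Asymp"
begin

section \<open>The walk in a fixed environment\<close>

text \<open>The obstacle: whether a particle crosses at a record z depends on particles touching
  \<open>rcone v z\<close>, that is, on what the past of z already knows, so it cannot be won from
  fresh randomness at z. Hence two conditionings per trial. Particles touching the reverse cone of
  the starting record y are made harmless by the wait; the others are independent of the past of y,
  when z is still unknown, and this forces the union bound over a box of order m^2 sites. A crossing
  from \<open>rcone v z\<close> to the cone of \<open>diag z l\<close> has probability of order
  exp(-v(1-v)l), so l = 3 log m / (v(1-v)) makes the sum small while the price of the forced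
  diagonal stays polynomial. Success is tested over a finite horizon H only, because failure must be
  known when the next trial starts. The assumed speed is 3v while the cones have slope v; the
  surplus 2v turns ballisticity into growth of height. Independence comes from void probabilities
  alone: the walk asks only whether a site is occupied, and exp(-\<rho> mu(B)) factorises over
  disjoint sets of paths.\<close>

definition ht :: "real \<Rightarrow> int \<times> int \<Rightarrow> real" where
  "ht v z = real_of_int (fst z) - v * real_of_int (snd z)"

definition diag :: "int \<times> int \<Rightarrow> nat \<Rightarrow> int \<times> int" where
  "diag z i = (fst z + int i, snd z + int i)"

lemma diag_simps [simp]: "fst (diag z i) = fst z + int i" "snd (diag z i) = snd z + int i" "diag z 0 = z"
  by (auto simp: diag_def)

lemma diag_diag [simp]: "diag (diag z i) j = diag z (i + j)"
  by (simp add: diag_def)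

lemma ht_diag [simp]: "ht v (diag z i) = ht v z + (1 - v) * real i"
  by (simp add: ht_def algebra_simps)

text \<open>With v > 0 the sign condition on the spatial offset follows from the slope condition, so
  cones (and likewise reverse cones) become conditions on time and on the linear height
  \<open>ht\<close>.\<close>

lemma mem_cone_iff:
  assumes "0 < v"
  shows "z \<in> cone v y \<longleftrightarrow> snd y \<le> snd z \<and> ht v y \<le> ht v z"
proof
  assume "z \<in> cone v y"
  then show "snd y \<le> snd z \<and> ht v y \<le> ht v z"
    by (auto simp: cone_def ht_def algebra_simps)
next
  assume *: "snd y \<le> snd z \<and> ht v y \<le> ht v z"
  define a b where "a = fst z - fst y" and "b = snd z - snd y"
  have "real_of_int a \<ge> v * real_of_int b" "0 \<le> b"
    using * by (auto simp: a_def b_def ht_def algebra_simps)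
  moreover have "0 \<le> a"
  proof -
    have "0 \<le> v * real_of_int b" using assms \<open>0 \<le> b\<close> by simp
    then show ?thesis using \<open>real_of_int a \<ge> v * real_of_int b\<close> by linarith
  qed
  ultimately show "z \<in> cone v y"
    unfolding cone_def by (intro CollectI exI[of _ a] exI[of _ b]) (auto simp: a_def b_def)
qed

lemma mem_rcone_iff:
  assumes "0 < v"
  shows "z \<in> rcone v y \<longleftrightarrow> snd z \<le> snd y \<and> ht v z < ht v y"
proof
  assume "z \<in> rcone v y"
  then show "snd z \<le> snd y \<and> ht v z < ht v y"
    by (auto simp: rcone_def ht_def algebra_simps)
next
  assume *: "snd z \<le> snd y \<and> ht v z < ht v y"
  define a b where "a = fst z - fst y" and "b = snd z - snd y"
  have "real_of_int a < v * real_of_int b" "b \<le> 0"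
    using * by (auto simp: a_def b_def ht_def algebra_simps)
  moreover have "a \<le> 0"
  proof -
    have "v * real_of_int b \<le> 0" using assms \<open>b \<le> 0\<close> by (simp add: mult_le_0_iff)
    then show ?thesis using \<open>real_of_int a < v * real_of_int b\<close> by linarith
  qed
  ultimately show "z \<in> rcone v y"
    unfolding rcone_def by (intro CollectI exI[of _ a] exI[of _ b]) (auto simp: a_def b_def)
qed

lemma Ywalk_snd [simp]: "snd (Ywalk T U po pb y i) = snd y + int i"
  by (induction i) (auto simp: Let_def)

lemma Ywalk_fst_bound: "\<bar>fst (Ywalk T U po pb y i) - fst y\<bar> \<le> int i"
  by (induction i) (auto simp: Let_def)

lemma Ywalk_add: "Ywalk T U po pb y (i + j) = Ywalk T U po pb (Ywalk T U po pb y i) j"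
  by (induction j) (auto simp: Let_def)

lemma ht_Ywalk_Suc:
  assumes "0 < v"
  shows "ht v (Ywalk T U po pb y (Suc i)) \<le> ht v (Ywalk T U po pb y i) + (1 - v)"
  using assms by (auto simp: Let_def ht_def algebra_simps)

lemma ht_Ywalk_add:
  assumes "0 < v"
  shows "ht v (Ywalk T U po pb y (i + j)) \<le> ht v (Ywalk T U po pb y i) + (1 - v) * real j"
proof (induction j)
  case (Suc j)
  then show ?case
    using ht_Ywalk_Suc[OF assms, of T U po pb y "i + j"] by (simp add: algebra_simps)
qed simp

text \<open>Position i is read off the sites visited strictly before time i, so it may itself lie
  outside \<open>S\<close>. This lets a record at y be decided inside \<open>rcone v y\<close>,
  which does not contain y.\<close>

lemma Ywalk_cong:
  assumes "\<And>z. z \<in> S \<Longrightarrow> (z \<in> T) = (z \<in> T')" "\<And>z. z \<in> S \<Longrightarrow> U z = U' z"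
    and "\<And>j. j < i \<Longrightarrow> Ywalk T U po pb y j \<in> S"
  shows "Ywalk T' U' po pb y i = Ywalk T U po pb y i"
  using assms(3)
proof (induction i)
  case (Suc i)
  then show ?case
    using assms(1,2)[of "Ywalk T U po pb y i"] by (simp add: Let_def)
qed simp

text \<open>A uniform variable below both thresholds sends the walk to the right whether or not the
  site is occupied.\<close>

lemma Ywalk_diag:
  assumes "\<And>i. i < l \<Longrightarrow> U (diag y i) \<le> min po pb" and "i \<le> l"
  shows "Ywalk T U po pb y i = diag y i"
  using assms(2)
proof (induction i)
  case (Suc i)
  then have "Ywalk T U po pb y i = diag y i" "U (diag y i) \<le> min po pb"
    using assms(1)[of i] by auto
  then show ?case by (auto simp: Let_def diag_def)
qed simp

section \<open>Record times\<close>

text \<open>\<open>Rtime\<close> rewritten through the height; 1 - v is the largest gain of height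
  in one step. A relation in n replaces the minimum because it depends only on positions up to time
  n.\<close>

definition isrec :: "real \<Rightarrow> (nat \<Rightarrow> int \<times> int) \<Rightarrow> nat \<Rightarrow> nat \<Rightarrow> bool" where
  "isrec v Y k n \<longleftrightarrow> (1 - v) * real k \<le> ht v (Y n) \<and> (\<forall>j<n. ht v (Y j) < (1 - v) * real k)"

lemma isrec_unique: "isrec v Y k n \<Longrightarrow> isrec v Y k n' \<Longrightarrow> n = n'"
  by (metis isrec_def linorder_not_less nat_neq_iff)

lemma isrec_cong: "(\<And>j. j \<le> n \<Longrightarrow> Y j = Y' j) \<Longrightarrow> isrec v Y k n = isrec v Y' k n"
  by (auto simp: isrec_def)

lemma isrec_exists:
  assumes "(1 - v) * real k \<le> ht v (Y n)"
  obtains n' where "n' \<le> n" "isrec v Y k n'"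
proof -
  define P where "P = (\<lambda>n. (1 - v) * real k \<le> ht v (Y n))"
  define n' where "n' = (LEAST n. P n)"
  have "P n" using assms by (simp add: P_def)
  then have "P n'" "n' \<le> n" unfolding n'_def by (auto intro: LeastI Least_le)
  moreover have "\<not> P j" if "j < n'" for j
    using that not_less_Least[of j P] by (simp add: n'_def)
  ultimately have "isrec v Y k n'" by (simp add: isrec_def P_def not_le)
  with \<open>n' \<le> n\<close> show ?thesis by (rule that)
qed

lemma isrec_mono:
  assumes "isrec v Y k n" "isrec v Y k' n'" "k \<le> k'" "v < 1"
  shows "n \<le> n'"
proof (rule ccontr)
  assume "\<not> n \<le> n'"
  then have "ht v (Y n') < (1 - v) * real k" using assms(1) by (auto simp: isrec_def)
  also have "\<dots> \<le> (1 - v) * real k'" using assms(3,4) by (intro mult_left_mono) auto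
  finally show False using assms(2) by (auto simp: isrec_def)
qed

text \<open>Kept abstract because it is applied both to the true walk and to the walk run in the
  part of the environment known to the past of a record.\<close>

locale walk_records =
  fixes v :: real and Y :: "nat \<Rightarrow> int \<times> int"
  assumes v: "0 < v" "v < 1"
    and Y0: "Y 0 = (0, 0)"
    and sndY: "\<And>n. snd (Y n) = int n"
    and htY: "\<And>i j. ht v (Y (i + j)) \<le> ht v (Y i) + (1 - v) * real j"
begin

lemma isrec_rcone:
  assumes "isrec v Y k n" "j < n"
  shows "Y j \<in> rcone v (Y n)"
proof -
  have "ht v (Y j) < (1 - v) * real k" "(1 - v) * real k \<le> ht v (Y n)"
    using assms by (auto simp: isrec_def)
  then show ?thesis using assms(2) by (simp add: mem_rcone_iff[OF v(1)] sndY)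
qed

text \<open>Just before a record the height is below the level, and one step gains at most 1 - v:
  the overshoot is less than one level.\<close>

lemma isrec_ht_less:
  assumes "isrec v Y k n"
  shows "ht v (Y n) < (1 - v) * (real k + 1)"
proof (cases n)
  case 0
  then show ?thesis using Y0 v by (simp add: ht_def mult_pos_pos)
next
  case (Suc n')
  then have "ht v (Y n') < (1 - v) * real k" using assms by (auto simp: isrec_def)
  moreover have "ht v (Y n) \<le> ht v (Y n') + (1 - v)" using htY[of n' 1] Suc by simp
  ultimately show ?thesis by (simp add: algebra_simps)
qed

text \<open>One step climbs at most one level. Strictness of the overshoot bound gives d steps
  rather than d - 1.\<close>

lemma isrec_gap:
  assumes "isrec v Y k n" "isrec v Y (k + d) n'"
  shows "n + d \<le> n'"
proof -
  obtain i where i: "n' = n + i"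
    using isrec_mono[OF assms] v by (auto simp: le_iff_add)
  have "(1 - v) * real (k + d) \<le> ht v (Y (n + i))" using assms(2) i by (auto simp: isrec_def)
  also have "\<dots> \<le> ht v (Y n) + (1 - v) * real i" by (rule htY)
  also have "\<dots> < (1 - v) * (real k + 1) + (1 - v) * real i"
    using isrec_ht_less[OF assms(1)] by simp
  also have "\<dots> = (1 - v) * (real k + 1 + real i)" by (simp add: algebra_simps)
  finally have "real (k + d) < real k + 1 + real i" using v by simp
  then show ?thesis using i by linarith
qed

text \<open>The possible overshoot at level k costs one diagonal step, hence d - 1.\<close>

lemma isrec_cone:
  assumes "isrec v Y k n" "isrec v Y (k + d) n'" "1 \<le> d"
  shows "Y n' \<in> cone v (diag (Y n) (d - 1))"
proof -
  have "n + d \<le> n'" using isrec_gap[OF assms(1,2)] .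
  moreover have "ht v (Y n) + (1 - v) * real (d - 1) \<le> (1 - v) * real (k + d)"
    using isrec_ht_less[OF assms(1)] assms(3) by (simp add: of_nat_diff algebra_simps)
  then have "ht v (Y n) + (1 - v) * real (d - 1) \<le> ht v (Y n')"
    using assms(2) by (auto simp: isrec_def)
  ultimately show ?thesis using assms(3) by (auto simp: mem_cone_iff[OF v(1)] sndY)
qed

text \<open>A diagonal step gains exactly one level, so the overshoot is preserved and each step is
  a record.\<close>

lemma isrec_diag:
  assumes "isrec v Y k n" and Y: "\<And>i. i \<le> l \<Longrightarrow> Y (n + i) = diag (Y n) i"
  shows "isrec v Y (k + l) (n + l)"
  unfolding isrec_def
proof (intro conjI allI impI)
  show "(1 - v) * real (k + l) \<le> ht v (Y (n + l))"
    using assms(1) Y[of l] by (auto simp: isrec_def algebra_simps)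
next
  fix j assume j: "j < n + l"
  show "ht v (Y j) < (1 - v) * real (k + l)"
  proof (cases "j < n")
    case True
    then have "ht v (Y j) < (1 - v) * real k" using assms(1) by (auto simp: isrec_def)
    also have "\<dots> \<le> (1 - v) * real (k + l)" using v by (intro mult_left_mono) auto
    finally show ?thesis .
  next
    case False
    then obtain i where i: "j = n + i" "i < l" using j by (metis add_less_cancel_left le_iff_add not_less)
    have "ht v (Y j) < (1 - v) * (real k + 1) + (1 - v) * real i"
      using isrec_ht_less[OF assms(1)] Y[of i] i by simp
    also have "\<dots> = (1 - v) * (real k + 1 + real i)" by (simp add: algebra_simps)
    also have "\<dots> \<le> (1 - v) * real (k + l)" using v i by (intro mult_left_mono) auto
    finally show ?thesis .
  qed
qed

end

lemma walk_records_Ywalk: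
  assumes "0 < v" "v < 1"
  shows "walk_records v (Ywalk T U po pb (0, 0))"
  using assms ht_Ywalk_add[OF assms(1)] by unfold_locales auto

section \<open>Void probabilities of the cloud of particles\<close>

definition pth :: "int \<Rightarrow> (int \<Rightarrow> int) \<Rightarrow> int \<Rightarrow> int" where
  "pth x s n = x + (if 0 \<le> n then (\<Sum>k\<in>{0..<n}. s k) else - (\<Sum>k\<in>{n..<0}. s k))"

lemma path_eq_pth: "path \<omega> x i = pth x (\<lambda>k. Steps \<omega> (x, i, k))"
  by (auto simp: path_def pth_def fun_eq_iff)

lemma pth_0 [simp]: "pth x s 0 = x"
  by (simp add: pth_def)

lemma pth_Suc: "pth x s (n + 1) = pth x s n + s n"
proof (cases "0 \<le> n")
  case True
  then have "{0..<n + 1} = insert n {0..<n}" by auto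
  with True show ?thesis by (simp add: pth_def)
next
  case False
  then have "{n..<0} = insert n {n + 1..<0}" by auto
  with False show ?thesis by (cases "n + 1 = 0") (auto simp: pth_def)
qed

lemma pth_shift: "pth x s (n + t) = pth (pth x s t) (\<lambda>k. s (k + t)) n"
proof (induction n rule: int_induct[where k = 0])
  case (step1 i)
  then show ?case
    using pth_Suc[of x s "i + t"] pth_Suc[of "pth x s t" "\<lambda>k. s (k + t)" i]
    by (simp add: algebra_simps)
next
  case (step2 i)
  then show ?case
    using pth_Suc[of x s "i - 1 + t"] pth_Suc[of "pth x s t" "\<lambda>k. s (k + t)" "i - 1"]
    by (simp add: algebra_simps)
qed simp

lemma pth_add: "pth (x + y) s n = x + pth y s n"
  by (simp add: pth_def)

definition Wsp :: "(int \<Rightarrow> int) measure" where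
  "Wsp = PiM UNIV (\<lambda>_. count_space UNIV)"

definition nu :: "real \<Rightarrow> (int \<Rightarrow> int) measure" where
  "nu q = PiM UNIV (\<lambda>_. measure_pmf (step_pmf q))"

text \<open>The intensity measure of the cloud for \<open>\<rho> = 1\<close>.\<close>
definition mu :: "real \<Rightarrow> (int \<Rightarrow> int) measure" where
  "mu q = distr (count_space UNIV \<Otimes>\<^sub>M nu q) Wsp (\<lambda>(x, s). pth x s)"

lemma space_Wsp [simp]: "space Wsp = UNIV" and space_nu [simp]: "space (nu q) = UNIV"
  and space_mu [simp]: "space (mu q) = UNIV" and sets_mu [measurable_cong, simp]: "sets (mu q) = sets Wsp"
  by (auto simp: Wsp_def nu_def mu_def space_PiM)

lemma sets_nu [measurable_cong, simp]: "sets (nu q) = sets Wsp"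
  unfolding nu_def Wsp_def by (intro sets_PiM_cong) auto

lemma prob_space_nu: "prob_space (nu q)"
  unfolding nu_def by (intro prob_space_PiM prob_space_measure_pmf)

lemma measurable_Wsp_component [measurable]: "(\<lambda>w. w n) \<in> measurable Wsp (count_space UNIV)"
  unfolding Wsp_def by measurable

lemma measurable_count_add [measurable]:
  fixes f g :: "'a \<Rightarrow> int"
  assumes [measurable]: "f \<in> measurable M (count_space UNIV)" "g \<in> measurable M (count_space UNIV)"
  shows "(\<lambda>x. f x + g x) \<in> measurable M (count_space UNIV)"
proof (rule measurable_compose_countable[where f = "\<lambda>i x. i + g x" and g = f])
  show "(\<lambda>x. i + g x) \<in> measurable M (count_space UNIV)" for i
    by (rule measurable_compose[OF assms(2)]) simp
qed fact

lemma measurable_count_uminus [measurable]: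
  fixes f :: "'a \<Rightarrow> int"
  assumes "f \<in> measurable M (count_space UNIV)"
  shows "(\<lambda>x. - f x) \<in> measurable M (count_space UNIV)"
  by (rule measurable_compose[OF assms]) simp

lemma measurable_count_sum [measurable]:
  fixes f :: "'b \<Rightarrow> 'a \<Rightarrow> int"
  assumes "\<And>k. k \<in> K \<Longrightarrow> f k \<in> measurable M (count_space UNIV)"
  shows "(\<lambda>x. \<Sum>k\<in>K. f k x) \<in> measurable M (count_space UNIV)"
  using assms by (induction K rule: infinite_finite_induct) auto

lemma measurable_pth_component:
  assumes [measurable]: "\<And>k. (\<lambda>x. s x k) \<in> measurable M (count_space UNIV)"
  shows "(\<lambda>x. pth y (s x) n) \<in> measurable M (count_space UNIV)"
  unfolding pth_def by (cases "0 \<le> n") auto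

lemma measurable_to_Wsp:
  assumes "\<And>n. (\<lambda>x. f x n) \<in> measurable M (count_space UNIV)"
  shows "f \<in> measurable M Wsp"
  unfolding Wsp_def using assms by (intro measurable_PiM_single') auto

lemma measurable_pth [measurable]: "pth x \<in> measurable Wsp Wsp"
  by (intro measurable_to_Wsp measurable_pth_component) measurable

lemma measurable_pth_pair [measurable]:
  "(\<lambda>(x, s). pth x s) \<in> measurable (count_space UNIV \<Otimes>\<^sub>M Wsp) Wsp"
  by (rule measurable_pair_measure_countable1) auto

lemma mu_eq_nn_integral:
  assumes [measurable]: "B \<in> sets Wsp"
  shows "emeasure (mu q) B = (\<integral>\<^sup>+x. emeasure (nu q) {s. pth x s \<in> B} \<partial>count_space UNIV)"
proof -
  interpret prob_space "nu q" by (rule prob_space_nu)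
  have "emeasure (mu q) B = emeasure (count_space UNIV \<Otimes>\<^sub>M nu q) ((\<lambda>(x, s). pth x s) -` B)"
    unfolding mu_def by (subst emeasure_distr) (auto simp: space_pair_measure)
  also have "\<dots> = (\<integral>\<^sup>+x. emeasure (nu q) (Pair x -` ((\<lambda>(x, s). pth x s) -` B)) \<partial>count_space UNIV)"
  proof (rule emeasure_pair_measure_alt)
    have "(\<lambda>(x, s). pth x s) -` B \<inter> space (count_space UNIV \<Otimes>\<^sub>M nu q) \<in> sets (count_space UNIV \<Otimes>\<^sub>M nu q)"
      by measurable
    then show "(\<lambda>(x, s). pth x s) -` B \<in> sets (count_space UNIV \<Otimes>\<^sub>M nu q)"
      by (simp add: space_pair_measure)
  qed
  also have "\<dots> = (\<integral>\<^sup>+x. emeasure (nu q) {s. pth x s \<in> B} \<partial>count_space UNIV)"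
    by (simp add: vimage_def)
  finally show ?thesis .
qed

lemma nn_integral_mu:
  assumes [measurable]: "f \<in> borel_measurable Wsp"
  shows "(\<integral>\<^sup>+w. f w \<partial>mu q) = (\<integral>\<^sup>+x. \<integral>\<^sup>+s. f (pth x s) \<partial>nu q \<partial>count_space UNIV)"
proof -
  interpret prob_space "nu q" by (rule prob_space_nu)
  have "(\<integral>\<^sup>+w. f w \<partial>mu q) = (\<integral>\<^sup>+z. f (case z of (x, s) \<Rightarrow> pth x s) \<partial>(count_space UNIV \<Otimes>\<^sub>M nu q))"
    unfolding mu_def by (subst nn_integral_distr) auto
  also have "\<dots> = (\<integral>\<^sup>+x. \<integral>\<^sup>+s. f (pth x s) \<partial>nu q \<partial>count_space UNIV)"
    by (subst nn_integral_fst[symmetric]) auto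
  finally show ?thesis .
qed

section \<open>The cloud of particles and the probability that it avoids a set of paths\<close>

type_synonym env = "(int \<Rightarrow> nat) \<times> (int \<times> nat \<times> int \<Rightarrow> int)"

definition NM :: "real \<Rightarrow> (int \<Rightarrow> nat) measure" where
  "NM \<rho> = PiM UNIV (\<lambda>_. measure_pmf (poisson_pmf \<rho>))"

definition SM :: "real \<Rightarrow> (int \<times> nat \<times> int \<Rightarrow> int) measure" where
  "SM q = PiM UNIV (\<lambda>_. measure_pmf (step_pmf q))"

definition EM :: "real \<Rightarrow> real \<Rightarrow> env measure" where
  "EM \<rho> q = NM \<rho> \<Otimes>\<^sub>M SM q"

definition evoid :: "env \<Rightarrow> (int \<Rightarrow> int) set \<Rightarrow> bool" where
  "evoid e B \<longleftrightarrow> (\<forall>x i. i < fst e x \<longrightarrow> pth x (\<lambda>k. snd e (x, i, k)) \<notin> B)"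

lemma space_NM [simp]: "space (NM \<rho>) = UNIV" and space_SM [simp]: "space (SM q) = UNIV"
  and space_EM [simp]: "space (EM \<rho> q) = UNIV"
  by (auto simp: NM_def SM_def EM_def space_PiM space_pair_measure)

lemma prob_space_NM: "prob_space (NM \<rho>)" and prob_space_SM: "prob_space (SM q)"
  unfolding NM_def SM_def by (intro prob_space_PiM prob_space_measure_pmf)+

lemma prob_space_EM: "prob_space (EM \<rho> q)"
  unfolding EM_def by (intro prob_space_pair prob_space_NM prob_space_SM)

lemma measurable_NM_component [measurable]: "(\<lambda>N. N x) \<in> measurable (NM \<rho>) (count_space UNIV)"
proof -
  have "(\<lambda>N. N x) \<in> measurable (NM \<rho>) (measure_pmf (poisson_pmf \<rho>))"
    unfolding NM_def by measurable
  then show ?thesis by simp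
qed

lemma measurable_SM_component [measurable]: "(\<lambda>s. s j) \<in> measurable (SM q) (count_space UNIV)"
proof -
  have "(\<lambda>s. s j) \<in> measurable (SM q) (measure_pmf (step_pmf q))"
    unfolding SM_def by measurable
  then show ?thesis by simp
qed

lemma measurable_SM_block [measurable]: "(\<lambda>s k. s (x, i, k)) \<in> measurable (SM q) Wsp"
  by (intro measurable_to_Wsp) measurable

lemma evoid_measurable [measurable]:
  assumes [measurable]: "B \<in> sets Wsp"
  shows "Measurable.pred (EM \<rho> q) (\<lambda>e. evoid e B)"
proof -
  have [measurable]: "(\<lambda>e. pth x (\<lambda>k. snd e (x, i, k))) \<in> measurable (EM \<rho> q) Wsp" for x i
    unfolding EM_def by (intro measurable_compose[OF _ measurable_pth] measurable_to_Wsp) measurable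
  have [measurable]: "(\<lambda>e. fst e x) \<in> measurable (EM \<rho> q) (count_space UNIV)" for x
    unfolding EM_def by measurable
  show ?thesis unfolding evoid_def by measurable
qed

lemma indep_vars_PiM_coordinates:
  assumes "\<And>i. prob_space (M i)"
  shows "prob_space.indep_vars (PiM (UNIV :: 'i set) M) M (\<lambda>i s. s i) UNIV"
proof -
  interpret P: prob_space "PiM UNIV M" by (intro prob_space_PiM assms)
  have "distr (PiM UNIV M) (PiM UNIV M) (\<lambda>x. \<lambda>i\<in>UNIV. x i) = PiM UNIV M"
    by (simp add: restrict_UNIV distr_id2)
  also have "\<dots> = PiM UNIV (\<lambda>i. distr (PiM UNIV M) (M i) (\<lambda>s. s i))"
    by (intro PiM_cong refl distr_PiM_component[symmetric] assms) auto
  finally show ?thesis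
    by (subst P.indep_vars_iff_distr_eq_PiM) auto
qed

lemma indep_vars_SM_blocks:
  "prob_space.indep_vars (SM q) (\<lambda>_. Wsp) (\<lambda>(x, i) s k. s (x, i, k)) UNIV"
proof -
  interpret prob_space "SM q" by (rule prob_space_SM)
  let ?M = "\<lambda>_::int \<times> nat \<times> int. measure_pmf (step_pmf q)"
  let ?K = "\<lambda>j::int \<times> nat. {(fst j, snd j, k) | k. True}"
  have "indep_vars ?M (\<lambda>j s. s j) UNIV"
    unfolding SM_def by (intro indep_vars_PiM_coordinates prob_space_measure_pmf)
  then have "indep_vars (\<lambda>j. PiM (?K j) ?M) (\<lambda>j s. restrict (\<lambda>i. s i) (?K j)) UNIV"
    by (rule indep_vars_restrict) (auto simp: disjoint_family_on_def)
  then have "indep_vars (\<lambda>_. Wsp) (\<lambda>j s. (\<lambda>g k. g (fst j, snd j, k)) (restrict (\<lambda>i. s i) (?K j))) UNIV"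
  proof (rule indep_vars_compose2)
    fix j :: "int \<times> nat"
    have "(\<lambda>g. g (fst j, snd j, k)) \<in> measurable (PiM (?K j) ?M) (measure_pmf (step_pmf q))" for k
      by (rule measurable_component_singleton) auto
    then show "(\<lambda>g k. g (fst j, snd j, k)) \<in> measurable (PiM (?K j) ?M) Wsp"
      by (intro measurable_to_Wsp) simp
  qed
  also have "(\<lambda>(j::int \<times> nat) s. (\<lambda>g k. g (fst j, snd j, k)) (restrict (\<lambda>i. s i) (?K j)))
    = (\<lambda>(x, i) s k. s (x, i, k))"
    by (auto simp: fun_eq_iff)
  finally show ?thesis .
qed

lemma distr_SM_block: "distr (SM q) Wsp (\<lambda>s k. s (x, i, k)) = nu q"
proof -
  have "distr (SM q) (nu q) (\<lambda>s. \<lambda>k\<in>UNIV. s (x, i, k)) = nu q"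
    unfolding SM_def nu_def
    by (rule distr_PiM_reindex[where f = "\<lambda>k. (x, i, k)" and I = UNIV and K = UNIV and M = "\<lambda>_. measure_pmf (step_pmf q)"])
       (auto intro: prob_space_measure_pmf simp: inj_on_def)
  then show ?thesis
    by (simp add: restrict_UNIV cong: distr_cong)
qed

lemma SM_void_finite:
  assumes [measurable]: "B \<in> sets Wsp" and F: "finite F"
  shows "measure (SM q) {s. \<forall>x\<in>F. \<forall>i<N x. pth x (\<lambda>k. s (x, i, k)) \<notin> B}
    = (\<Prod>x\<in>F. (1 - measure (nu q) {s. pth x s \<in> B}) ^ N x)"
proof -
  interpret S: prob_space "SM q" by (rule prob_space_SM)
  interpret V: prob_space "nu q" by (rule prob_space_nu)
  define J where "J = Sigma F (\<lambda>x. {..<N x})"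
  define A where "A = (\<lambda>j::int \<times> nat. {s. pth (fst j) s \<notin> B})"
  let ?Z = "\<lambda>(x, i) s k. s (x, i, k)"
  have A: "A j \<in> sets Wsp" for j
  proof -
    have "A j = {s \<in> space Wsp. pth (fst j) s \<notin> B}" by (simp add: A_def)
    also have "\<dots> \<in> sets Wsp" by measurable
    finally show ?thesis .
  qed
  have PA: "S.prob (?Z j -` A j \<inter> space (SM q)) = 1 - measure (nu q) {s. pth (fst j) s \<in> B}" for j
  proof -
    obtain x i where j: "j = (x, i)" by (cases j)
    have "measure (nu q) (A j) = S.prob (?Z j -` A j \<inter> space (SM q))"
      using A[of j] measure_distr[of "?Z j" "SM q" Wsp "A j"] distr_SM_block[of q x i] by (simp add: j)
    moreover have "measure (nu q) (A j) = 1 - measure (nu q) {s. pth (fst j) s \<in> B}"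
    proof -
      have "A j = space (nu q) - {s \<in> space (nu q). pth (fst j) s \<in> B}" by (auto simp: A_def)
      moreover have "{s \<in> space (nu q). pth (fst j) s \<in> B} \<in> sets (nu q)" by measurable
      ultimately show ?thesis using V.prob_compl by simp
    qed
    ultimately show ?thesis by simp
  qed
  have fin: "finite J" using F by (simp add: J_def)
  have "S.prob (\<Inter>j\<in>J. ?Z j -` A j \<inter> space (SM q)) = (\<Prod>j\<in>J. S.prob (?Z j -` A j \<inter> space (SM q)))"
    if "J \<noteq> {}"
    using that fin A by (intro S.indep_varsD[OF indep_vars_SM_blocks]) auto
  moreover have "{s. \<forall>x\<in>F. \<forall>i<N x. pth x (\<lambda>k. s (x, i, k)) \<notin> B} = (\<Inter>j\<in>J. ?Z j -` A j \<inter> space (SM q))"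
    by (auto simp: J_def A_def)
  moreover have "(\<Prod>j\<in>J. S.prob (?Z j -` A j \<inter> space (SM q)))
    = (\<Prod>x\<in>F. (1 - measure (nu q) {s. pth x s \<in> B}) ^ N x)"
  proof -
    have "(\<Prod>j\<in>J. S.prob (?Z j -` A j \<inter> space (SM q)))
      = (\<Prod>x\<in>F. \<Prod>i\<in>{..<N x}. 1 - measure (nu q) {s. pth x s \<in> B})"
      unfolding PA J_def using F by (subst prod.Sigma) (auto simp: split_beta)
    then show ?thesis by simp
  qed
  ultimately show ?thesis
    using S.prob_space by (cases "J = {}") auto
qed

lemma poisson_pgf:
  assumes "0 < \<rho>" "0 \<le> a" "a \<le> 1"
  shows "(\<integral>\<^sup>+n. ennreal ((1 - a) ^ n) \<partial>measure_pmf (poisson_pmf \<rho>)) = ennreal (exp (- \<rho> * a))"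
proof -
  have "(\<lambda>n. (\<rho> * (1 - a)) ^ n /\<^sub>R fact n) sums exp (\<rho> * (1 - a))"
    by (rule exp_converges)
  then have "(\<lambda>n. exp (- \<rho>) * ((\<rho> * (1 - a)) ^ n /\<^sub>R fact n)) sums (exp (- \<rho>) * exp (\<rho> * (1 - a)))"
    by (rule sums_mult)
  moreover have "exp (- \<rho>) * ((\<rho> * (1 - a)) ^ n /\<^sub>R fact n) = pmf (poisson_pmf \<rho>) n * (1 - a) ^ n"
    for n
  proof -
    have "(\<rho> * (1 - a)) ^ n = \<rho> ^ n * (1 - a) ^ n" by (rule power_mult_distrib)
    then show ?thesis using pmf_poisson[OF assms(1)] by (simp add: divide_inverse mult_ac)
  qed
  moreover have "exp (- \<rho>) * exp (\<rho> * (1 - a)) = exp (- \<rho> * a)"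
    by (simp add: exp_add[symmetric] algebra_simps)
  ultimately have *: "(\<lambda>n. pmf (poisson_pmf \<rho>) n * (1 - a) ^ n) sums exp (- \<rho> * a)" by simp
  have "(\<integral>\<^sup>+n. ennreal ((1 - a) ^ n) \<partial>measure_pmf (poisson_pmf \<rho>))
    = (\<integral>\<^sup>+n. ennreal (pmf (poisson_pmf \<rho>) n * (1 - a) ^ n) \<partial>count_space UNIV)"
    by (subst nn_integral_measure_pmf) (simp add: ennreal_mult')
  also have "\<dots> = (\<Sum>n. ennreal (pmf (poisson_pmf \<rho>) n * (1 - a) ^ n))"
    by (rule nn_integral_count_space_nat)
  also have "\<dots> = ennreal (exp (- \<rho> * a))"
    using assms * by (intro suminf_ennreal_eq) auto
  finally show ?thesis .
qed

text \<open>Given the counts, a particle from x avoids \<open>B\<close> with probability 1 - a x,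
  independently of the others; averaging over the Poisson count turns (1 - a x)^N into exp(-\<rho> a
  x).\<close>

lemma EM_void_finite:
  assumes [measurable]: "B \<in> sets Wsp" and F: "finite F" and \<rho>: "0 < \<rho>"
  shows "emeasure (EM \<rho> q) {e :: env. \<forall>x\<in>F. \<forall>i<fst e x. pth x (\<lambda>k. snd e (x, i, k)) \<notin> B}
    = ennreal (exp (- \<rho> * (\<Sum>x\<in>F. measure (nu q) {s. pth x s \<in> B})))"
proof -
  interpret S: prob_space "SM q" by (rule prob_space_SM)
  interpret P: prob_space "NM \<rho>" by (rule prob_space_NM)
  interpret V: prob_space "nu q" by (rule prob_space_nu)
  define a where "a = (\<lambda>x. measure (nu q) {s. pth x s \<in> B})"
  have a: "0 \<le> a x" "a x \<le> 1" for x by (auto simp: a_def)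
  define X where "X = {e :: env. \<forall>x\<in>F. \<forall>i<fst e x. pth x (\<lambda>k. snd e (x, i, k)) \<notin> B}"
  have [measurable]: "X \<in> sets (EM \<rho> q)"
  proof -
    have [measurable]: "(\<lambda>e. pth x (\<lambda>k. snd e (x, i, k))) \<in> measurable (EM \<rho> q) Wsp" for x i
      unfolding EM_def by (intro measurable_compose[OF _ measurable_pth] measurable_to_Wsp) measurable
    have [measurable]: "(\<lambda>e. fst e x) \<in> measurable (EM \<rho> q) (count_space UNIV)" for x
      unfolding EM_def by measurable
    have "X = {e \<in> space (EM \<rho> q). \<forall>x\<in>F. \<forall>i. i < fst e x \<longrightarrow> pth x (\<lambda>k. snd e (x, i, k)) \<notin> B}"
      by (auto simp: X_def)
    also have "\<dots> \<in> sets (EM \<rho> q)" using F by measurable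
    finally show ?thesis .
  qed
  have "emeasure (EM \<rho> q) X = (\<integral>\<^sup>+N. emeasure (SM q) (Pair N -` X) \<partial>NM \<rho>)"
    unfolding EM_def by (rule S.emeasure_pair_measure_alt, fold EM_def) measurable
  also have "\<dots> = (\<integral>\<^sup>+N. ennreal (\<Prod>x\<in>F. (1 - a x) ^ N x) \<partial>NM \<rho>)"
    using SM_void_finite[OF assms(1) F, of q]
    by (auto simp: X_def vimage_def a_def S.emeasure_eq_measure intro!: nn_integral_cong)
  also have "\<dots> = (\<integral>\<^sup>+N. (\<Prod>x\<in>F. ennreal ((1 - a x) ^ N x)) \<partial>NM \<rho>)"
    using a by (intro nn_integral_cong) (simp add: prod_ennreal)
  also have "\<dots> = (\<Prod>x\<in>F. \<integral>\<^sup>+N. ennreal ((1 - a x) ^ N x) \<partial>NM \<rho>)"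
  proof -
    have "P.indep_vars (\<lambda>_. measure_pmf (poisson_pmf \<rho>)) (\<lambda>x N. N x) UNIV"
      unfolding NM_def by (rule indep_vars_PiM_coordinates) (rule prob_space_measure_pmf)
    then have "P.indep_vars (\<lambda>_. borel) (\<lambda>x N. ennreal ((1 - a x) ^ N x)) UNIV"
      by (rule P.indep_vars_compose2) auto
    then have "P.indep_vars (\<lambda>_. borel) (\<lambda>x N. ennreal ((1 - a x) ^ N x)) F"
      by (rule P.indep_vars_subset) auto
    then show ?thesis using F a by (intro P.indep_vars_nn_integral) auto
  qed
  also have "\<dots> = (\<Prod>x\<in>F. ennreal (exp (- \<rho> * a x)))"
  proof (rule prod.cong[OF refl])
    fix x
    have "distr (NM \<rho>) (measure_pmf (poisson_pmf \<rho>)) (\<lambda>N. N x) = measure_pmf (poisson_pmf \<rho>)"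
      unfolding NM_def by (rule distr_PiM_component) (auto intro: prob_space_measure_pmf)
    then have "(\<integral>\<^sup>+n. ennreal ((1 - a x) ^ n) \<partial>measure_pmf (poisson_pmf \<rho>))
      = (\<integral>\<^sup>+N. ennreal ((1 - a x) ^ N x) \<partial>NM \<rho>)"
      by (subst nn_integral_distr[symmetric, where f = "\<lambda>n. ennreal ((1 - a x) ^ n)"
            and M = "NM \<rho>" and M' = "measure_pmf (poisson_pmf \<rho>)"]) auto
    then show "(\<integral>\<^sup>+N. ennreal ((1 - a x) ^ N x) \<partial>NM \<rho>) = ennreal (exp (- \<rho> * a x))"
      using poisson_pgf[OF \<rho> a] by simp
  qed
  also have "\<dots> = ennreal (exp (- \<rho> * (\<Sum>x\<in>F. a x)))"
    using F by (simp add: prod_ennreal exp_sum[symmetric] sum_distrib_left sum_negf)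
  finally show ?thesis unfolding X_def a_def .
qed

text \<open>The starting sites are exhausted by finite windows. Finite intensity matters: otherwise
  \<open>measure\<close> would return its default value 0 and the formula would be wrong.\<close>

lemma EM_void:
  assumes B: "B \<in> sets Wsp" "emeasure (mu q) B < \<infinity>" and \<rho>: "0 < \<rho>"
  shows "measure (EM \<rho> q) {e. evoid e B} = exp (- \<rho> * measure (mu q) B)"
proof -
  note [measurable] = B(1)
  interpret E: prob_space "EM \<rho> q" by (rule prob_space_EM)
  interpret V: prob_space "nu q" by (rule prob_space_nu)
  define a where "a = (\<lambda>x. measure (nu q) {s. pth x s \<in> B})"
  define F where "F = (\<lambda>n. {- int n..int n})"
  define X where "X = (\<lambda>n. {e :: env. \<forall>x\<in>F n. \<forall>i<fst e x. pth x (\<lambda>k. snd e (x, i, k)) \<notin> B})"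
  have X: "measure (EM \<rho> q) (X n) = exp (- \<rho> * (\<Sum>x\<in>F n. a x))" for n
    using EM_void_finite[OF B(1), of "F n" \<rho> q] \<rho>
    by (simp add: X_def a_def F_def E.emeasure_eq_measure)
  \<comment> \<open>A set outside the sigma-algebra has \<open>emeasure\<close> 0, whereas the value
    just computed is a positive exponential.\<close>
  have "X n \<in> sets (EM \<rho> q)" for n
    using EM_void_finite[OF B(1), of "F n" \<rho> q] \<rho> emeasure_notin_sets[of "X n" "EM \<rho> q"]
    by (force simp: X_def F_def)
  moreover have "decseq X"
    by (auto simp: decseq_def X_def F_def)
  ultimately have "(\<lambda>n. measure (EM \<rho> q) (X n)) \<longlonglongrightarrow> measure (EM \<rho> q) (\<Inter>n. X n)"
    by (intro E.finite_Lim_measure_decseq) auto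
  also have "(\<Inter>n. X n) = {e. evoid e B}"
  proof -
    have "\<exists>n. x \<in> F n" for x by (rule exI[of _ "nat \<bar>x\<bar>"]) (auto simp: F_def)
    then show ?thesis by (fastforce simp: X_def evoid_def)
  qed
  finally have lim: "(\<lambda>n. exp (- \<rho> * (\<Sum>x\<in>F n. a x))) \<longlonglongrightarrow> measure (EM \<rho> q) {e. evoid e B}"
    unfolding X .
  have mu: "(\<integral>\<^sup>+x. ennreal (a x) \<partial>count_space UNIV) = emeasure (mu q) B"
    by (simp add: mu_eq_nn_integral V.emeasure_eq_measure a_def)
  have "(\<lambda>n. \<integral>\<^sup>+x. ennreal (a x) * indicator (F n) x \<partial>count_space UNIV) \<longlonglongrightarrow> (\<integral>\<^sup>+x. ennreal (a x) \<partial>count_space UNIV)"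
  proof (rule nn_integral_LIMSEQ)
    show "incseq (\<lambda>n x. ennreal (a x) * indicator (F n) x)"
      by (auto simp: incseq_def le_fun_def F_def split: split_indicator)
    fix x
    have "eventually (\<lambda>n. ennreal (a x) * indicator (F n) x = ennreal (a x)) sequentially"
      using eventually_ge_at_top[of "nat \<bar>x\<bar>"]
      by eventually_elim (auto simp: F_def split: split_indicator)
    then show "(\<lambda>n. ennreal (a x) * indicator (F n) x) \<longlonglongrightarrow> ennreal (a x)"
      by (rule tendsto_eventually)
  qed auto
  moreover have "(\<integral>\<^sup>+x. ennreal (a x) * indicator (F n) x \<partial>count_space UNIV) = ennreal (\<Sum>x\<in>F n. a x)" for n
  proof -
    have "(\<integral>\<^sup>+x. ennreal (a x) * indicator (F n) x \<partial>count_space UNIV) = (\<integral>\<^sup>+x. ennreal (a x) \<partial>count_space (F n))"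
      by (subst nn_integral_count_space_indicator) auto
    also have "\<dots> = ennreal (\<Sum>x\<in>F n. a x)"
      by (subst nn_integral_count_space_finite) (auto simp: F_def a_def)
    finally show ?thesis .
  qed
  ultimately have "(\<lambda>n. ennreal (\<Sum>x\<in>F n. a x)) \<longlonglongrightarrow> ennreal (measure (mu q) B)"
    using mu B(2) by (simp add: emeasure_eq_ennreal_measure less_top[symmetric])
  then have "(\<lambda>n. \<Sum>x\<in>F n. a x) \<longlonglongrightarrow> measure (mu q) B"
    by (subst (asm) tendsto_ennreal_iff) (auto simp: a_def sum_nonneg)
  then have "(\<lambda>n. exp (- \<rho> * (\<Sum>x\<in>F n. a x))) \<longlonglongrightarrow> exp (- \<rho> * measure (mu q) B)"
    by (intro tendsto_intros)
  then show ?thesis using lim LIMSEQ_unique by blast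
qed

section \<open>The intensity measure: shift invariance and crossings\<close>

lemma distr_nu_shift: "distr (nu q) (nu q) (\<lambda>s k. s (k + t)) = nu q"
proof -
  have "distr (nu q) (nu q) (\<lambda>s. \<lambda>k\<in>UNIV. s (k + t)) = nu q"
    unfolding nu_def
    by (rule distr_PiM_reindex[where f = "\<lambda>k. k + t" and I = UNIV and K = UNIV and M = "\<lambda>_. measure_pmf (step_pmf q)"])
       (auto intro: prob_space_measure_pmf simp: inj_on_def)
  then show ?thesis by (simp add: restrict_UNIV)
qed

lemma measurable_shift_Wsp [measurable]: "(\<lambda>s k. s (k + t)) \<in> measurable Wsp Wsp"
  by (intro measurable_to_Wsp) measurable

text \<open>For fixed increments, adding \<open>pth y s t\<close> to the start permutes the
  integers, so counting measure absorbs both the translation and the displacement up to time t. What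
  remains is an index shift of i.i.d. increments.\<close>

lemma nn_integral_mu_shift:
  assumes [measurable]: "f \<in> borel_measurable Wsp"
  shows "(\<integral>\<^sup>+w. f (\<lambda>n. w (n + t) + y) \<partial>mu q) = (\<integral>\<^sup>+w. f w \<partial>mu q)"
proof -
  let ?sh = "\<lambda>(s :: int \<Rightarrow> int) k. s (k + t)"
  have [measurable]: "(\<lambda>w n. w (n + t) + y) \<in> measurable Wsp Wsp"
    by (intro measurable_to_Wsp) measurable
  have [measurable]: "(\<lambda>s. pth (x + pth y s t) (?sh s)) \<in> measurable Wsp Wsp" for x
    by (intro measurable_to_Wsp) (simp add: pth_add[of x] pth_shift[symmetric] pth_add[of y], measurable)
  have [measurable]: "(\<lambda>s. pth x (?sh s)) \<in> measurable Wsp Wsp" for x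
    by (intro measurable_compose[OF measurable_shift_Wsp measurable_pth])
  have eq: "(\<lambda>n. pth x s (n + t) + y) = pth (x + pth y s t) (?sh s)" for x s
    using pth_shift[of x s _ t] pth_add[of y x s t] pth_add[of x y s t] pth_add[of y "pth x s t" "?sh s"]
    by (auto simp: fun_eq_iff add_ac)
  have "(\<integral>\<^sup>+w. f (\<lambda>n. w (n + t) + y) \<partial>mu q)
    = (\<integral>\<^sup>+x. \<integral>\<^sup>+s. f (pth (x + pth y s t) (?sh s)) \<partial>nu q \<partial>count_space UNIV)"
    by (subst nn_integral_mu) (simp_all add: eq)
  also have "\<dots> = (\<integral>\<^sup>+s. \<integral>\<^sup>+x. f (pth (x + pth y s t) (?sh s)) \<partial>count_space UNIV \<partial>nu q)"
    by (subst nn_integral_count_space_nn_integral) auto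
  also have "\<dots> = (\<integral>\<^sup>+s. \<integral>\<^sup>+x. f (pth x (?sh s)) \<partial>count_space UNIV \<partial>nu q)"
  proof (rule nn_integral_cong)
    fix s
    have "bij (\<lambda>x. x + pth y s t)"
      by (rule bij_betwI[where g = "\<lambda>x. x - pth y s t"]) auto
    then show "(\<integral>\<^sup>+x. f (pth (x + pth y s t) (?sh s)) \<partial>count_space UNIV) = (\<integral>\<^sup>+x. f (pth x (?sh s)) \<partial>count_space UNIV)"
      by (rule nn_integral_bij_count_space)
  qed
  also have "\<dots> = (\<integral>\<^sup>+x. \<integral>\<^sup>+s. f (pth x (?sh s)) \<partial>nu q \<partial>count_space UNIV)"
    by (subst nn_integral_count_space_nn_integral) auto
  also have "\<dots> = (\<integral>\<^sup>+x. \<integral>\<^sup>+s. f (pth x s) \<partial>nu q \<partial>count_space UNIV)"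
  proof (rule nn_integral_cong)
    fix x
    have "(\<integral>\<^sup>+s. f (pth x s) \<partial>nu q) = (\<integral>\<^sup>+s. f (pth x s) \<partial>distr (nu q) (nu q) ?sh)"
      by (simp only: distr_nu_shift)
    also have "\<dots> = (\<integral>\<^sup>+s. f (pth x (?sh s)) \<partial>nu q)"
      by (rule nn_integral_distr) auto
    finally show "(\<integral>\<^sup>+s. f (pth x (?sh s)) \<partial>nu q) = (\<integral>\<^sup>+s. f (pth x s) \<partial>nu q)" by simp
  qed
  also have "\<dots> = (\<integral>\<^sup>+w. f w \<partial>mu q)"
    by (simp add: nn_integral_mu)
  finally show ?thesis .
qed

lemma mu_shift:
  assumes [measurable]: "B \<in> sets Wsp"
  shows "emeasure (mu q) {w. (\<lambda>n. w (n + t) + y) \<in> B} = emeasure (mu q) B"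
proof -
  have [measurable]: "(\<lambda>w n. w (n + t) + y) \<in> measurable Wsp Wsp"
    by (intro measurable_to_Wsp) measurable
  let ?S = "{w. (\<lambda>n. w (n + t) + y) \<in> B}"
  have "{w \<in> space Wsp. (\<lambda>n. w (n + t) + y) \<in> B} \<in> sets Wsp" by measurable
  then have "emeasure (mu q) ?S = (\<integral>\<^sup>+w. indicator ?S w \<partial>mu q)" by simp
  also have "\<dots> = (\<integral>\<^sup>+w. indicator B (\<lambda>n. w (n + t) + y) \<partial>mu q)"
    by (intro nn_integral_cong) (simp add: indicator_def)
  also have "\<dots> = (\<integral>\<^sup>+w. indicator B w \<partial>mu q)"
    by (rule nn_integral_mu_shift) measurable
  finally show ?thesis by simp
qed

section \<open>Exponential moments of the lazy walk and the crossing estimate\<close>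

lemma cosh_le_exp_square:
  fixes x :: real
  assumes "0 \<le> x"
  shows "(exp x + exp (- x)) / 2 \<le> exp (x\<^sup>2 / 2)"
proof -
  \<comment> \<open>Hoeffding's lemma for a symmetric sign: weight 1/2 and interval length
    2x.\<close>
  have "- (2 * x) * (1 / 2) + ln (1 + 1 / 2 * (exp (2 * x) - 1)) \<le> (2 * x)\<^sup>2 / 8"
    using assms by (intro Hoeffdings_lemma_aux) auto
  then have "ln ((1 + exp (2 * x)) / 2) \<le> x + x\<^sup>2 / 2"
    by (simp add: power2_eq_square field_simps)
  then have "(1 + exp (2 * x)) / 2 \<le> exp (x + x\<^sup>2 / 2)"
    using exp_le_cancel_iff[of "ln ((1 + exp (2 * x)) / 2)" "x + x\<^sup>2 / 2"]
    by (simp add: add_pos_pos)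
  then have "exp (- x) * ((1 + exp (2 * x)) / 2) \<le> exp (- x) * exp (x + x\<^sup>2 / 2)"
    by (intro mult_left_mono) auto
  then show ?thesis
    by (simp add: exp_add[symmetric] distrib_left add_divide_distrib)
qed

text \<open>Holding contributes 1 to the moment, which is below the bound for a symmetric sign as
  well.\<close>

lemma step_pmf_mgf:
  assumes "0 < q" "q < 1" "0 \<le> \<theta>"
  shows "(\<integral>\<^sup>+k. ennreal (exp (\<theta> * real_of_int k)) \<partial>measure_pmf (step_pmf q)) \<le> ennreal (exp (\<theta>\<^sup>2 / 2))"
proof -
  define C where "C = (exp \<theta> + exp (- \<theta>)) / 2"
  have C: "C \<le> exp (\<theta>\<^sup>2 / 2)" "0 \<le> C"
    using cosh_le_exp_square[OF assms(3)] by (auto simp: C_def)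
  have 1: "(\<integral>\<^sup>+k. ennreal (exp (\<theta> * real_of_int k)) \<partial>measure_pmf (step_pmf q))
    = ennreal q + ennreal (1 - q) * ennreal C"
  proof -
    have "(\<integral>\<^sup>+k. ennreal (exp (\<theta> * real_of_int k)) \<partial>measure_pmf (map_pmf (\<lambda>c. if c then 1 else - 1) (bernoulli_pmf (1 / 2))))
       = ennreal (exp \<theta>) * ennreal (1 / 2) + ennreal (exp (- \<theta>)) * ennreal (1 - 1 / 2)"
      by (subst nn_integral_map_pmf, subst nn_integral_bernoulli_pmf) auto
    also have "\<dots> = ennreal (exp \<theta> * (1 / 2) + exp (- \<theta>) * (1 - 1 / 2))"
      by (subst (1 2) ennreal_mult[symmetric], simp, simp, simp, simp, rule ennreal_plus[symmetric]) auto
    also have "\<dots> = ennreal C" by (simp add: C_def add_divide_distrib)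
    finally have "(\<integral>\<^sup>+k. ennreal (exp (\<theta> * real_of_int k)) \<partial>measure_pmf (map_pmf (\<lambda>c. if c then 1 else - 1) (bernoulli_pmf (1 / 2))))
       = ennreal C" .
    then show ?thesis
      using assms unfolding step_pmf_def
      by (simp add: mult.commute del: nn_integral_map_pmf)
  qed
  have "ennreal q + ennreal (1 - q) * ennreal C = ennreal (q + (1 - q) * C)"
    using assms C by (simp add: ennreal_mult[symmetric])
  also have "\<dots> \<le> ennreal (exp (\<theta>\<^sup>2 / 2))"
  proof (rule ennreal_leI)
    have "q * 1 + (1 - q) * C \<le> q * exp (\<theta>\<^sup>2 / 2) + (1 - q) * exp (\<theta>\<^sup>2 / 2)"
      using assms C by (intro add_mono mult_left_mono) auto
    then show "q + (1 - q) * C \<le> exp (\<theta>\<^sup>2 / 2)" by (simp add: algebra_simps)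
  qed
  finally show ?thesis using 1 by simp
qed

lemma nu_mgf:
  assumes "0 < q" "q < 1" "0 \<le> \<theta>"
  shows "(\<integral>\<^sup>+s. ennreal (exp (\<theta> * real_of_int (pth 0 s (int m)))) \<partial>nu q) \<le> ennreal (exp (\<theta>\<^sup>2 / 2 * real m))"
proof -
  interpret prob_space "nu q" by (rule prob_space_nu)
  let ?g = "\<lambda>k s. ennreal (exp (\<theta> * real_of_int (s (k :: int))))"
  have "(\<integral>\<^sup>+s. ennreal (exp (\<theta> * real_of_int (pth 0 s (int m)))) \<partial>nu q)
    = (\<integral>\<^sup>+s. (\<Prod>k\<in>{0..<int m}. ?g k s) \<partial>nu q)"
    by (intro nn_integral_cong) (simp add: pth_def prod_ennreal exp_sum[symmetric] sum_distrib_left)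
  also have "\<dots> = (\<Prod>k\<in>{0..<int m}. \<integral>\<^sup>+s. ?g k s \<partial>nu q)"
  proof (rule indep_vars_nn_integral)
    have "indep_vars (\<lambda>_. measure_pmf (step_pmf q)) (\<lambda>k s. s k) UNIV"
      unfolding nu_def by (rule indep_vars_PiM_coordinates) (rule prob_space_measure_pmf)
    then have "indep_vars (\<lambda>_. borel) ?g UNIV"
      by (rule indep_vars_compose2) auto
    then show "indep_vars (\<lambda>_. borel) ?g {0..<int m}"
      by (rule indep_vars_subset) auto
  qed auto
  also have "\<dots> = (\<Prod>k\<in>{0..<int m}. \<integral>\<^sup>+j. ennreal (exp (\<theta> * real_of_int j)) \<partial>measure_pmf (step_pmf q))"
  proof (rule prod.cong[OF refl])
    fix k
    have "distr (nu q) (measure_pmf (step_pmf q)) (\<lambda>s. s k) = measure_pmf (step_pmf q)"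
      unfolding nu_def by (rule distr_PiM_component) (auto intro: prob_space_measure_pmf)
    moreover have "(\<lambda>s. s k) \<in> measurable (nu q) (measure_pmf (step_pmf q))"
      unfolding nu_def by (rule measurable_component_singleton) simp
    ultimately show "(\<integral>\<^sup>+s. ?g k s \<partial>nu q) = (\<integral>\<^sup>+j. ennreal (exp (\<theta> * real_of_int j)) \<partial>measure_pmf (step_pmf q))"
      by (subst nn_integral_distr[symmetric, where f = "\<lambda>j. ennreal (exp (\<theta> * real_of_int j))"
            and M = "nu q" and M' = "measure_pmf (step_pmf q)"]) auto
  qed
  also have "\<dots> \<le> ennreal (exp (\<theta>\<^sup>2 / 2)) ^ m"
    unfolding prod_constant card_atLeastLessThan_int using step_pmf_mgf[OF assms] by (simp add: power_mono)
  also have "\<dots> = ennreal (exp (\<theta>\<^sup>2 / 2 * real m))"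
    by (subst ennreal_power) (auto simp only: exp_of_nat_mult[symmetric] mult.commute exp_ge_zero)
  finally show ?thesis .
qed

text \<open>List the integers below \<alpha> downwards from the largest one; the j-th term is at
  most exp(-\<theta>)^j.\<close>

lemma nn_integral_exp_below:
  assumes "0 < \<theta>"
  shows "(\<integral>\<^sup>+x. ennreal (exp (\<theta> * (real_of_int x - \<alpha>))) * indicator {x. real_of_int x < \<alpha>} x \<partial>count_space UNIV)
    \<le> ennreal (1 / (1 - exp (- \<theta>)))"
proof -
  let ?h = "\<lambda>j::nat. \<lceil>\<alpha>\<rceil> - 1 - int j"
  have bij: "bij_betw ?h UNIV {x. real_of_int x < \<alpha>}"
  proof (rule bij_betwI[where g = "\<lambda>x. nat (\<lceil>\<alpha>\<rceil> - 1 - x)"])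
    show "?h \<in> UNIV \<rightarrow> {x. real_of_int x < \<alpha>}" by (auto simp: less_ceiling_iff[symmetric])
    show "?h (nat (\<lceil>\<alpha>\<rceil> - 1 - x)) = x" if "x \<in> {x. real_of_int x < \<alpha>}" for x
      using that by (auto simp: less_ceiling_iff[symmetric])
  qed auto
  have "(\<integral>\<^sup>+x. ennreal (exp (\<theta> * (real_of_int x - \<alpha>))) * indicator {x. real_of_int x < \<alpha>} x \<partial>count_space UNIV)
    = (\<integral>\<^sup>+x. ennreal (exp (\<theta> * (real_of_int x - \<alpha>))) \<partial>count_space {x. real_of_int x < \<alpha>})"
    by (subst nn_integral_count_space_indicator) auto
  also have "\<dots> = (\<integral>\<^sup>+j. ennreal (exp (\<theta> * (real_of_int (?h j) - \<alpha>))) \<partial>count_space UNIV)"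
    by (rule nn_integral_bij_count_space[OF bij, symmetric])
  also have "\<dots> \<le> (\<integral>\<^sup>+j. ennreal (exp (- \<theta>) ^ j) \<partial>count_space UNIV)"
  proof (intro nn_integral_mono ennreal_leI)
    fix j
    have "real_of_int (?h j) - \<alpha> \<le> - real j" by linarith
    then have "\<theta> * (real_of_int (?h j) - \<alpha>) \<le> \<theta> * (- real j)"
      using assms by (intro mult_left_mono) auto
    also have "\<dots> = real j * - \<theta>" by simp
    finally show "exp (\<theta> * (real_of_int (?h j) - \<alpha>)) \<le> exp (- \<theta>) ^ j"
      unfolding exp_of_nat_mult[symmetric] by simp
  qed
  also have "\<dots> = (\<Sum>j. ennreal (exp (- \<theta>) ^ j))" by (rule nn_integral_count_space_nat)
  also have "\<dots> = ennreal (1 / (1 - exp (- \<theta>)))"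
    using assms by (intro suminf_ennreal_eq geometric_sums) auto
  finally show ?thesis .
qed

text \<open>An exponential Markov bound; summing over the starting points costs only a geometric series.\<close>
lemma mu_climb:
  assumes q: "0 < q" "q < 1" and \<theta>: "0 < \<theta>" and n: "n \<le> n'"
  shows "emeasure (mu q) {w. real_of_int (w n) < \<alpha> \<and> \<beta> \<le> real_of_int (w n')}
    \<le> ennreal (exp (\<theta> * (\<alpha> - \<beta>)) * exp (\<theta>\<^sup>2 / 2 * real_of_int (n' - n)) / (1 - exp (- \<theta>)))"
proof -
  define m where "m = nat (n' - n)"
  have m: "n' - n = int m" using n by (simp add: m_def)
  define B where "B = {w :: int \<Rightarrow> int. real_of_int (w 0) < \<alpha> \<and> \<beta> \<le> real_of_int (w (int m))}"
  have [measurable]: "B \<in> sets Wsp"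
  proof -
    have "B = {w \<in> space Wsp. real_of_int (w 0) < \<alpha> \<and> \<beta> \<le> real_of_int (w (int m))}" by (simp add: B_def)
    also have "\<dots> \<in> sets Wsp" by measurable
    finally show ?thesis .
  qed
  let ?E = "\<lambda>s. ennreal (exp (\<theta> * real_of_int (pth 0 s (int m))))"
  let ?I = "\<lambda>x. ennreal (exp (\<theta> * (real_of_int x - \<alpha>))) * indicator {x. real_of_int x < \<alpha>} x"
  have [measurable]: "?E \<in> borel_measurable Wsp"
    using measurable_pth_component[of "\<lambda>s. s" Wsp 0 "int m"] by measurable
  have "{w. real_of_int (w n) < \<alpha> \<and> \<beta> \<le> real_of_int (w n')} = {w. (\<lambda>k. w (k + n) + 0) \<in> B}"
    using m by (auto simp: B_def diff_eq_eq)
  then have "emeasure (mu q) {w. real_of_int (w n) < \<alpha> \<and> \<beta> \<le> real_of_int (w n')} = emeasure (mu q) B"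
    using mu_shift[of B q n 0] by simp
  also have "\<dots> = (\<integral>\<^sup>+w. indicator B w \<partial>mu q)"
    by simp
  also have "\<dots> = (\<integral>\<^sup>+x. \<integral>\<^sup>+s. indicator B (pth x s) \<partial>nu q \<partial>count_space UNIV)"
    by (rule nn_integral_mu) measurable
  also have "\<dots> \<le> (\<integral>\<^sup>+x. \<integral>\<^sup>+s. (ennreal (exp (\<theta> * (\<alpha> - \<beta>))) * ?I x) * ?E s \<partial>nu q \<partial>count_space UNIV)"
  proof (intro nn_integral_mono)
    fix x s
    show "indicator B (pth x s) \<le> (ennreal (exp (\<theta> * (\<alpha> - \<beta>))) * ?I x) * ?E s"
    proof (cases "pth x s \<in> B")
      case True
      then have x: "real_of_int x < \<alpha>" and b: "\<beta> \<le> real_of_int x + real_of_int (pth 0 s (int m))"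
        using pth_add[of x 0 s "int m"] by (auto simp: B_def)
      have "0 \<le> \<theta> * (real_of_int x + real_of_int (pth 0 s (int m)) - \<beta>)" using b \<theta> by simp
      also have "\<dots> = \<theta> * (\<alpha> - \<beta>) + \<theta> * (real_of_int x - \<alpha>) + \<theta> * real_of_int (pth 0 s (int m))"
        by (simp add: algebra_simps)
      finally have "1 \<le> exp (\<theta> * (\<alpha> - \<beta>)) * exp (\<theta> * (real_of_int x - \<alpha>)) * exp (\<theta> * real_of_int (pth 0 s (int m)))"
        by (simp add: exp_add[symmetric])
      then show ?thesis
        using True x by (simp add: ennreal_mult[symmetric] ennreal_1[symmetric] del: ennreal_1)
    qed simp
  qed
  also have "\<dots> = (\<integral>\<^sup>+x. (ennreal (exp (\<theta> * (\<alpha> - \<beta>))) * ?I x) * (\<integral>\<^sup>+s. ?E s \<partial>nu q) \<partial>count_space UNIV)"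
    by (intro nn_integral_cong nn_integral_cmult) measurable
  also have "\<dots> = ennreal (exp (\<theta> * (\<alpha> - \<beta>))) * (\<integral>\<^sup>+x. ?I x \<partial>count_space UNIV) * (\<integral>\<^sup>+s. ?E s \<partial>nu q)"
    by (subst nn_integral_multc, simp, subst nn_integral_cmult) auto
  also have "\<dots> \<le> ennreal (exp (\<theta> * (\<alpha> - \<beta>))) * ennreal (1 / (1 - exp (- \<theta>))) * ennreal (exp (\<theta>\<^sup>2 / 2 * real m))"
    using \<theta> q by (intro mult_mono nn_integral_exp_below nu_mgf) auto
  also have "\<dots> = ennreal (exp (\<theta> * (\<alpha> - \<beta>)) * exp (\<theta>\<^sup>2 / 2 * real_of_int (n' - n)) / (1 - exp (- \<theta>)))"
    using \<theta> m by (simp add: ennreal_mult[symmetric])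
  finally show ?thesis .
qed

definition tch :: "(int \<times> int) set \<Rightarrow> (int \<Rightarrow> int) set" where
  "tch C = {w. \<exists>n. (w n, n) \<in> C}"

lemma tch_mono: "C \<subseteq> D \<Longrightarrow> tch C \<subseteq> tch D"
  by (auto simp: tch_def)

lemma tch_sets [measurable]: "tch C \<in> sets Wsp"
proof -
  have "Measurable.pred Wsp (\<lambda>w. (w n, n) \<in> C)" for n
    by (rule measurable_compose[OF measurable_Wsp_component[of n]]) simp
  then have "{w \<in> space Wsp. \<exists>n. (w n, n) \<in> C} \<in> sets Wsp" by measurable
  then show ?thesis by (simp add: tch_def)
qed

lemma Wcross_eq_tch: "Wcross v y = tch (cone v y) \<inter> tch (rcone v y)"
  by (auto simp: Wcross_def tch_def trace_def)

text \<open>The constant of \<open>mu_cross\<close>: the prefactor of \<open>mu_climb\<close> at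
  \<theta> = v, times two geometric series of ratio exp(-v^2/2), one over times before y and one
  over times after z.\<close>

definition crossK :: "real \<Rightarrow> real" where
  "crossK v = 1 / (1 - exp (- v)) * (1 / (1 - exp (- v\<^sup>2 / 2)))\<^sup>2"

lemma crossK_pos: "0 < v \<Longrightarrow> 0 < crossK v"
  by (auto simp: crossK_def)

text \<open>\<open>mu_climb\<close> with \<theta> = v: a time span D between the two visits
  contributes -v^2 D through the slope of the cones and +v^2 D/2 through the exponential moment. The
  net -v^2 D/2 makes the union over both visiting times summable, since the order of y and z in time
  gives D \<ge> i + j.\<close>

lemma mu_cross:
  assumes q: "0 < q" "q < 1" and v: "0 < v" and yz: "snd y \<le> snd z"
  shows "emeasure (mu q) (tch (rcone v y) \<inter> tch (cone v z)) \<le> ennreal (crossK v * exp (- v * (ht v z - ht v y)))"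
proof -
  define r where "r = exp (- v\<^sup>2 / 2)"
  have r: "0 \<le> r" "r < 1" using v by (auto simp: r_def)
  define G where "G = exp (- v * (ht v z - ht v y)) / (1 - exp (- v))"
  have G: "0 \<le> G" using v by (auto simp: G_def)
  define A where "A = (\<lambda>i j. {w :: int \<Rightarrow> int. real_of_int (w (snd y - int i)) < ht v y + v * (snd y - int i)
      \<and> ht v z + v * (snd z + int j) \<le> real_of_int (w (snd z + int j))})"
  have [measurable]: "A i j \<in> sets Wsp" for i j
  proof -
    have "{w \<in> space Wsp. real_of_int (w (snd y - int i)) < ht v y + v * (snd y - int i)
      \<and> ht v z + v * (snd z + int j) \<le> real_of_int (w (snd z + int j))} \<in> sets Wsp" by measurable
    then show ?thesis by (simp add: A_def)
  qed
  have A: "emeasure (mu q) (A i j) \<le> ennreal (G * r ^ i * r ^ j)" for i j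
  proof -
    define D where "D = real_of_int ((snd z + int j) - (snd y - int i))"
    have D: "real i + real j \<le> D" using yz by (simp add: D_def)
    have "emeasure (mu q) (A i j) \<le> ennreal (exp (v * (ht v y + v * (snd y - int i) - (ht v z + v * (snd z + int j))))
        * exp (v\<^sup>2 / 2 * D) / (1 - exp (- v)))"
      unfolding A_def D_def using yz by (intro mu_climb q v) auto
    also have "\<dots> \<le> ennreal (G * r ^ i * r ^ j)"
    proof (rule ennreal_leI)
      have "v * (ht v y + v * (snd y - int i) - (ht v z + v * (snd z + int j))) + v\<^sup>2 / 2 * D
        = - v * (ht v z - ht v y) - v\<^sup>2 / 2 * D"
        by (simp add: D_def algebra_simps power2_eq_square)
      also have "\<dots> \<le> - v * (ht v z - ht v y) - v\<^sup>2 / 2 * (real i + real j)"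
        using D by (intro diff_left_mono mult_left_mono) auto
      finally have "exp (v * (ht v y + v * (snd y - int i) - (ht v z + v * (snd z + int j)))) * exp (v\<^sup>2 / 2 * D)
        \<le> exp (- v * (ht v z - ht v y) - v\<^sup>2 / 2 * (real i + real j))"
        unfolding exp_add[symmetric] by simp
      also have "\<dots> = exp (- v * (ht v z - ht v y) + real i * (- v\<^sup>2 / 2) + real j * (- v\<^sup>2 / 2))"
        by (simp add: algebra_simps)
      also have "\<dots> = exp (- v * (ht v z - ht v y)) * r ^ i * r ^ j"
        unfolding exp_add exp_of_nat_mult r_def by simp
      finally have "exp (v * (ht v y + v * (snd y - int i) - (ht v z + v * (snd z + int j)))) * exp (v\<^sup>2 / 2 * D) / (1 - exp (- v))
        \<le> exp (- v * (ht v z - ht v y)) * r ^ i * r ^ j / (1 - exp (- v))"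
        using v by (intro divide_right_mono) auto
      then show "exp (v * (ht v y + v * (snd y - int i) - (ht v z + v * (snd z + int j)))) * exp (v\<^sup>2 / 2 * D) / (1 - exp (- v))
        \<le> G * r ^ i * r ^ j"
        by (simp add: G_def)
    qed
    finally show ?thesis .
  qed
  have "tch (rcone v y) \<inter> tch (cone v z) \<subseteq> (\<Union>i. \<Union>j. A i j)"
  proof safe
    fix w assume "w \<in> tch (rcone v y)" "w \<in> tch (cone v z)"
    then obtain n n' where n: "(w n, n) \<in> rcone v y" "(w n', n') \<in> cone v z" by (auto simp: tch_def)
    define i j where "i = nat (snd y - n)" and "j = nat (n' - snd z)"
    have "n = snd y - int i" "n' = snd z + int j"
      using n unfolding mem_cone_iff[OF v] mem_rcone_iff[OF v] by (auto simp: i_def j_def)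
    then have "w \<in> A i j"
      using n unfolding mem_cone_iff[OF v] mem_rcone_iff[OF v] by (auto simp: A_def ht_def[of v "(_, _)"])
    then show "w \<in> (\<Union>i. \<Union>j. A i j)" by blast
  qed
  then have "emeasure (mu q) (tch (rcone v y) \<inter> tch (cone v z)) \<le> emeasure (mu q) (\<Union>i. \<Union>j. A i j)"
    by (rule emeasure_mono) simp
  also have "\<dots> \<le> (\<Sum>i. emeasure (mu q) (\<Union>j. A i j))"
    by (rule emeasure_subadditive_countably) auto
  also have "\<dots> \<le> (\<Sum>i. ennreal (G * r ^ i * (1 / (1 - r))))"
  proof (rule suminf_le)
    fix i
    have "emeasure (mu q) (\<Union>j. A i j) \<le> (\<Sum>j. emeasure (mu q) (A i j))"
      by (rule emeasure_subadditive_countably) auto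
    also have "\<dots> \<le> (\<Sum>j. ennreal (G * r ^ i * r ^ j))"
      by (rule suminf_le) (auto intro: A)
    also have "\<dots> = ennreal (G * r ^ i * (1 / (1 - r)))"
      using r G by (intro suminf_ennreal_eq sums_mult geometric_sums) auto
    finally show "emeasure (mu q) (\<Union>j. A i j) \<le> ennreal (G * r ^ i * (1 / (1 - r)))" .
  qed auto
  also have "\<dots> = ennreal (G * (1 / (1 - r)) * (1 / (1 - r)))"
    using r G by (intro suminf_ennreal_eq sums_mult sums_mult2 geometric_sums) auto
  also have "G * (1 / (1 - r)) * (1 / (1 - r)) = crossK v * exp (- v * (ht v z - ht v y))"
    by (simp add: G_def crossK_def r_def power2_eq_square)
  finally show ?thesis .
qed

definition through :: "int \<times> int \<Rightarrow> (int \<Rightarrow> int) set" where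
  "through z = {w. w (snd z) = fst z}"

lemma through_sets [measurable]: "through z \<in> sets Wsp"
proof -
  have "{w \<in> space Wsp. w (snd z) = fst z} \<in> sets Wsp" by measurable
  then show ?thesis by (simp add: through_def)
qed

text \<open>By stationarity only time 0 matters, where exactly the paths started at
  \<open>fst z\<close> count. Single-site events thus have finite intensity.\<close>

lemma mu_through: "emeasure (mu q) (through z) = 1"
proof -
  interpret prob_space "nu q" by (rule prob_space_nu)
  have "through z = {w. (\<lambda>n. w (n + snd z) + 0) \<in> through (fst z, 0)}" by (simp add: through_def)
  then have "emeasure (mu q) (through z) = emeasure (mu q) (through (fst z, 0))"
    using mu_shift[OF through_sets, of q "snd z" 0 "(fst z, 0)"] by simp
  also have "\<dots> = (\<integral>\<^sup>+x. indicator {fst z} x \<partial>count_space UNIV)"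
  proof (subst mu_eq_nn_integral[OF through_sets], rule nn_integral_cong)
    fix x
    have "{s :: int \<Rightarrow> int. pth x s \<in> through (fst z, 0)} = (if x = fst z then UNIV else {})"
      by (auto simp: through_def)
    then show "emeasure (nu q) {s. pth x s \<in> through (fst z, 0)} = indicator {fst z} x"
      using emeasure_space_1 by simp
  qed
  finally show ?thesis by simp
qed

section \<open>Independence and translation invariance\<close>

definition U1 :: "real measure" where "U1 = uniform_measure lborel {0..1}"

definition UM :: "(int \<times> int \<Rightarrow> real) measure" where "UM = PiM UNIV (\<lambda>_. U1)"

lemma PP_eq: "PP \<rho> q = EM \<rho> q \<Otimes>\<^sub>M UM"
  by (simp add: PP_def EM_def NM_def SM_def UM_def U1_def)

lemma space_U1 [simp]: "space U1 = UNIV" and sets_U1 [measurable_cong, simp]: "sets U1 = sets borel"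
  by (auto simp: U1_def)

lemma space_UM [simp]: "space UM = UNIV"
  by (auto simp: UM_def space_PiM)

lemma space_PP [simp]: "space (PP \<rho> q) = UNIV"
  by (simp add: PP_eq space_pair_measure)

lemma prob_space_U1: "prob_space U1"
  unfolding U1_def by (intro prob_space_uniform_measure) auto

lemma prob_space_UM: "prob_space UM"
  unfolding UM_def by (intro prob_space_PiM prob_space_U1)

lemma prob_space_PP: "prob_space (PP \<rho> q)"
  unfolding PP_eq by (intro prob_space_pair prob_space_EM prob_space_UM)

lemma U1_atMost:
  assumes "0 \<le> p" "p \<le> 1"
  shows "measure U1 {..p} = p"
proof -
  have "{0..1} \<inter> {..p} = {0..p}" using assms by auto
  then show ?thesis
    using assms by (simp add: U1_def measure_uniform_measure)
qed

section \<open>Void events, thinned environments and the sigma-algebras they generate\<close>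

definition cvoid :: "config \<Rightarrow> (int \<Rightarrow> int) set \<Rightarrow> bool" where
  "cvoid \<omega> B \<longleftrightarrow> evoid (fst \<omega>) B"

lemma cvoid_iff: "cvoid \<omega> B \<longleftrightarrow> (\<forall>x i. i < Ncnt \<omega> x \<longrightarrow> path \<omega> x i \<notin> B)"
  by (simp add: cvoid_def evoid_def path_eq_pth Ncnt_def Steps_def)

lemma cvoid_mono: "cvoid \<omega> B \<Longrightarrow> B' \<subseteq> B \<Longrightarrow> cvoid \<omega> B'"
  by (auto simp: cvoid_iff)

lemma cvoid_Un: "cvoid \<omega> (B \<union> B') \<longleftrightarrow> cvoid \<omega> B \<and> cvoid \<omega> B'"
  by (auto simp: cvoid_iff)

lemma cvoid_empty [simp]: "cvoid \<omega> {}"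
  by (auto simp: cvoid_iff)

lemma omega_count_eq_0: "omega_count \<omega> B = 0 \<longleftrightarrow> cvoid \<omega> B"
proof -
  define S where "S = {(x, i). i < Ncnt \<omega> x \<and> path \<omega> x i \<in> B}"
  have "omega_count \<omega> B = 0 \<longleftrightarrow> S = {}"
    by (auto simp: omega_count_def S_def[symmetric] Let_def zero_enat_def)
  then show ?thesis by (auto simp: S_def cvoid_iff)
qed

text \<open>The sites occupied by the thinned cloud of particles whose whole path lies in
  \<open>A\<close>, phrased through void events so that it is measurable for
  \<open>Gm\<close>.\<close>

definition Tres :: "(int \<Rightarrow> int) set \<Rightarrow> config \<Rightarrow> (int \<times> int) set" where
  "Tres A \<omega> = {z. \<not> cvoid \<omega> (A \<inter> through z)}"

text \<open>The value 0 off \<open>S\<close> is a placeholder that removes dependence on unknown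
  variables; the events below are arranged so that the relevant walk reads sites of
  \<open>S\<close>.\<close>

definition Ures :: "(int \<times> int) set \<Rightarrow> config \<Rightarrow> int \<times> int \<Rightarrow> real" where
  "Ures S \<omega> z = (if z \<in> S then Unif \<omega> z else 0)"

lemma Tset_eq_Tres: "Tset \<omega> = Tres UNIV \<omega>"
  by (force simp: Tset_def Tres_def cvoid_iff through_def)

text \<open>A particle occupying a site of \<open>C\<close> has its path in \<open>tch C\<close>, so
  only such particles in the symmetric difference of \<open>A\<close> and \<open>A'\<close> could
  make the two thinned clouds differ there.\<close>

lemma Tres_cong:
  assumes "cvoid \<omega> (tch C \<inter> (A - A'))" "cvoid \<omega> (tch C \<inter> (A' - A))" "z \<in> C"
  shows "z \<in> Tres A \<omega> \<longleftrightarrow> z \<in> Tres A' \<omega>"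
proof -
  have "through z \<subseteq> tch C" 
  proof
    fix w assume "w \<in> through z"
    then have "(w (snd z), snd z) = z" by (simp add: through_def)
    then show "w \<in> tch C" using assms(3) unfolding tch_def by (intro CollectI exI[of _ "snd z"]) simp
  qed
  then show ?thesis using assms(1,2) unfolding Tres_def cvoid_iff by blast
qed

definition obs :: "(int \<Rightarrow> int) set \<Rightarrow> (int \<times> int) set \<Rightarrow> (int \<times> int \<Rightarrow> real set) \<Rightarrow> config set" where
  "obs B F C = {\<omega>. cvoid \<omega> B \<and> (\<forall>z\<in>F. Unif \<omega> z \<in> C z)}"

lemma obs_Int:
  "obs B F C \<inter> obs B' F' C'
    = obs (B \<union> B') (F \<union> F') (\<lambda>z. (if z \<in> F then C z else UNIV) \<inter> (if z \<in> F' then C' z else UNIV))"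
  by (auto simp: obs_def cvoid_Un split: if_splits)

text \<open>A pi-system on which probabilities are explicit: finite intensity and finite
  \<open>F\<close> make \<open>prob_obs\<close> applicable.\<close>

definition gens :: "real \<Rightarrow> (int \<Rightarrow> int) set \<Rightarrow> (int \<times> int) set \<Rightarrow> config set set" where
  "gens q A S = {obs B F C | B F C. B \<in> sets Wsp \<and> B \<subseteq> A \<and> emeasure (mu q) B < \<infinity> \<and> finite F \<and> F \<subseteq> S
     \<and> (\<forall>z. C z \<in> sets borel)}"

text \<open>What is known from the particles with path in \<open>A\<close> and the uniform variables
  at \<open>S\<close>. Void events suffice, since the walk and the crossing condition never count
  particles.\<close>

definition Gm :: "real \<Rightarrow> (int \<Rightarrow> int) set \<Rightarrow> (int \<times> int) set \<Rightarrow> config measure" where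
  "Gm q A S = sigma UNIV (gens q A S)"

lemma space_Gm [simp]: "space (Gm q A S) = UNIV"
  by (simp add: Gm_def)

lemma sets_Gm: "sets (Gm q A S) = sigma_sets UNIV (gens q A S)"
  by (simp add: Gm_def)

lemma measurable_fst_PP [measurable]: "fst \<in> measurable (PP \<rho> q) (EM \<rho> q)"
  unfolding PP_eq by measurable

lemma cvoid_measurable [measurable]:
  assumes [measurable]: "B \<in> sets Wsp"
  shows "Measurable.pred (PP \<rho> q) (\<lambda>\<omega>. cvoid \<omega> B)"
  unfolding cvoid_def by measurable

lemma Unif_measurable [measurable]: "(\<lambda>\<omega>. Unif \<omega> z) \<in> borel_measurable (PP \<rho> q)"
proof -
  have "(\<lambda>u. u z) \<in> measurable UM U1" unfolding UM_def by measurable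
  then have "(\<lambda>u. u z) \<in> borel_measurable UM" by (simp cong: measurable_cong_sets)
  moreover have "snd \<in> measurable (PP \<rho> q) UM" unfolding PP_eq by measurable
  ultimately show ?thesis unfolding Unif_def by measurable
qed

lemma obs_sets [measurable]:
  assumes [measurable]: "B \<in> sets Wsp" "finite F" "\<And>z. C z \<in> sets borel"
  shows "obs B F C \<in> sets (PP \<rho> q)"
proof -
  have "obs B F C = {\<omega> \<in> space (PP \<rho> q). cvoid \<omega> B \<and> (\<forall>z\<in>F. Unif \<omega> z \<in> C z)}" by (simp add: obs_def)
  also have "\<dots> \<in> sets (PP \<rho> q)" using assms(2) by measurable
  finally show ?thesis .
qed

lemma prob_obs:
  assumes B [measurable]: "B \<in> sets Wsp" "emeasure (mu q) B < \<infinity>"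
    and F: "finite F" and C: "\<And>z. C z \<in> sets borel" and \<rho>: "0 < \<rho>"
  shows "measure (PP \<rho> q) (obs B F C) = exp (- \<rho> * measure (mu q) B) * (\<Prod>z\<in>F. measure U1 (C z))"
proof -
  interpret U: prob_space UM by (rule prob_space_UM)
  interpret U1: prob_space U1 by (rule prob_space_U1)
  interpret E: prob_space "EM \<rho> q" by (rule prob_space_EM)
  interpret P: prob_space "PP \<rho> q" by (rule prob_space_PP)
  have emb: "{u. \<forall>z\<in>F. u z \<in> C z} = prod_emb UNIV (\<lambda>_. U1) F (Pi\<^sub>E F C)"
    by (auto simp: prod_emb_def space_PiM PiE_iff)
  have "prod_emb UNIV (\<lambda>_. U1) F (Pi\<^sub>E F C) \<in> sets UM"
    unfolding UM_def using F C by (intro sets_PiM_I) auto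
  moreover have "{e. evoid e B} \<in> sets (EM \<rho> q)"
    using measurable_sets[OF evoid_measurable[OF B(1), of \<rho> q], of "{True}"] by (simp add: vimage_def)
  moreover have "obs B F C = {e. evoid e B} \<times> {u. \<forall>z\<in>F. u z \<in> C z}"
    by (auto simp: obs_def cvoid_def Unif_def)
  ultimately have "emeasure (PP \<rho> q) (obs B F C)
    = emeasure (EM \<rho> q) {e. evoid e B} * emeasure UM (prod_emb UNIV (\<lambda>_. U1) F (Pi\<^sub>E F C))"
    unfolding PP_eq emb by (simp add: U.emeasure_pair_measure_Times)
  also have "emeasure UM (prod_emb UNIV (\<lambda>_. U1) F (Pi\<^sub>E F C)) = (\<Prod>z\<in>F. emeasure U1 (C z))"
    unfolding UM_def using F C by (intro emeasure_PiM_emb prob_space_U1) auto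
  finally show ?thesis
    using EM_void[OF B \<rho>]
    by (simp add: E.emeasure_eq_measure P.emeasure_eq_measure U1.emeasure_eq_measure prod_ennreal
        prod_nonneg ennreal_mult[symmetric])
qed

lemma prob_not_cvoid_le:
  assumes B: "B \<in> sets Wsp" "emeasure (mu q) B \<le> ennreal b" and \<rho>: "0 < \<rho>" and b: "0 \<le> b"
  shows "measure (PP \<rho> q) {\<omega>. \<not> cvoid \<omega> B} \<le> \<rho> * b"
    and "exp (- \<rho> * b) \<le> exp (- \<rho> * measure (mu q) B)"
proof -
  interpret P: prob_space "PP \<rho> q" by (rule prob_space_PP)
  have fin: "emeasure (mu q) B < \<infinity>" using B(2) by (simp add: order_le_less_trans)
  have m: "measure (mu q) B \<le> b"
    unfolding measure_def using B(2) b by (simp add: enn2real_leI)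
  then show "exp (- \<rho> * b) \<le> exp (- \<rho> * measure (mu q) B)" using \<rho> by simp
  have "measure (PP \<rho> q) {\<omega>. \<not> cvoid \<omega> B} = 1 - measure (PP \<rho> q) (obs B {} (\<lambda>_. UNIV))"
    using P.prob_compl[OF obs_sets[OF B(1), of "{}" "\<lambda>_. UNIV"]] by (simp add: obs_def Compl_eq_Diff_UNIV[symmetric] Collect_neg_eq)
  also have "\<dots> = 1 - exp (- \<rho> * measure (mu q) B)"
    using prob_obs[OF B(1) fin, of "{}" "\<lambda>_. UNIV", OF _ _ \<rho>] by simp
  also have "\<dots> \<le> \<rho> * measure (mu q) B"
    using exp_ge_add_one_self[of "- \<rho> * measure (mu q) B"] by simp
  also have "\<dots> \<le> \<rho> * b" using m \<rho> by simp
  finally show "measure (PP \<rho> q) {\<omega>. \<not> cvoid \<omega> B} \<le> \<rho> * b" .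
qed

lemma Int_stable_gens: "Int_stable (gens q A S)"
proof (rule Int_stableI)
  fix a b assume "a \<in> gens q A S" "b \<in> gens q A S"
  then obtain B F C B' F' C' where 1: "a = obs B F C" "b = obs B' F' C'"
    and B: "B \<in> sets Wsp" "B \<subseteq> A" "emeasure (mu q) B < \<infinity>" "B' \<in> sets Wsp" "B' \<subseteq> A" "emeasure (mu q) B' < \<infinity>"
    and F: "finite F" "F \<subseteq> S" "finite F'" "F' \<subseteq> S" "\<forall>z. C z \<in> sets borel" "\<forall>z. C' z \<in> sets borel"
    unfolding gens_def by blast
  have "emeasure (mu q) (B \<union> B') \<le> emeasure (mu q) B + emeasure (mu q) B'"
    using B by (intro emeasure_subadditive) auto
  also have "\<dots> < \<infinity>" using B by simp
  finally have "emeasure (mu q) (B \<union> B') < \<infinity>" .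
  then show "a \<inter> b \<in> gens q A S"
    unfolding 1 obs_Int gens_def mem_Collect_eq using B F
    by (intro exI[of _ "B \<union> B'"] exI[of _ "F \<union> F'"]
        exI[of _ "\<lambda>z. (if z \<in> F then C z else UNIV) \<inter> (if z \<in> F' then C' z else UNIV)"]) auto
qed

lemma gens_subset_PP: "gens q A S \<subseteq> sets (PP \<rho> q)"
  unfolding gens_def by (auto intro!: obs_sets)

lemma sets_Gm_subset: "sets (Gm q A S) \<subseteq> sets (PP \<rho> q)"
  unfolding sets_Gm using gens_subset_PP[of q A S \<rho>] sets.sigma_sets_subset[of "gens q A S" "PP \<rho> q"] by simp

text \<open>Poisson thinning: on the generators, exp(-\<rho> mu(B)) turns disjoint unions of path
  sets into products, and stability under intersection extends this to the sigma-algebras.\<close>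

lemma Gm_indep:
  assumes \<rho>: "0 < \<rho>" and AA: "A \<inter> A' = {}" and SS: "S \<inter> S' = {}"
    and E: "E \<in> sets (Gm q A S)" "E' \<in> sets (Gm q A' S')"
  shows "measure (PP \<rho> q) (E \<inter> E') = measure (PP \<rho> q) E * measure (PP \<rho> q) E'"
proof -
  interpret P: prob_space "PP \<rho> q" by (rule prob_space_PP)
  have "P.indep_set (gens q A S) (gens q A' S')"
  proof (rule P.indep_setI)
    fix a b assume "a \<in> gens q A S" "b \<in> gens q A' S'"
    then obtain B F C B' F' C' where 1: "a = obs B F C" "b = obs B' F' C'"
      and B: "B \<in> sets Wsp" "B \<subseteq> A" "emeasure (mu q) B < \<infinity>" "B' \<in> sets Wsp" "B' \<subseteq> A'" "emeasure (mu q) B' < \<infinity>"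
      and F: "finite F" "F \<subseteq> S" "finite F'" "F' \<subseteq> S'" "\<forall>z. C z \<in> sets borel" "\<forall>z. C' z \<in> sets borel"
      unfolding gens_def by blast
    let ?C = "\<lambda>z. (if z \<in> F then C z else UNIV) \<inter> (if z \<in> F' then C' z else UNIV)"
    have dis: "B \<inter> B' = {}" "F \<inter> F' = {}" using B F AA SS by auto
    have "emeasure (mu q) (B \<union> B') = emeasure (mu q) B + emeasure (mu q) B'"
      using B dis by (intro plus_emeasure[symmetric]) auto
    then have fin: "emeasure (mu q) (B \<union> B') < \<infinity>" using B by simp
    have "measure (mu q) (B \<union> B') = measure (mu q) B + measure (mu q) B'"
      using B dis by (intro measure_Union) auto
    moreover have "(\<Prod>z\<in>F \<union> F'. measure U1 (?C z)) = (\<Prod>z\<in>F. measure U1 (C z)) * (\<Prod>z\<in>F'. measure U1 (C' z))"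
    proof (subst prod.union_disjoint)
      show "(\<Prod>z\<in>F. measure U1 (?C z)) * (\<Prod>z\<in>F'. measure U1 (?C z))
         = (\<Prod>z\<in>F. measure U1 (C z)) * (\<Prod>z\<in>F'. measure U1 (C' z))"
        using dis by (intro arg_cong2[where f = "(*)"] prod.cong arg_cong[where f = "measure U1"]) auto
    qed (use F dis in auto)
    moreover have "P.prob (obs (B \<union> B') (F \<union> F') ?C) = exp (- \<rho> * measure (mu q) (B \<union> B')) * (\<Prod>z\<in>F \<union> F'. measure U1 (?C z))"
      using B F fin \<rho> by (intro prob_obs) auto
    moreover have "P.prob (obs B F C) = exp (- \<rho> * measure (mu q) B) * (\<Prod>z\<in>F. measure U1 (C z))"
      using B F \<rho> by (intro prob_obs) auto
    moreover have "P.prob (obs B' F' C') = exp (- \<rho> * measure (mu q) B') * (\<Prod>z\<in>F'. measure U1 (C' z))"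
      using B F \<rho> by (intro prob_obs) auto
    moreover have "exp (- \<rho> * (x + y)) = exp (- \<rho> * x) * exp (- \<rho> * y)" for x y
      by (simp add: exp_add[symmetric] algebra_simps)
    ultimately show "P.prob (a \<inter> b) = P.prob a * P.prob b"
      unfolding 1 obs_Int by simp
  qed (rule gens_subset_PP)+
  then have "P.indep_set (sigma_sets (space (PP \<rho> q)) (gens q A S)) (sigma_sets (space (PP \<rho> q)) (gens q A' S'))"
    by (rule P.indep_set_sigma_sets) (rule Int_stable_gens)+
  then show ?thesis
    using E by (intro P.indep_setD) (auto simp: sets_Gm)
qed

lemma cvoid_measurable_Gm:
  assumes "B \<in> sets Wsp" "B \<subseteq> A" "emeasure (mu q) B < \<infinity>"
  shows "Measurable.pred (Gm q A S) (\<lambda>\<omega>. cvoid \<omega> B)"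
proof -
  have "obs B {} (\<lambda>_. UNIV) \<in> gens q A S"
    unfolding gens_def mem_Collect_eq using assms
    by (intro exI[of _ B] exI[of _ "{}"] exI[of _ "\<lambda>_. UNIV"]) auto
  then have "{\<omega> \<in> space (Gm q A S). cvoid \<omega> B} \<in> sets (Gm q A S)" by (simp add: sets_Gm obs_def)
  then show ?thesis by (simp add: pred_def)
qed

lemma Ures_measurable_Gm [measurable]: "(\<lambda>\<omega>. Ures S \<omega> z) \<in> borel_measurable (Gm q A S)"
proof (cases "z \<in> S")
  case True
  have "(\<lambda>\<omega>. Unif \<omega> z) -` C \<in> sets (Gm q A S)" if "C \<in> sets borel" for C
  proof -
    have "obs {} {z} (\<lambda>_. C) \<in> gens q A S" using True that unfolding gens_def by fastforce
    moreover have "obs {} {z} (\<lambda>_. C) = (\<lambda>\<omega>. Unif \<omega> z) -` C" by (auto simp: obs_def)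
    ultimately show ?thesis by (auto simp: sets_Gm)
  qed
  then show ?thesis using True by (auto simp: measurable_def Ures_def)
qed (simp add: Ures_def)

lemma Tres_measurable_Gm:
  assumes "A' \<in> sets Wsp" "A' \<subseteq> A"
  shows "Measurable.pred (Gm q A S) (\<lambda>\<omega>. z \<in> Tres A' \<omega>)"
proof -
  have "emeasure (mu q) (A' \<inter> through z) \<le> emeasure (mu q) (through z)"
    by (intro emeasure_mono) auto
  also have "\<dots> < \<infinity>" by (simp add: mu_through)
  finally have "Measurable.pred (Gm q A S) (\<lambda>\<omega>. cvoid \<omega> (A' \<inter> through z))"
    using assms by (intro cvoid_measurable_Gm) auto
  then show ?thesis unfolding Tres_def by simp
qed

lemma Tres_measurable [measurable]:
  assumes [measurable]: "A \<in> sets Wsp"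
  shows "Measurable.pred (PP \<rho> q) (\<lambda>\<omega>. z \<in> Tres A \<omega>)"
  unfolding Tres_def by simp

lemma Ywalk_measurable:
  assumes [measurable]: "\<And>z. Measurable.pred M (\<lambda>\<omega>. z \<in> T \<omega>)" "\<And>z. (\<lambda>\<omega>. U \<omega> z) \<in> borel_measurable M"
  shows "(\<lambda>\<omega>. Ywalk (T \<omega>) (U \<omega>) po pb y i) \<in> measurable M (count_space UNIV)"
proof (induction i)
  case (Suc i)
  note [measurable] = Suc
  have "(\<lambda>\<omega>. if (z \<in> T \<omega> \<and> U \<omega> z \<le> pb) \<or> (z \<notin> T \<omega> \<and> U \<omega> z \<le> po)
      then (fst z + 1, snd z + 1) else (fst z - 1, snd z + 1)) \<in> measurable M (count_space UNIV)" for z :: "int \<times> int"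
    by measurable
  from measurable_compose_countable[OF this Suc] show ?case by (simp add: Let_def)
qed simp

section \<open>Translation invariance of the occupied sites and of the walk\<close>

lemma Ywalk_translate:
  "Ywalk T U po pb (y + z) i = y + Ywalk {z. y + z \<in> T} (\<lambda>z. U (y + z)) po pb z i"
proof (induction i)
  case (Suc i)
  then show ?case by (auto simp: Let_def plus_prod_def)
qed simp

abbreviation Bsp :: "(int \<times> int \<Rightarrow> bool) measure" where
  "Bsp \<equiv> PiM UNIV (\<lambda>_. count_space UNIV)"

definition Tlaw :: "real \<Rightarrow> real \<Rightarrow> int \<times> int \<Rightarrow> (int \<times> int \<Rightarrow> bool) measure" where
  "Tlaw \<rho> q y = distr (EM \<rho> q) Bsp (\<lambda>e z. \<not> evoid e (through (y + z)))"

text \<open>Events that finitely many sites are empty form the pi-system on which the law of the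
  occupied set is known from void probabilities.\<close>

lemma sets_Bsp: "sets Bsp = sigma_sets UNIV {{f. \<forall>z\<in>F. \<not> f z} | F. finite F}" (is "_ = sigma_sets UNIV ?G")
proof
  have 1: "{f. \<not> f z} \<in> sigma_sets UNIV ?G" for z :: "int \<times> int"
  proof -
    have "{f. \<not> f z} = {f. \<forall>z\<in>{z}. \<not> f z}" by simp
    then show ?thesis by (intro sigma_sets.Basic) blast
  qed
  show "sets Bsp \<subseteq> sigma_sets UNIV ?G"
    unfolding sets_PiM_single
  proof (simp add: space_PiM, rule sigma_sets_mono, safe)
    fix z :: "int \<times> int" and A :: "bool set"
    have "{f. f z} = UNIV - {f. \<not> f z}" by auto
    then have 2: "{f. f z} \<in> sigma_sets UNIV ?G" using sigma_sets.Compl[OF 1[of z]] by simp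
    have "A = {} \<or> A = UNIV \<or> A = {True} \<or> A = {False}" by (cases "True \<in> A"; cases "False \<in> A") (auto, metis+)
    then show "{f. f z \<in> A} \<in> sigma_sets UNIV ?G"
      using 1[of z] 2 sigma_sets_top[of UNIV ?G] sigma_sets.Empty[of UNIV ?G] by auto
  qed
  have "{f. \<forall>z\<in>F. \<not> f z} \<in> sets Bsp" if "finite F" for F :: "(int \<times> int) set"
  proof -
    have "{f \<in> space Bsp. \<forall>z\<in>F. \<not> f z} \<in> sets Bsp" using that by measurable
    then show ?thesis by (simp add: space_PiM)
  qed
  then show "sigma_sets UNIV ?G \<subseteq> sets Bsp"
    using sets.sigma_sets_subset[of ?G Bsp] by (auto simp: space_PiM)
qed

lemma Tlaw_measurable [measurable]: "(\<lambda>e z. \<not> evoid e (through (y + z))) \<in> measurable (EM \<rho> q) Bsp"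
  by (rule measurable_PiM_single') auto

text \<open>The set of occupied sites is stationary, because its void probabilities are.\<close>
lemma Tlaw_eq:
  assumes "0 < \<rho>"
  shows "Tlaw \<rho> q y = Tlaw \<rho> q 0"
proof (rule measure_eqI_generator_eq[where E = "{{f. \<forall>z\<in>F. \<not> f z} | F. finite F}" and \<Omega> = UNIV and A = "\<lambda>_. UNIV"])
  interpret E: prob_space "EM \<rho> q" by (rule prob_space_EM)
  show "Int_stable {{f :: int \<times> int \<Rightarrow> bool. \<forall>z\<in>F. \<not> f z} | F. finite F}"
  proof (rule Int_stableI, safe)
    fix F F' :: "(int \<times> int) set" assume "finite F" "finite F'"
    then show "\<exists>F''. {f. \<forall>z\<in>F. \<not> f z} \<inter> {f. \<forall>z\<in>F'. \<not> f z} = {f. \<forall>z\<in>F''. \<not> f z} \<and> finite F''"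
      by (intro exI[of _ "F \<union> F'"]) auto
  qed
  show "sets (Tlaw \<rho> q y) = sigma_sets UNIV {{f. \<forall>z\<in>F. \<not> f z} | F. finite F}"
    and "sets (Tlaw \<rho> q 0) = sigma_sets UNIV {{f. \<forall>z\<in>F. \<not> f z} | F. finite F}"
    by (simp_all add: Tlaw_def sets_Bsp)
  show "range (\<lambda>_. UNIV) \<subseteq> {{f :: int \<times> int \<Rightarrow> bool. \<forall>z\<in>F. \<not> f z} | F. finite F}"
    by (auto intro!: exI[of _ "{}"])
  show "emeasure (Tlaw \<rho> q y) UNIV \<noteq> \<infinity>"
  proof -
    have "prob_space (Tlaw \<rho> q y)" unfolding Tlaw_def by (intro E.prob_space_distr) measurable
    then have "emeasure (Tlaw \<rho> q y) (space (Tlaw \<rho> q y)) = 1" by (rule prob_space.emeasure_space_1)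
    then show ?thesis by (simp add: Tlaw_def space_PiM)
  qed
  fix X assume "X \<in> {{f :: int \<times> int \<Rightarrow> bool. \<forall>z\<in>F. \<not> f z} | F. finite F}"
  then obtain F where F: "finite F" "X = {f. \<forall>z\<in>F. \<not> f z}" by blast
  define B where "B = (\<lambda>y. \<Union>z\<in>F. through (y + z))"
  have B: "B y \<in> sets Wsp" for y unfolding B_def using F(1) by (intro sets.finite_UN) auto
  have X: "X \<in> sets Bsp" using F by (auto simp: sets_Bsp)
  have "measure (Tlaw \<rho> q y) X = exp (- \<rho> * measure (mu q) (B y))" for y
  proof -
    have "emeasure (mu q) (B y) \<le> (\<Sum>z\<in>F. emeasure (mu q) (through (y + z)))"
      unfolding B_def using F by (intro emeasure_subadditive_finite) auto
    also have "\<dots> < \<infinity>" by (simp add: mu_through ennreal_of_nat_eq_real_of_nat)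
    finally have fin: "emeasure (mu q) (B y) < \<infinity>" .
    have "measure (Tlaw \<rho> q y) X = measure (EM \<rho> q) {e. evoid e (B y)}"
    proof -
      have "measure (Tlaw \<rho> q y) X = measure (EM \<rho> q) ((\<lambda>e z. \<not> evoid e (through (y + z))) -` X \<inter> space (EM \<rho> q))"
        unfolding Tlaw_def by (rule measure_distr[OF Tlaw_measurable X])
      also have "(\<lambda>e z. \<not> evoid e (through (y + z))) -` X \<inter> space (EM \<rho> q) = {e. evoid e (B y)}"
        by (auto simp: F(2) B_def evoid_def)
      finally show ?thesis .
    qed
    also have "\<dots> = exp (- \<rho> * measure (mu q) (B y))"
      by (rule EM_void[OF B fin assms])
    finally show ?thesis .
  qed
  moreover have "emeasure (mu q) (B y) = emeasure (mu q) (B 0)"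
  proof -
    have "{w. (\<lambda>n. w (n + snd y) + - fst y) \<in> B 0} = B y"
      by (auto simp: B_def through_def add.commute algebra_simps)
    then show ?thesis using mu_shift[OF B[of 0], of q "snd y" "- fst y"] by simp
  qed
  then have "measure (mu q) (B y) = measure (mu q) (B 0)" by (simp add: measure_def)
  moreover have "emeasure (Tlaw \<rho> q y) X = ennreal (measure (Tlaw \<rho> q y) X)" for y
    by (intro finite_measure.emeasure_eq_measure) (auto simp: Tlaw_def intro: E.finite_measure_distr)
  ultimately show "emeasure (Tlaw \<rho> q y) X = emeasure (Tlaw \<rho> q 0) X" by simp
qed auto

lemma distr_UM_shift: "distr UM UM (\<lambda>u z. u (y + z)) = UM"
proof -
  have "distr UM UM (\<lambda>u. \<lambda>z\<in>UNIV. u (y + z)) = UM"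
    unfolding UM_def
    by (rule distr_PiM_reindex[where f = "\<lambda>z. y + z" and I = UNIV and K = UNIV and M = "\<lambda>_. U1"])
       (auto intro: prob_space_U1 simp: inj_on_def)
  then show ?thesis by (simp add: restrict_UNIV)
qed

text \<open>The walk relative to its start is one fixed function of the environment seen from y,
  whose law does not depend on y. This carries ballisticity from the origin to every site.\<close>

lemma Ywalk_law:
  assumes \<rho>: "0 < \<rho>" and D: "D \<in> sets (PiM UNIV (\<lambda>_ :: nat. count_space UNIV))"
  shows "emeasure (PP \<rho> q) {\<omega>. (\<lambda>i. Yw po pb \<omega> y i - y) \<in> D} = emeasure (PP \<rho> q) {\<omega>. (\<lambda>i. Yw po pb \<omega> 0 i) \<in> D}"
proof -
  interpret E: prob_space "EM \<rho> q" by (rule prob_space_EM)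
  interpret U: prob_space UM by (rule prob_space_UM)
  let ?\<Phi> = "\<lambda>y (e, u). ((\<lambda>z. \<not> evoid e (through (y + z))), (\<lambda>z. u (y + z)))"
  let ?W = "\<lambda>(f, u) i. Ywalk {z. f z} u po pb 0 i"
  have [measurable]: "(\<lambda>u z. u (y + z)) \<in> measurable UM UM" for y
    unfolding UM_def by (rule measurable_PiM_single') (auto simp: space_PiM)
  have law: "distr (PP \<rho> q) (Bsp \<Otimes>\<^sub>M UM) (?\<Phi> y) = Tlaw \<rho> q 0 \<Otimes>\<^sub>M UM" for y
  proof -
    have "distr (PP \<rho> q) (Bsp \<Otimes>\<^sub>M UM) (?\<Phi> y) = Tlaw \<rho> q y \<Otimes>\<^sub>M distr UM UM (\<lambda>u z. u (y + z))"
      unfolding PP_eq Tlaw_def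
      by (subst pair_measure_distr) (auto simp: distr_UM_shift intro: U.sigma_finite_measure_axioms)
    then show ?thesis by (simp add: Tlaw_eq[OF \<rho>, of q y] distr_UM_shift)
  qed
  have meas: "?\<Phi> y \<in> measurable (PP \<rho> q) (Bsp \<Otimes>\<^sub>M UM)" for y
    unfolding PP_eq by measurable
  have W: "?W \<in> measurable (Bsp \<Otimes>\<^sub>M UM) (PiM UNIV (\<lambda>_. count_space UNIV))"
  proof (rule measurable_PiM_single')
    fix i :: nat
    have [measurable]: "(\<lambda>u. u z) \<in> borel_measurable UM" for z
    proof -
      have "(\<lambda>u. u z) \<in> measurable UM U1" unfolding UM_def by measurable
      then show ?thesis by (simp cong: measurable_cong_sets)
    qed
    show "(\<lambda>x. ?W x i) \<in> measurable (Bsp \<Otimes>\<^sub>M UM) (count_space UNIV)"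
      unfolding split_beta' by (rule Ywalk_measurable) measurable
  qed (auto simp: space_PiM)
  have eq: "(\<lambda>i. Yw po pb \<omega> y i - y) = ?W (?\<Phi> y \<omega>)" for \<omega> y
  proof -
    have "{z. y + z \<in> Tset \<omega>} = {z. \<not> evoid (fst \<omega>) (through (y + z))}"
      by (simp add: Tset_eq_Tres Tres_def cvoid_def)
    then show ?thesis
      using Ywalk_translate[of "Tset \<omega>" "Unif \<omega>" po pb y 0]
      by (simp add: Yw_def fun_eq_iff split_beta Unif_def)
  qed
  have "emeasure (PP \<rho> q) {\<omega>. (\<lambda>i. Yw po pb \<omega> y i - y) \<in> D}
    = emeasure (Tlaw \<rho> q 0 \<Otimes>\<^sub>M UM) (?W -` D \<inter> space (Bsp \<Otimes>\<^sub>M UM))" for y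
  proof -
    have "emeasure (Tlaw \<rho> q 0 \<Otimes>\<^sub>M UM) (?W -` D \<inter> space (Bsp \<Otimes>\<^sub>M UM))
      = emeasure (PP \<rho> q) (?\<Phi> y -` (?W -` D \<inter> space (Bsp \<Otimes>\<^sub>M UM)) \<inter> space (PP \<rho> q))"
      unfolding law[of y, symmetric] by (intro emeasure_distr meas measurable_sets[OF W D])
    also have "?\<Phi> y -` (?W -` D \<inter> space (Bsp \<Otimes>\<^sub>M UM)) \<inter> space (PP \<rho> q) = {\<omega>. (\<lambda>i. Yw po pb \<omega> y i - y) \<in> D}"
      unfolding eq by (auto simp: space_pair_measure space_PiM)
    finally show ?thesis by simp
  qed
  from this[of y] this[of 0] show ?thesis by simp
qed

section \<open>Trials at record times\<close>

definition stay :: "real \<Rightarrow> real \<Rightarrow> (int \<times> int) set \<Rightarrow> (int \<times> int \<Rightarrow> real) \<Rightarrow> int \<times> int \<Rightarrow> (int \<times> int) set \<Rightarrow> bool" where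
  "stay po pb T U y C \<longleftrightarrow> (\<forall>i. Ywalk T U po pb y i \<in> C)"

lemma stay_mono: "stay po pb T U y C \<Longrightarrow> C \<subseteq> C' \<Longrightarrow> stay po pb T U y C'"
  by (auto simp: stay_def)

text \<open>A walk confined to \<open>C\<close> reads the environment on \<open>C\<close> only, so
  \<open>stay\<close> survives any change of environment off \<open>C\<close>.\<close>

lemma stay_cong:
  assumes "stay po pb T U y C" "\<And>z. z \<in> C \<Longrightarrow> (z \<in> T) = (z \<in> T')" "\<And>z. z \<in> C \<Longrightarrow> U z = U' z"
  shows "stay po pb T' U' y C"
  unfolding stay_def
proof
  fix i
  have "Ywalk T' U' po pb y i = Ywalk T U po pb y i"
    using assms by (intro Ywalk_cong[where S = C]) (auto simp: stay_def)
  then show "Ywalk T' U' po pb y i \<in> C" using assms(1) by (simp add: stay_def)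
qed

lemma stay_diag:
  assumes "\<And>i. i < l \<Longrightarrow> U (diag y i) \<le> min po pb" "\<And>i. i < l \<Longrightarrow> diag y i \<in> C" "stay po pb T U (diag y l) C"
  shows "stay po pb T U y C"
  unfolding stay_def
proof
  fix i
  have Yd: "Ywalk T U po pb y i = diag y i" if "i \<le> l" for i
    by (rule Ywalk_diag[where l = l]) (use assms(1) that in auto)
  show "Ywalk T U po pb y i \<in> C"
  proof (cases "i < l")
    case True
    then show ?thesis using Yd[of i] assms(2) by simp
  next
    case False
    then have "Ywalk T U po pb y i = Ywalk T U po pb (diag y l) (i - l)"
      using Ywalk_add[of T U po pb y l "i - l"] Yd[of l] by simp
    then show ?thesis using assms(3) by (simp add: stay_def)
  qed
qed

lemma cone_mono: "0 < v \<Longrightarrow> z \<in> cone v y \<Longrightarrow> cone v z \<subseteq> cone v y"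
  by (auto simp: mem_cone_iff)

lemma rcone_mono: "0 < v \<Longrightarrow> z \<in> rcone v y \<Longrightarrow> rcone v z \<subseteq> rcone v y"
  by (auto simp: mem_rcone_iff)

lemma diag_in_cone: "0 < v \<Longrightarrow> v < 1 \<Longrightarrow> i \<le> j \<Longrightarrow> diag y j \<in> cone v (diag y i)"
  by (auto simp: mem_cone_iff intro!: mult_left_mono)

lemma rcone_diag_mono: "0 < v \<Longrightarrow> v < 1 \<Longrightarrow> rcone v y \<subseteq> rcone v (diag y l)"
  by (fastforce simp: mem_rcone_iff intro: add_increasing2 less_le_trans)

lemma cone_rcone_disjoint: "0 < v \<Longrightarrow> z \<in> cone v y \<Longrightarrow> z \<notin> rcone v y"
  by (auto simp: mem_cone_iff mem_rcone_iff)

lemma UNIV_Wsp [measurable]: "UNIV \<in> sets Wsp"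
  using sets.top[of Wsp] by simp

section \<open>The standing setting, ballisticity from every site, and the success probability of
  one trial\<close>

lemma powr_at_top:
  fixes \<gamma> :: real
  assumes "1 \<le> \<gamma>"
  shows "filterlim (\<lambda>x. x powr \<gamma>) at_top at_top"
proof (rule filterlim_at_top_mono[OF filterlim_ident])
  show "eventually (\<lambda>x. x \<le> x powr \<gamma>) at_top"
    using eventually_ge_at_top[of 1]
  proof eventually_elim
    case (elim x)
    then show ?case using powr_mono[OF assms elim] by simp
  qed
qed

text \<open>Here v is the slope of the cones, so the ballistic speed reads 3 * v. Positivity of both
  \<open>po\<close> and \<open>pb\<close> is what allows diagonal moves to be forced.\<close>

locale random_walk =
  fixes q \<rho> po pb v c0 \<gamma> :: real
  assumes q: "0 < q" "q < 1" and po: "0 < po" "po \<le> 1" and pb: "0 < pb" "pb \<le> 1"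
    and v: "0 < v" "v < 1 / 3" and rho: "0 < \<rho>" and c0: "0 < c0" and gamma: "1 < \<gamma>"
    and ballistic: "\<And>L::nat. 1 \<le> L \<Longrightarrow>
      emeasure (PP \<rho> q) {\<omega>. \<exists>n::nat. real_of_int (Xw po pb \<omega> n) < real n * (3 * v) - real L}
        \<le> ennreal (exp (- c0 * (ln (real L)) powr \<gamma>) / c0)"
begin

abbreviation "M \<equiv> PP \<rho> q"
abbreviation "p \<equiv> min po pb"
abbreviation "K \<equiv> crossK v"
abbreviation "Y \<omega> \<equiv> Yw po pb \<omega> (0, 0)"
abbreviation "slow L \<equiv> exp (- c0 * (ln (real L)) powr \<gamma>) / c0"

sublocale prob_space M by (rule prob_space_PP)

lemma v1: "v < 1" using v by simp

lemma p: "0 < p" "p \<le> 1" using po pb by auto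

definition cross :: "int \<times> int \<Rightarrow> int \<times> int \<Rightarrow> (int \<Rightarrow> int) set" where
  "cross y z = tch (rcone v y) \<inter> tch (cone v z)"

lemma cross_sets [measurable]: "cross y z \<in> sets Wsp"
  by (auto simp: cross_def)

lemma Wcross_eq_cross: "Wcross v y = cross y y"
  by (auto simp: Wcross_eq_tch cross_def)

lemma emeasure_cross: "snd y \<le> snd z \<Longrightarrow> emeasure (mu q) (cross y z) \<le> ennreal (K * exp (- v * (ht v z - ht v y)))"
  unfolding cross_def by (rule mu_cross[OF q v(1)])

lemma emeasure_cross_finite: "snd y \<le> snd z \<Longrightarrow> B \<in> sets Wsp \<Longrightarrow> B \<subseteq> cross y z \<Longrightarrow> emeasure (mu q) B < \<infinity>"
  using emeasure_mono[of B "cross y z" "mu q", THEN order_trans, OF _ _ emeasure_cross[of y z]]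
  by (simp add: order_le_less_trans[OF _ ennreal_less_top])

lemma prob_not_cvoid_cross:
  assumes "snd y \<le> snd z" "B \<in> sets Wsp" "B \<subseteq> cross y z"
  shows "prob {\<omega>. \<not> cvoid \<omega> B} \<le> \<rho> * (K * exp (- v * (ht v z - ht v y)))"
  using emeasure_cross[OF assms(1)] emeasure_mono[OF assms(3), of "mu q"] crossK_pos[OF v(1)]
  by (intro prob_not_cvoid_le[OF assms(2) _ rho]) (auto intro: order_trans)

lemma Yw_measurable [measurable]: "(\<lambda>\<omega>. Yw po pb \<omega> y i) \<in> measurable M (count_space UNIV)"
  unfolding Yw_def Tset_eq_Tres by (intro Ywalk_measurable Tres_measurable Unif_measurable UNIV_Wsp)

lemma events_Collect: "Measurable.pred M Q \<Longrightarrow> {\<omega>. Q \<omega>} \<in> events"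
  by (simp add: pred_def)

definition ball :: "nat \<Rightarrow> int \<times> int \<Rightarrow> config \<Rightarrow> bool" where
  "ball L y \<omega> \<longleftrightarrow> (\<forall>i::nat. real i * (3 * v) - real L \<le> real_of_int (fst (Yw po pb \<omega> y i) - fst y))"

lemma ball_measurable [measurable]: "Measurable.pred M (ball L y)"
  unfolding ball_def by measurable

lemma prob_not_ball:
  assumes "1 \<le> L"
  shows "prob {\<omega>. \<not> ball L y \<omega>} \<le> slow L"
proof -
  define D where "D = {g :: nat \<Rightarrow> int \<times> int. \<exists>i. real_of_int (fst (g i)) < real i * (3 * v) - real L}"
  have D: "D \<in> sets (PiM UNIV (\<lambda>_. count_space UNIV))"
  proof -
    have "{g \<in> space (PiM UNIV (\<lambda>_. count_space UNIV)). \<exists>i. real_of_int (fst (g i)) < real i * (3 * v) - real L}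
       \<in> sets (PiM (UNIV :: nat set) (\<lambda>_. count_space (UNIV :: (int \<times> int) set)))" by measurable
    then show ?thesis by (simp add: D_def space_PiM)
  qed
  have "{\<omega>. \<not> ball L y \<omega>} = {\<omega>. (\<lambda>i. Yw po pb \<omega> y i - y) \<in> D}"
    by (auto simp: ball_def D_def not_le)
  then have "emeasure M {\<omega>. \<not> ball L y \<omega>} = emeasure M {\<omega>. (\<lambda>i. Yw po pb \<omega> 0 i) \<in> D}"
    using Ywalk_law[OF rho D, of q po pb y] by simp
  also have "\<dots> \<le> ennreal (slow L)"
    using ballistic[OF assms] by (simp add: D_def Xw_def zero_prod_def)
  finally show ?thesis using c0 by (simp add: emeasure_eq_measure)
qed

text \<open>Of the speed 3v, the height subtracts v per time step, leaving 2v.\<close>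

lemma ht_ball:
  assumes "ball L y \<omega>"
  shows "ht v y + 2 * v * real i - real L \<le> ht v (Yw po pb \<omega> y i)"
proof -
  have "real i * (3 * v) - real L \<le> real_of_int (fst (Yw po pb \<omega> y i) - fst y)"
    using assms by (simp add: ball_def)
  then show ?thesis by (simp add: ht_def Yw_def algebra_simps)
qed

definition L1 :: nat where
  "L1 = (SOME L. 1 \<le> L \<and> slow L \<le> 1 / 4)"

text \<open>Further forced diagonal steps: enough to make up in height for the ballistic slack
  \<open>L1\<close>, and to keep particles from crossing over the resulting gap except with
  probability 1/4.\<close>

definition L2 :: nat where
  "L2 = (SOME L. real L1 \<le> (1 - v) * real L \<and> \<rho> * (K * exp (- v * ((1 - v) * real L - real L1))) \<le> 1 / 4)"

lemma L1: "1 \<le> L1" "slow L1 \<le> 1 / 4"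
proof -
  have "((\<lambda>L. slow L) \<longlongrightarrow> 0 / c0) sequentially"
  proof (intro tendsto_divide tendsto_const)
    have "filterlim (\<lambda>L. c0 * ln (real L) powr \<gamma>) at_top sequentially"
      using c0 gamma
      by (intro filterlim_tendsto_pos_mult_at_top[OF tendsto_const] filterlim_compose[OF powr_at_top]
          filterlim_compose[OF ln_at_top] filterlim_real_sequentially) auto
    then have "filterlim (\<lambda>L. - (c0 * ln (real L) powr \<gamma>)) at_bot sequentially"
      by (simp add: filterlim_uminus_at_bot)
    then have "((\<lambda>L. exp (- (c0 * ln (real L) powr \<gamma>))) \<longlongrightarrow> 0) sequentially"
      by (rule filterlim_compose[OF exp_at_bot])
    then show "((\<lambda>L. exp (- c0 * ln (real L) powr \<gamma>)) \<longlongrightarrow> 0) sequentially" by simp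
  qed (use c0 in auto)
  then have "eventually (\<lambda>L. slow L < 1 / 4) sequentially"
    by (rule order_tendstoD) auto
  then have "eventually (\<lambda>L. 1 \<le> L \<and> slow L \<le> 1 / 4) sequentially"
    using eventually_ge_at_top[of 1] by eventually_elim auto
  then have "\<exists>L. 1 \<le> L \<and> slow L \<le> 1 / 4"
    by (rule eventually_happens'[OF sequentially_bot])
  from someI_ex[OF this] show "1 \<le> L1" "slow L1 \<le> 1 / 4" by (auto simp: L1_def)
qed

lemma L2: "real L1 \<le> (1 - v) * real L2" "\<rho> * (K * exp (- v * ((1 - v) * real L2 - real L1))) \<le> 1 / 4"
proof -
  have inf: "filterlim (\<lambda>L. - real L1 + (1 - v) * real L) at_top sequentially"
    using v by (intro filterlim_tendsto_add_at_top[OF tendsto_const] filterlim_tendsto_pos_mult_at_top[OF tendsto_const]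
        filterlim_real_sequentially) auto
  then have "filterlim (\<lambda>L. v * (- real L1 + (1 - v) * real L)) at_top sequentially"
    by (intro filterlim_tendsto_pos_mult_at_top[OF tendsto_const v(1)])
  then have "filterlim (\<lambda>L. - (v * (- real L1 + (1 - v) * real L))) at_bot sequentially"
    by (simp add: filterlim_uminus_at_bot)
  then have "((\<lambda>L. exp (- (v * (- real L1 + (1 - v) * real L)))) \<longlongrightarrow> 0) sequentially"
    by (rule filterlim_compose[OF exp_at_bot])
  then have "((\<lambda>L. \<rho> * (K * exp (- (v * (- real L1 + (1 - v) * real L))))) \<longlongrightarrow> \<rho> * (K * 0)) sequentially"
    by (intro tendsto_intros)
  then have "eventually (\<lambda>L. \<rho> * (K * exp (- (v * (- real L1 + (1 - v) * real L)))) < 1 / 4) sequentially"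
    by (rule order_tendstoD) auto
  moreover have "eventually (\<lambda>L. 0 \<le> - real L1 + (1 - v) * real L) sequentially"
    using inf unfolding filterlim_at_top by blast
  ultimately have "eventually (\<lambda>L. real L1 \<le> (1 - v) * real L
      \<and> \<rho> * (K * exp (- v * ((1 - v) * real L - real L1))) \<le> 1 / 4) sequentially"
    by eventually_elim (simp add: algebra_simps)
  then have "\<exists>L. real L1 \<le> (1 - v) * real L \<and> \<rho> * (K * exp (- v * ((1 - v) * real L - real L1))) \<le> 1 / 4"
    by (rule eventually_happens'[OF sequentially_bot])
  from someI_ex[OF this]
  show "real L1 \<le> (1 - v) * real L2" "\<rho> * (K * exp (- v * ((1 - v) * real L2 - real L1))) \<le> 1 / 4"
    by (auto simp: L2_def)
qed

text \<open>Lower bound for the success of a trial: l + \<open>L2\<close> forced steps, no crossing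
  particle at the end of the first l of them, and 1/2 for staying in the cone afterwards.\<close>

definition \<delta> :: "nat \<Rightarrow> real" where
  "\<delta> l = p ^ (l + L2) * exp (- \<rho> * K) / 2"

lemma \<delta>: "0 < \<delta> l" "\<delta> l \<le> 1"
proof -
  show "0 < \<delta> l" using p by (simp add: \<delta>_def)
  have "p ^ (l + L2) * exp (- \<rho> * K) \<le> 1 * 1"
    using p rho crossK_pos[OF v(1)] by (intro mult_mono power_le_one) auto
  then show "\<delta> l \<le> 1" by (simp add: \<delta>_def)
qed

text \<open>The success of a trial at \<open>z\<close>, phrased with the information independent of the past of a record at \<open>z\<close> only.\<close>
definition fresh :: "nat \<Rightarrow> int \<times> int \<Rightarrow> config set" where
  "fresh l z = {\<omega>. (\<forall>i<l. Ures (- rcone v z) \<omega> (diag z i) \<le> p)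
     \<and> cvoid \<omega> (Wcross v (diag z l) - tch (rcone v z))
     \<and> stay po pb (Tres (- tch (rcone v z)) \<omega>) (Ures (- rcone v z) \<omega>) (diag z l) (cone v (diag z l))}"

abbreviation "past z \<equiv> Gm q (tch (rcone v z)) (rcone v z)"
abbreviation "future z \<equiv> Gm q (- tch (rcone v z)) (- rcone v z)"

lemma Compl_Wsp [measurable]: "A \<in> sets Wsp \<Longrightarrow> - A \<in> sets Wsp"
  using sets.compl_sets[of A Wsp] by (simp add: Compl_eq_Diff_UNIV)

lemma stay_measurable_Gm:
  assumes "A \<in> sets Wsp"
  shows "Measurable.pred (Gm q A S) (\<lambda>\<omega>. stay po pb (Tres A \<omega>) (Ures S \<omega>) y C)"
proof -
  have [measurable]: "(\<lambda>\<omega>. Ywalk (Tres A \<omega>) (Ures S \<omega>) po pb y i) \<in> measurable (Gm q A S) (count_space UNIV)" for i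
    using assms by (intro Ywalk_measurable Tres_measurable_Gm) auto
  show ?thesis unfolding stay_def by measurable
qed

lemma fresh_sets: "fresh l z \<in> sets (future z)"
proof -
  have [measurable]: "Measurable.pred (future z) (\<lambda>\<omega>. cvoid \<omega> (Wcross v (diag z l) - tch (rcone v z)))"
    by (intro cvoid_measurable_Gm emeasure_cross_finite[of "diag z l" "diag z l"]) (auto simp: Wcross_eq_cross)
  have [measurable]: "Measurable.pred (future z)
      (\<lambda>\<omega>. stay po pb (Tres (- tch (rcone v z)) \<omega>) (Ures (- rcone v z) \<omega>) (diag z l) (cone v (diag z l)))"
    by (intro stay_measurable_Gm) auto
  have "Measurable.pred (future z) (\<lambda>\<omega>. \<omega> \<in> fresh l z)"
    unfolding fresh_def mem_Collect_eq by measurable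
  then show ?thesis by (simp add: pred_def)
qed

text \<open>Absence of crossing particles and the future of the walk share the same cloud. They are
  decoupled by running the walk without the particles of \<open>Wcross v z'\<close>: this is
  independent of whether such particles exist, and changes nothing when they do not.\<close>

lemma prob_fresh: "\<delta> l \<le> prob (fresh l z)"
proof -
  define z' where "z' = diag z l"
  \<comment> \<open>\<open>w\<close> lies \<open>L1\<close> to the left of the end of the forced
    stretch, so ballisticity with slack \<open>L1\<close> from there keeps the walk in
    \<open>cone v w\<close>. The choice of \<open>L2\<close> puts this cone inside
    \<open>cone v z'\<close>.\<close>
  define w where "w = (fst z' + int L2 - int L1, snd z' + int L2)"
  have ht_w: "ht v w = ht v z' + ((1 - v) * real L2 - real L1)"
    by (simp add: w_def ht_def algebra_simps)
  have w: "w \<in> cone v z'"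
    using L2(1) by (simp add: mem_cone_iff[OF v(1)] ht_w) (simp add: w_def)
  define S where "S = {x. snd z' + int L2 \<le> snd (x :: int \<times> int)}"
  define F where "F = diag z ` {..<l + L2}"
  define E where "E = obs (Wcross v z') F (\<lambda>_. {..p})"
  \<comment> \<open>Times from \<open>snd z' + L2\<close> on, disjoint from the forced sites
    \<open>F\<close>, and particles disjoint from those in \<open>E\<close>.\<close>
  define E' where "E' = {\<omega>. stay po pb (Tres (- Wcross v z') \<omega>) (Ures S \<omega>) (diag z' L2) (cone v w)}"
  have cone_S: "x \<in> S" if "x \<in> cone v w" for x
    using that by (auto simp: mem_cone_iff[OF v(1)] S_def w_def)
  have Tcong: "x \<in> Tres (- Wcross v z') \<omega> \<longleftrightarrow> x \<in> Tset \<omega>" if "cvoid \<omega> (cross z' w)" "x \<in> cone v w" for x \<omega>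
    unfolding Tset_eq_Tres
    by (rule Tres_cong[where C = "cone v w"])
       (use that in \<open>auto simp: Wcross_eq_cross cross_def intro: cvoid_mono\<close>)
  have sub: "E \<inter> E' \<subseteq> fresh l z"
  proof
    fix \<omega> assume "\<omega> \<in> E \<inter> E'"
    then have void: "cvoid \<omega> (Wcross v z')" and U: "\<And>i. i < l + L2 \<Longrightarrow> Unif \<omega> (diag z i) \<le> p"
      and st: "stay po pb (Tres (- Wcross v z') \<omega>) (Ures S \<omega>) (diag z' L2) (cone v w)"
      by (auto simp: E_def E'_def obs_def F_def)
    have cv: "cvoid \<omega> (cross z' w)"
      using void cone_mono[OF v(1) w] by (rule_tac cvoid_mono) (auto simp: Wcross_eq_cross cross_def tch_def)
    have "stay po pb (Tset \<omega>) (Unif \<omega>) (diag z' L2) (cone v w)"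
      by (rule stay_cong[OF st]) (simp_all add: Tcong[OF cv] Ures_def cone_S)
    then have "stay po pb (Tset \<omega>) (Unif \<omega>) (diag z' L2) (cone v z')"
      using cone_mono[OF v(1) w] by (rule stay_mono)
    moreover have "Unif \<omega> (diag z' i) \<le> p" if "i < L2" for i
      using U[of "l + i"] that by (simp add: z'_def)
    moreover have "diag z' i \<in> cone v z'" for i
      using diag_in_cone[OF v(1) v1, of 0 i z'] by simp
    ultimately have st': "stay po pb (Tset \<omega>) (Unif \<omega>) z' (cone v z')"
      by (intro stay_diag[where l = L2 and y = z']) auto
    have "cvoid \<omega> (tch (cone v z') \<inter> tch (rcone v z))"
      using void rcone_diag_mono[OF v(1) v1, of z l]
      by (rule_tac cvoid_mono) (auto simp: Wcross_eq_cross cross_def z'_def tch_def)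
    then have "x \<in> Tset \<omega> \<longleftrightarrow> x \<in> Tres (- tch (rcone v z)) \<omega>" if "x \<in> cone v z'" for x
      unfolding Tset_eq_Tres
      by (intro Tres_cong[where C = "cone v z'"]) (use that in \<open>auto intro: cvoid_mono\<close>)
    moreover have "x \<notin> rcone v z" if "x \<in> cone v z'" for x
    proof -
      have "x \<in> cone v z"
        using that cone_mono[OF v(1) diag_in_cone[OF v(1) v1, of 0 l z]] by (auto simp: z'_def)
      then show ?thesis by (rule cone_rcone_disjoint[OF v(1)])
    qed
    ultimately have "stay po pb (Tres (- tch (rcone v z)) \<omega>) (Ures (- rcone v z) \<omega>) z' (cone v z')"
      by (intro stay_cong[OF st']) (auto simp: Ures_def)
    moreover have "Ures (- rcone v z) \<omega> (diag z i) \<le> p" if "i < l" for i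
      using U[of i] that diag_in_cone[OF v(1) v1, of 0 i z] cone_rcone_disjoint[OF v(1), of "diag z i" z]
      by (simp add: Ures_def)
    moreover have "cvoid \<omega> (Wcross v z' - tch (rcone v z))"
      using void by (rule cvoid_mono) auto
    ultimately show "\<omega> \<in> fresh l z"
      unfolding fresh_def z'_def by simp
  qed
  have E: "E \<in> sets (Gm q (Wcross v z') F)"
  proof -
    have "E \<in> gens q (Wcross v z') F"
      unfolding E_def gens_def mem_Collect_eq
      by (intro exI[of _ "Wcross v z'"] exI[of _ F] exI[of _ "\<lambda>_. {..p}"])
         (auto simp: F_def Wcross_eq_cross emeasure_cross_finite[OF order_refl cross_sets order_refl, simplified])
    then show ?thesis by (simp add: sets_Gm)
  qed
  have E': "E' \<in> sets (Gm q (- Wcross v z') S)"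
    using stay_measurable_Gm[of "- Wcross v z'" S "diag z' L2" "cone v w"]
    by (simp add: pred_def E'_def Wcross_eq_cross)
  have "prob (E \<inter> E') = prob E * prob E'"
    by (rule Gm_indep[OF rho _ _ E E']) (auto simp: F_def S_def z'_def)
  moreover have "p ^ (l + L2) * exp (- \<rho> * K) \<le> prob E"
  proof -
    have "card F = l + L2"
      unfolding F_def by (subst card_image) (auto simp: inj_on_def diag_def)
    then have "prob E = exp (- \<rho> * measure (mu q) (Wcross v z')) * p ^ (l + L2)"
      unfolding E_def using p
      by (subst prob_obs) (auto simp: F_def Wcross_eq_cross rho U1_atMost emeasure_cross_finite[OF order_refl cross_sets order_refl, simplified])
    moreover have "exp (- \<rho> * K) \<le> exp (- \<rho> * measure (mu q) (Wcross v z'))"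
      using emeasure_cross[of z' z'] crossK_pos[OF v(1)]
      by (intro prob_not_cvoid_le(2)[OF _ _ rho]) (auto simp: Wcross_eq_cross)
    ultimately show ?thesis using p by (simp add: mult.commute mult_left_mono)
  qed
  moreover have "1 / 2 \<le> prob E'"
  proof -
    let ?B1 = "{\<omega>. \<not> ball L1 (diag z' L2) \<omega>}" and ?B2 = "{\<omega>. \<not> cvoid \<omega> (cross z' w)}"
    have [measurable]: "?B1 \<in> events" "?B2 \<in> events"
      by (intro events_Collect; measurable)+
    have E'M: "E' \<in> events" using E' sets_Gm_subset by blast
    \<comment> \<open>If no particle goes from \<open>rcone v z'\<close> to \<open>cone v w\<close>,
      the discarded particles never touch \<open>cone v w\<close>. The thinned walk is then the true
      one there, and ballisticity applies.\<close>
    have "- E' \<subseteq> ?B1 \<union> ?B2"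
    proof (rule ccontr)
      assume "\<not> - E' \<subseteq> ?B1 \<union> ?B2"
      then obtain \<omega> where \<omega>: "\<omega> \<notin> E'" "ball L1 (diag z' L2) \<omega>" "cvoid \<omega> (cross z' w)" by blast
      have "stay po pb (Tset \<omega>) (Unif \<omega>) (diag z' L2) (cone v w)"
        unfolding stay_def
      proof
        fix i
        have "ht v w \<le> ht v (diag z' L2) + 2 * v * real i - real L1"
          using v by (simp add: ht_w)
        also have "\<dots> \<le> ht v (Yw po pb \<omega> (diag z' L2) i)" by (rule ht_ball[OF \<omega>(2)])
        finally show "Ywalk (Tset \<omega>) (Unif \<omega>) po pb (diag z' L2) i \<in> cone v w"
          by (simp add: mem_cone_iff[OF v(1)] Yw_def) (simp add: w_def)
      qed
      then have "\<omega> \<in> E'"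
        unfolding E'_def mem_Collect_eq
        by (rule stay_cong) (simp_all add: Tcong[OF \<omega>(3)] Ures_def cone_S)
      then show False using \<omega>(1) by simp
    qed
    then have "prob (- E') \<le> prob (?B1 \<union> ?B2)" by (intro finite_measure_mono) auto
    also have "\<dots> \<le> prob ?B1 + prob ?B2" by (intro measure_Un_le) auto
    also have "\<dots> \<le> 1 / 4 + 1 / 4"
    proof (rule add_mono)
      show "prob ?B1 \<le> 1 / 4" by (rule order_trans[OF prob_not_ball[OF L1(1)] L1(2)])
      have "prob ?B2 \<le> \<rho> * (K * exp (- v * (ht v w - ht v z')))"
        by (intro prob_not_cvoid_cross) (auto simp: w_def)
      then show "prob ?B2 \<le> 1 / 4" using L2(2) by (simp add: ht_w)
    qed
    finally show ?thesis using prob_compl[OF E'M] by (simp add: Compl_eq_Diff_UNIV)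
  qed
  ultimately have "p ^ (l + L2) * exp (- \<rho> * K) * (1 / 2) \<le> prob (E \<inter> E')"
    using mult_mono[of "p ^ (l + L2) * exp (- \<rho> * K)" "prob E" "1 / 2" "prob E'"] by simp
  also have "\<dots> \<le> prob (fresh l z)"
    using sub subsetD[OF sets_Gm_subset fresh_sets] by (rule finite_measure_mono)
  finally show ?thesis by (simp add: \<delta>_def)
qed

section \<open>Records, trials with finite horizon, and independence of past and future at a
  record\<close>

lemma walk_records_Y: "walk_records v (Y \<omega>)"
  unfolding Yw_def[abs_def] by (rule walk_records_Ywalk[OF v(1) v1])

lemma snd_Yw [simp]: "snd (Yw po pb \<omega> y i) = snd y + int i"
  by (simp add: Yw_def)

lemma Yw_add: "Yw po pb \<omega> y (i + j) = Yw po pb \<omega> (Yw po pb \<omega> y i) j"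
  by (simp add: Yw_def Ywalk_add)

definition recat :: "nat \<Rightarrow> int \<times> int \<Rightarrow> config \<Rightarrow> bool" where
  "recat k y \<omega> \<longleftrightarrow> isrec v (Y \<omega>) k (nat (snd y)) \<and> Y \<omega> (nat (snd y)) = y"

lemma recatI: "isrec v (Y \<omega>) k n \<Longrightarrow> recat k (Y \<omega> n) \<omega>"
  by (simp add: recat_def)

lemma recat_unique: "recat k y \<omega> \<Longrightarrow> recat k y' \<omega> \<Longrightarrow> y = y'"
  unfolding recat_def using isrec_unique by metis

text \<open>Staying in the cone forever would not be decided at any later record; the horizon
  \<open>H\<close> makes failure an event of the past.\<close>

definition success :: "nat \<Rightarrow> nat \<Rightarrow> config \<Rightarrow> bool" where
  "success H k \<omega> \<longleftrightarrow> (\<exists>n. isrec v (Y \<omega>) k n \<and> cvoid \<omega> (Wcross v (Y \<omega> n))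
     \<and> (\<forall>i\<le>H. Y \<omega> (n + i) \<in> cone v (Y \<omega> n)))"

text \<open>Up to a record at \<open>y\<close> the walk stays in the reverse cone of \<open>y\<close>, so whatever it has seen is known to the past
  of \<open>y\<close>.\<close>
lemma recat_past:
  fixes j :: nat
  assumes g: "\<And>i. i < j \<Longrightarrow> g i + H \<le> k"
  shows "{\<omega>. recat k y \<omega> \<and> (\<forall>i<j. \<not> success H (g i) \<omega>)} \<in> sets (past y)"
proof -
  define n where "n = nat (snd y)"
  \<comment> \<open>The walk as it can be computed from the past of y alone; it is automatically
    measurable for \<open>past y\<close>.\<close>
  define Y' where "Y' = (\<lambda>\<omega>. Ywalk (Tres (tch (rcone v y)) \<omega>) (Ures (rcone v y) \<omega>) po pb (0, 0))"
  have [measurable]: "(\<lambda>\<omega>. Y' \<omega> i) \<in> measurable (past y) (count_space UNIV)" for i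
    unfolding Y'_def by (intro Ywalk_measurable Tres_measurable_Gm) auto
  have [measurable]: "Measurable.pred (past y) (\<lambda>\<omega>. cvoid \<omega> (Wcross v x))" if "x \<in> insert y (rcone v y)" for x
  proof -
    have "rcone v x \<subseteq> rcone v y" using that rcone_mono[OF v(1), of x y] by auto
    then have "cross x x \<subseteq> tch (rcone v y)" using tch_mono by (auto simp: cross_def)
    then show ?thesis
      unfolding Wcross_eq_cross
      by (intro cvoid_measurable_Gm emeasure_cross_finite[OF order_refl cross_sets order_refl]) auto
  qed
  define rec' where "rec' = (\<lambda>\<omega>. isrec v (Y' \<omega>) k n \<and> Y' \<omega> n = y)"
  \<comment> \<open>Splitting over the possible sites x leaves only void events of deterministic
    sets \<open>Wcross v x\<close>, each inside \<open>tch (rcone v y)\<close>. The guard keeps to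
    times at which \<open>Y'\<close> is trustworthy.\<close>
  define suc' where "suc' = (\<lambda>i \<omega>. \<exists>n'\<in>{..n}. isrec v (Y' \<omega>) (g i) n'
     \<and> (\<exists>x\<in>insert y (rcone v y). Y' \<omega> n' = x \<and> cvoid \<omega> (Wcross v x)
       \<and> (\<forall>a\<in>{..H}. n' + a \<le> n \<longrightarrow> Y' \<omega> (n' + a) \<in> cone v x)))"
  \<comment> \<open>The disjunction gives equality of the two record events: whichever walk has its
    record at y, its earlier positions lie in \<open>rcone v y\<close>, where both environments
    coincide.\<close>
  have agree: "Y' \<omega> i = Y \<omega> i" if "i \<le> n" "rec' \<omega> \<or> recat k y \<omega>" for \<omega> i
  proof -
    have TT: "x \<in> Tset \<omega> \<longleftrightarrow> x \<in> Tres (tch (rcone v y)) \<omega>" if "x \<in> rcone v y" for x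
      unfolding Tset_eq_Tres
      by (rule Tres_cong[where C = "rcone v y"]) (use that in \<open>simp_all add: Diff_eq\<close>)
    from that(2) show ?thesis
    proof
      assume *: "rec' \<omega>"
      interpret R: walk_records v "Y' \<omega>" unfolding Y'_def by (rule walk_records_Ywalk[OF v(1) v1])
      have "Y' \<omega> a \<in> rcone v y" if "a < n" for a
        using R.isrec_rcone[of k n a] * that by (auto simp: rec'_def)
      then have "Y \<omega> i = Y' \<omega> i"
        unfolding Yw_def Y'_def using \<open>i \<le> n\<close>
        by (intro Ywalk_cong[where S = "rcone v y"]) (auto simp: TT Ures_def)
      then show ?thesis by simp
    next
      assume *: "recat k y \<omega>"
      interpret R: walk_records v "Y \<omega>" by (rule walk_records_Y)
      have "Y \<omega> a \<in> rcone v y" if "a < n" for a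
        using R.isrec_rcone[of k n a] * that by (auto simp: recat_def n_def)
      then show ?thesis
        unfolding Yw_def Y'_def using \<open>i \<le> n\<close>
        by (intro Ywalk_cong[where S = "rcone v y"]) (auto simp: TT Ures_def)
    qed
  qed
  have rec_iff: "rec' \<omega> \<longleftrightarrow> recat k y \<omega>" for \<omega>
  proof -
    have "isrec v (Y' \<omega>) k n = isrec v (Y \<omega>) k n \<and> Y' \<omega> n = Y \<omega> n" if "rec' \<omega> \<or> recat k y \<omega>"
      using agree[OF _ that] by (intro conjI isrec_cong) auto
    then show ?thesis by (auto simp: rec'_def recat_def n_def)
  qed
  have suc_iff: "suc' i \<omega> \<longleftrightarrow> success H (g i) \<omega>" if rec: "recat k y \<omega>" and i: "i < j" for i \<omega>
  proof -
    interpret R: walk_records v "Y \<omega>" by (rule walk_records_Y)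
    have ag: "a \<le> n \<Longrightarrow> Y' \<omega> a = Y \<omega> a" for a using agree rec by blast
    have isr: "isrec v (Y' \<omega>) (g i) n' = isrec v (Y \<omega>) (g i) n'" if "n' \<le> n" for n'
      using that ag by (intro isrec_cong) auto
    have recn: "isrec v (Y \<omega>) k n" "Y \<omega> n = y" using rec by (auto simp: recat_def n_def)
    obtain d where d: "k = g i + d" "H \<le> d" using g[OF i] by (metis add_le_cancel_left le_add1 le_iff_add order_trans)
    \<comment> \<open>At least \<open>H\<close> levels separate the trial from y, hence at least
      \<open>H\<close> steps: the horizon is over by time n.\<close>
    have le: "n' + H \<le> n" if "isrec v (Y \<omega>) (g i) n'" for n'
      using R.isrec_gap[OF that, of d n] recn d by simp
    have inr: "Y \<omega> n' \<in> insert y (rcone v y)" if "n' \<le> n" for n'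
      using R.isrec_rcone[OF recn(1), of n'] recn(2) that by (cases "n' = n") auto
    show ?thesis
    proof
      assume "suc' i \<omega>"
      then obtain n' where n': "n' \<le> n" "isrec v (Y \<omega>) (g i) n'" "cvoid \<omega> (Wcross v (Y \<omega> n'))"
        "\<And>a. a \<le> H \<Longrightarrow> n' + a \<le> n \<Longrightarrow> Y' \<omega> (n' + a) \<in> cone v (Y \<omega> n')"
        unfolding suc'_def using isr ag by fastforce
      have "Y \<omega> (n' + a) \<in> cone v (Y \<omega> n')" if "a \<le> H" for a
      proof -
        have "n' + a \<le> n" using le[OF n'(2)] that by simp
        then show ?thesis using n'(4)[OF that] ag[of "n' + a"] by simp
      qed
      then show "success H (g i) \<omega>"
        unfolding success_def using n' by blast
    next
      assume "success H (g i) \<omega>"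
      then obtain n' where n': "isrec v (Y \<omega>) (g i) n'" "cvoid \<omega> (Wcross v (Y \<omega> n'))"
        "\<And>a. a \<le> H \<Longrightarrow> Y \<omega> (n' + a) \<in> cone v (Y \<omega> n')"
        unfolding success_def by blast
      have "n' \<le> n" using le[OF n'(1)] by simp
      then show "suc' i \<omega>"
        unfolding suc'_def using n' isr ag inr[of n']
        by (intro bexI[of _ n'] conjI bexI[of _ "Y \<omega> n'"]) auto
    qed
  qed
  have [measurable]: "(\<lambda>\<omega>. ht v (Y' \<omega> i)) \<in> borel_measurable (past y)" for i
    by (rule measurable_compose[where N = "count_space UNIV"]) auto
  have [measurable]: "Measurable.pred (past y) (\<lambda>\<omega>. isrec v (Y' \<omega>) k n)" for k n
    unfolding isrec_def by measurable
  have [measurable]: "Measurable.pred (past y) (\<lambda>\<omega>. Y' \<omega> i \<in> C)" for i C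
    by (rule measurable_compose[where N = "count_space UNIV" and f = "\<lambda>\<omega>. Y' \<omega> i"]) auto
  have [measurable]: "Measurable.pred (past y) (\<lambda>\<omega>. suc' i \<omega>)" for i
    unfolding suc'_def by (intro pred_intros_finite pred_intros_logic pred_intros_countable_bounded) measurable
  have "Measurable.pred (past y) (\<lambda>\<omega>. rec' \<omega> \<and> (\<forall>i\<in>{..<j}. \<not> suc' i \<omega>))"
    unfolding rec'_def by (intro pred_intros_logic pred_intros_finite finite_lessThan) measurable
  then have "{\<omega>. rec' \<omega> \<and> (\<forall>i\<in>{..<j}. \<not> suc' i \<omega>)} \<in> sets (past y)" by (simp add: pred_def)
  also have "{\<omega>. rec' \<omega> \<and> (\<forall>i\<in>{..<j}. \<not> suc' i \<omega>)} = {\<omega>. recat k y \<omega> \<and> (\<forall>i<j. \<not> success H (g i) \<omega>)}"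
    using rec_iff suc_iff by auto
  finally show ?thesis .
qed

text \<open>A substitute for the strong Markov property: partition by the random record site, use
  independence at each fixed site, and sum.\<close>

lemma prob_Union_past_future:
  assumes \<Gamma>: "\<And>y. \<Gamma> y \<in> sets (past y)" and D: "\<And>y. D y \<in> sets (future y)"
    and disj: "disjoint_family \<Gamma>"
  shows "(\<And>y. d \<le> prob (D y)) \<Longrightarrow> 0 \<le> d \<Longrightarrow> d * prob (\<Union>y. \<Gamma> y) \<le> prob (\<Union>y. \<Gamma> y \<inter> D y)"
    and "(\<And>y. prob (D y) \<le> d) \<Longrightarrow> 0 \<le> d \<Longrightarrow> prob (\<Union>y. \<Gamma> y \<inter> D y) \<le> d * prob (\<Union>y. \<Gamma> y)"
proof -
  have [measurable]: "\<Gamma> y \<in> events" "D y \<in> events" for y using \<Gamma> D sets_Gm_subset by blast+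
  have disj': "disjoint_family (\<lambda>y. \<Gamma> y \<inter> D y)" using disj unfolding disjoint_family_on_def by blast
  have prod: "emeasure M (\<Gamma> y \<inter> D y) = emeasure M (\<Gamma> y) * ennreal (prob (D y))" for y
  proof -
    have "prob (\<Gamma> y \<inter> D y) = prob (\<Gamma> y) * prob (D y)" by (rule Gm_indep[OF rho _ _ \<Gamma> D]) auto
    then show ?thesis by (simp add: emeasure_eq_measure ennreal_mult)
  qed
  have 1: "emeasure M (\<Union>y. \<Gamma> y) = (\<integral>\<^sup>+y. emeasure M (\<Gamma> y) \<partial>count_space UNIV)"
    using disj by (intro emeasure_UN_countable) auto
  have 2: "emeasure M (\<Union>y. \<Gamma> y \<inter> D y) = (\<integral>\<^sup>+y. emeasure M (\<Gamma> y) * ennreal (prob (D y)) \<partial>count_space UNIV)"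
    using disj' by (subst emeasure_UN_countable) (auto simp: prod)
  have 3: "ennreal (d * prob (\<Union>y. \<Gamma> y)) = (\<integral>\<^sup>+y. emeasure M (\<Gamma> y) * ennreal d \<partial>count_space UNIV)" if "0 \<le> d"
  proof -
    have "(\<integral>\<^sup>+y. emeasure M (\<Gamma> y) * ennreal d \<partial>count_space UNIV) = emeasure M (\<Union>y. \<Gamma> y) * ennreal d"
      unfolding 1 by (rule nn_integral_multc) auto
    then show ?thesis using that by (simp add: ennreal_mult emeasure_eq_measure mult.commute)
  qed
  show "d * prob (\<Union>y. \<Gamma> y) \<le> prob (\<Union>y. \<Gamma> y \<inter> D y)" if "\<And>y. d \<le> prob (D y)" "0 \<le> d"
  proof -
    have "ennreal (d * prob (\<Union>y. \<Gamma> y)) \<le> emeasure M (\<Union>y. \<Gamma> y \<inter> D y)"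
      unfolding 2 3[OF that(2)] using that by (intro nn_integral_mono mult_left_mono ennreal_leI) auto
    then show ?thesis by (simp add: emeasure_eq_measure)
  qed
  show "prob (\<Union>y. \<Gamma> y \<inter> D y) \<le> d * prob (\<Union>y. \<Gamma> y)" if "\<And>y. prob (D y) \<le> d" "0 \<le> d"
  proof -
    have "emeasure M (\<Union>y. \<Gamma> y \<inter> D y) \<le> ennreal (d * prob (\<Union>y. \<Gamma> y))"
      unfolding 2 3[OF that(2)] using that by (intro nn_integral_mono mult_left_mono ennreal_leI) auto
    then show ?thesis using that by (simp add: emeasure_eq_measure)
  qed
qed

section \<open>Error events over boxes, and the passage from good records to
  \<open>tau\<close>\<close>

definition nbox :: "nat \<Rightarrow> int \<times> int \<Rightarrow> (int \<times> int) set" where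
  "nbox I y = {fst y - int I..fst y + int I} \<times> {snd y..snd y + int I}"

lemma finite_nbox [simp]: "finite (nbox I y)"
  by (simp add: nbox_def)

lemma card_nbox: "card (nbox I y) = (2 * I + 1) * (I + 1)"
  by (simp add: nbox_def card_cartesian_product nat_add_distrib nat_mult_distrib)

lemma Yw_in_nbox: "i \<le> I \<Longrightarrow> Yw po pb \<omega> y i \<in> nbox I y"
  using Ywalk_fst_bound[of "Tset \<omega>" "Unif \<omega>" po pb y i]
  by (auto simp: nbox_def mem_Times_iff Yw_def[symmetric])

lemma prob_nbox_cross:
  assumes "\<And>z. B z \<in> sets Wsp" "\<And>z. B z \<subseteq> cross z (diag z l)"
  shows "prob {\<omega>. \<exists>z\<in>nbox I y. \<not> cvoid \<omega> (B z)}
    \<le> real ((2 * I + 1) * (I + 1)) * (\<rho> * (K * exp (- v * ((1 - v) * real l))))"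
proof -
  have [measurable]: "{\<omega>. \<not> cvoid \<omega> (B z)} \<in> events" for z
    using assms(1) by (intro events_Collect) measurable
  have "{\<omega>. \<exists>z\<in>nbox I y. \<not> cvoid \<omega> (B z)} = (\<Union>z\<in>nbox I y. {\<omega>. \<not> cvoid \<omega> (B z)})" by auto
  also have "prob \<dots> \<le> (\<Sum>z\<in>nbox I y. prob {\<omega>. \<not> cvoid \<omega> (B z)})"
    by (intro finite_measure_subadditive_finite) auto
  also have "\<dots> \<le> (\<Sum>z\<in>nbox I y. \<rho> * (K * exp (- v * ((1 - v) * real l))))"
  proof (rule sum_mono)
    fix z
    show "prob {\<omega>. \<not> cvoid \<omega> (B z)} \<le> \<rho> * (K * exp (- v * ((1 - v) * real l)))"
      using prob_not_cvoid_cross[of z "diag z l" "B z"] assms by simp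
  qed
  finally show ?thesis by (simp add: card_nbox)
qed

text \<open>Required at every site of a deterministic box, so it applies at the random record sites.
  The offset m - 1 is the one \<open>isrec_cone\<close> yields after m levels.\<close>

definition good :: "nat \<Rightarrow> nat \<Rightarrow> config \<Rightarrow> bool" where
  "good m N \<omega> \<longleftrightarrow> (\<forall>z\<in>nbox N (0, 0). ball m z \<omega> \<and> cvoid \<omega> (cross z (diag z (m - 1))))"

definition eps :: "nat \<Rightarrow> nat \<Rightarrow> real" where
  "eps m N = real ((2 * N + 1) * (N + 1)) * (\<rho> * (K * exp (- v * ((1 - v) * real (m - 1)))) + slow m)"

lemma good_sets [measurable]: "Measurable.pred M (good m N)"
proof -
  have "Measurable.pred M (\<lambda>\<omega>. \<forall>z\<in>nbox N (0, 0). ball m z \<omega> \<and> cvoid \<omega> (cross z (diag z (m - 1))))"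
    by (rule pred_intros_finite(3)) auto
  then show ?thesis by (simp add: good_def[abs_def])
qed

lemma prob_not_good:
  assumes "1 \<le> m"
  shows "prob {\<omega>. \<not> good m N \<omega>} \<le> eps m N"
proof -
  let ?B = "nbox N (0, 0)"
  let ?A1 = "{\<omega>. \<exists>z\<in>?B. \<not> cvoid \<omega> (cross z (diag z (m - 1)))}" and ?A2 = "\<Union>z\<in>?B. {\<omega>. \<not> ball m z \<omega>}"
  have A1: "?A1 \<in> events" by (intro events_Collect pred_intros_finite(4)) auto
  have A2': "{\<omega>. \<not> ball m z \<omega>} \<in> events" for z by (intro events_Collect) measurable
  then have A2: "?A2 \<in> events" by auto
  have "{\<omega>. \<not> good m N \<omega>} \<subseteq> ?A1 \<union> ?A2" by (auto simp: good_def)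
  then have "prob {\<omega>. \<not> good m N \<omega>} \<le> prob (?A1 \<union> ?A2)"
    using A1 A2 by (intro finite_measure_mono) auto
  also have "\<dots> \<le> prob ?A1 + prob ?A2" using A1 A2 by (intro measure_Un_le) auto
  also have "prob ?A2 \<le> (\<Sum>z\<in>?B. prob {\<omega>. \<not> ball m z \<omega>})"
    using A2' by (intro finite_measure_subadditive_finite) auto
  also have "\<dots> \<le> (\<Sum>z\<in>?B. slow m)"
    by (intro sum_mono prob_not_ball assms)
  also have "\<dots> = real ((2 * N + 1) * (N + 1)) * slow m" by (simp add: card_nbox)
  also have "prob ?A1 \<le> real ((2 * N + 1) * (N + 1)) * (\<rho> * (K * exp (- v * ((1 - v) * real (m - 1)))))"
    by (rule prob_nbox_cross) auto
  finally show ?thesis by (simp add: eps_def distrib_left)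
qed

lemma Rtime_eq: "isrec v (Y \<omega>) k n \<Longrightarrow> Rtime po pb v \<omega> k = enat n"
proof -
  assume rec: "isrec v (Y \<omega>) k n"
  have iff: "(1 - v) * real k + v * real n \<le> real_of_int (Xw po pb \<omega> n) \<longleftrightarrow> (1 - v) * real k \<le> ht v (Y \<omega> n)" for n
    by (auto simp: ht_def Xw_def)
  have "(LEAST n. (1 - v) * real k \<le> ht v (Y \<omega> n)) = n"
    using rec by (intro Least_equality) (auto simp: isrec_def not_less[symmetric])
  then show ?thesis using rec unfolding Rtime_def iff by (auto simp: isrec_def)
qed

lemma Rtime_isrec: "Rtime po pb v \<omega> k = enat n \<Longrightarrow> isrec v (Y \<omega>) k n"
proof -
  assume R: "Rtime po pb v \<omega> k = enat n"
  have iff: "(1 - v) * real k + v * real n \<le> real_of_int (Xw po pb \<omega> n) \<longleftrightarrow> (1 - v) * real k \<le> ht v (Y \<omega> n)" for n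
    by (auto simp: ht_def Xw_def)
  have "\<exists>n. (1 - v) * real k \<le> ht v (Y \<omega> n)"
    using R unfolding Rtime_def iff by (auto split: if_splits)
  then obtain n' where "isrec v (Y \<omega>) k n'" using isrec_exists by metis
  with Rtime_eq[OF this] R show ?thesis by simp
qed

text \<open>\<open>tau\<close> belongs to the smallest good level, not to a given one; record times
  increase with the level.\<close>

lemma tau_le:
  assumes k: "1 \<le> k" and rec: "isrec v (Y \<omega>) k n" and "cvoid \<omega> (Wcross v (Y \<omega> n))" "Aev po pb v \<omega> (Y \<omega> n)"
  shows "tau po pb v \<omega> \<le> enat n"
proof -
  have good: "good_index po pb v \<omega> k"
    using assms by (simp add: good_index_def Rtime_eq omega_count_eq_0)
  define k0 where "k0 = (LEAST k. k \<ge> 1 \<and> good_index po pb v \<omega> k)"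
  have k0: "1 \<le> k0" "good_index po pb v \<omega> k0" "k0 \<le> k"
    unfolding k0_def using LeastI[of "\<lambda>k. k \<ge> 1 \<and> good_index po pb v \<omega> k" k] Least_le[of "\<lambda>k. k \<ge> 1 \<and> good_index po pb v \<omega> k" k]
      k good by auto
  have "Iidx po pb v \<omega> = enat k0" unfolding Iidx_def k0_def using k good by auto
  moreover obtain n0 where n0: "Rtime po pb v \<omega> k0 = enat n0"
    using k0(2) by (auto simp: good_index_def split: enat.splits)
  moreover have "n0 \<le> n"
    using isrec_mono[OF Rtime_isrec[OF n0] rec k0(3) v1] .
  ultimately show ?thesis by (simp add: tau_def)
qed

end

text \<open>The recursion has fixed point 2e, and the distance to it contracts by 1 - d/2.\<close>

lemma linear_recursion_bound:
  fixes a :: "nat \<Rightarrow> real"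
  assumes "\<And>j. j < J \<Longrightarrow> a (Suc j) \<le> a j - d * (a j / 2 - e)" "a 0 \<le> 1" "0 \<le> d" "d \<le> 1" "0 \<le> e" "j \<le> J"
  shows "a j \<le> (1 - d / 2) ^ j + 2 * e"
  using \<open>j \<le> J\<close>
proof (induction j)
  case 0
  then show ?case using assms by simp
next
  case (Suc j)
  have "a (Suc j) - 2 * e \<le> (1 - d / 2) * (a j - 2 * e)"
    using assms(1)[of j] Suc.prems by (simp add: algebra_simps)
  also have "\<dots> \<le> (1 - d / 2) * (1 - d / 2) ^ j"
    using Suc assms by (intro mult_left_mono) auto
  finally show ?case by simp
qed

section \<open>Iterating the trials\<close>

context random_walk
begin

text \<open>Each of J trials occupies \<open>M'\<close> levels: m for the wait, l for the diagonal,
  H for the horizon. I bounds the time needed to climb m levels, and N the total time.\<close>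

theorem trial_bound:
  fixes m l H J N I :: nat
  defines "M' \<equiv> m + l + H + 1"
  assumes m: "1 \<le> m" and H: "real m \<le> 2 * v * real H" and I: "real m \<le> v * real I"
    and N: "real (J * M') + real m \<le> 2 * v * real N"
    and small: "real ((2 * I + 1) * (I + 1)) * (\<rho> * (K * exp (- v * ((1 - v) * real l)))) \<le> 1 / 2"
  shows "\<exists>Z\<in>events. prob Z \<le> (1 - \<delta> l / 2) ^ J + 3 * eps m N
    \<and> (\<forall>\<omega>. \<omega> \<notin> Z \<longrightarrow> tau po pb v \<omega> \<le> enat N)"
proof -
  \<comment> \<open>The level at the end of the forced diagonal, where trial i would
    succeed.\<close>
  define g where "g = (\<lambda>i. i * M' + m + l)"
  have g: "g i + H \<le> j * M'" if "i < j" for i j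
  proof -
    have "Suc i * M' \<le> j * M'" using that by (intro mult_le_mono1) auto
    then show ?thesis by (simp add: g_def M'_def)
  qed
  define nosuc where "nosuc = (\<lambda>j \<omega>. \<forall>i<j. \<not> success H (g i) \<omega>)"
  define V where "V = (\<lambda>j. {\<omega>. (\<exists>n. isrec v (Y \<omega>) (j * M') n) \<and> nosuc j \<omega>})"
  define \<Gamma> where "\<Gamma> = (\<lambda>j y. {\<omega>. recat (j * M') y \<omega> \<and> nosuc j \<omega>})"
  \<comment> \<open>The wait is over at z and no particle touching \<open>rcone v z\<close> reaches
    the cone of \<open>diag z l\<close>; all this belongs to the past of z.\<close>
  define \<Gamma>' where "\<Gamma>' = (\<lambda>j z. {\<omega>. recat (j * M' + m) z \<omega> \<and> nosuc j \<omega>} \<inter> {\<omega>. cvoid \<omega> (cross z (diag z l))})"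
  \<comment> \<open>Only particles not touching \<open>rcone v y\<close> are counted, so this is
    independent of the past of y; the site z is not known yet, hence the box.\<close>
  define bad where "bad = (\<lambda>y. {\<omega>. \<exists>z\<in>nbox I y. \<not> cvoid \<omega> (cross z (diag z l) - tch (rcone v y))})"
  define e where "e = eps m N"
  have notgood: "{\<omega>. \<not> good m N \<omega>} \<in> events" by (intro events_Collect) measurable
  have pe: "prob {\<omega>. \<not> good m N \<omega>} \<le> e" unfolding e_def by (rule prob_not_good[OF m])
  then have e0: "0 \<le> e" using measure_nonneg order_trans by blast
  have \<Gamma>: "\<Gamma> j y \<in> sets (past y)" for j y
    unfolding \<Gamma>_def nosuc_def using g by (intro recat_past) auto
  have \<Gamma>': "\<Gamma>' j z \<in> sets (past z)" for j z
  proof -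
    have "{\<omega>. recat (j * M' + m) z \<omega> \<and> nosuc j \<omega>} \<in> sets (past z)"
      unfolding nosuc_def using g by (intro recat_past) (auto intro: trans_le_add1)
    moreover have "Measurable.pred (past z) (\<lambda>\<omega>. cvoid \<omega> (cross z (diag z l)))"
      by (intro cvoid_measurable_Gm emeasure_cross_finite[of z "diag z l"]) (auto simp: cross_def)
    ultimately show ?thesis unfolding \<Gamma>'_def by (simp add: pred_def)
  qed
  have bad: "bad y \<in> sets (future y)" for y
  proof -
    have "Measurable.pred (future y) (\<lambda>\<omega>. \<exists>z\<in>nbox I y. \<not> cvoid \<omega> (cross z (diag z l) - tch (rcone v y)))"
    proof (intro pred_intros_finite(4) pred_intros_logic(2) cvoid_measurable_Gm)
      fix z
      show "emeasure (mu q) (cross z (diag z l) - tch (rcone v y)) < \<infinity>"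
        by (rule emeasure_cross_finite[of z "diag z l"]) auto
    qed auto
    then show ?thesis by (simp add: pred_def bad_def)
  qed
  have prob_bad: "prob (bad y) \<le> 1 / 2" for y
    unfolding bad_def by (rule order_trans[OF prob_nbox_cross small]) auto
  have disj: "disjoint_family (\<Gamma> j)" "disjoint_family (\<Gamma>' j)" for j
    using recat_unique by (fastforce simp: disjoint_family_on_def \<Gamma>_def \<Gamma>'_def)+
  have V_eq: "V j = (\<Union>y. \<Gamma> j y)" for j
    by (auto simp: V_def \<Gamma>_def recat_def dest: recatI[unfolded recat_def])
  have \<Gamma>M: "\<Gamma> j y \<in> events" and \<Gamma>'M: "\<Gamma>' j y \<in> events" and badM: "bad y \<in> events" and freshM: "fresh l y \<in> events" for j y
    using subsetD[OF sets_Gm_subset \<Gamma>] subsetD[OF sets_Gm_subset \<Gamma>'] subsetD[OF sets_Gm_subset bad]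
      subsetD[OF sets_Gm_subset fresh_sets] by auto
  have VM: "V j \<in> events" for j unfolding V_eq using \<Gamma>M by (intro sets.countable_UN') auto
  have \<Gamma>'UM: "(\<Union>z. \<Gamma>' j z) \<in> events" for j using \<Gamma>'M by (intro sets.countable_UN') auto
  have \<Gamma>'fM: "(\<Union>z. \<Gamma>' j z \<inter> fresh l z) \<in> events" for j using \<Gamma>'M freshM by (intro sets.countable_UN') auto
  have \<Gamma>bM: "(\<Union>y. \<Gamma> j y \<inter> bad y) \<in> events" for j using \<Gamma>M badM by (intro sets.countable_UN') auto
  have rec_less: "\<exists>n. isrec v (Y \<omega>) k n" if "isrec v (Y \<omega>) k' n'" "k \<le> k'" for \<omega> k k' n'
  proof -
    have "(1 - v) * real k \<le> (1 - v) * real k'" using that v by (intro mult_left_mono) auto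
    also have "\<dots> \<le> ht v (Y \<omega> n')" using that by (simp add: isrec_def)
    finally show ?thesis using isrec_exists by blast
  qed
  have rec_good: "\<exists>n\<le>N. isrec v (Y \<omega>) k n" if "good m N \<omega>" "k \<le> J * M'" for \<omega> k
  proof -
    have "ball m (0, 0) \<omega>" using that by (auto simp: good_def nbox_def)
    from ht_ball[OF this, of N] have "2 * v * real N - real m \<le> ht v (Y \<omega> N)" by (simp add: ht_def)
    moreover have "(1 - v) * real k \<le> real k" using v by (simp add: mult_left_le_one_le)
    moreover have "real k \<le> real (J * M')" using that(2) by (simp only: of_nat_le_iff)
    ultimately have "(1 - v) * real k \<le> ht v (Y \<omega> N)" using N by linarith
    then show ?thesis using isrec_exists by blast
  qed
  have in_box: "Y \<omega> n \<in> nbox N (0, 0)" if "n \<le> N" for \<omega> n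
    using that by (rule Yw_in_nbox)
  have main: "success H (g j) \<omega>" if "\<omega> \<in> \<Gamma>' j z" "\<omega> \<in> fresh l z" for j z \<omega>
  proof -
    interpret R: walk_records v "Y \<omega>" by (rule walk_records_Y)
    define n where "n = nat (snd z)"
    define z' where "z' = diag z l"
    have rec: "isrec v (Y \<omega>) (j * M' + m) n" and Yn: "Y \<omega> n = z"
      and ok: "cvoid \<omega> (cross z z')"
      using that(1) by (auto simp: \<Gamma>'_def recat_def n_def z'_def)
    have U: "\<And>i. i < l \<Longrightarrow> Ures (- rcone v z) \<omega> (diag z i) \<le> p"
      and void: "cvoid \<omega> (Wcross v z' - tch (rcone v z))"
      and st: "stay po pb (Tres (- tch (rcone v z)) \<omega>) (Ures (- rcone v z) \<omega>) z' (cone v z')"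
      using that(2) by (auto simp: fresh_def z'_def)
    have notin: "x \<notin> rcone v z" if "x \<in> cone v z" for x using cone_rcone_disjoint[OF v(1) that] .
    have diag_z: "diag z i \<in> cone v z" for i using diag_in_cone[OF v(1) v1, of 0 i z] by simp
    have "Unif \<omega> (diag z i) \<le> p" if "i < l" for i
      using U[OF that] notin[OF diag_z, of i] by (simp add: Ures_def)
    then have "Yw po pb \<omega> z i = diag z i" if "i \<le> l" for i
      unfolding Yw_def using that by (rule Ywalk_diag)
    then have Yd: "Y \<omega> (n + i) = diag (Y \<omega> n) i" if "i \<le> l" for i
      using that by (simp add: Yw_add Yn)
    have rec': "isrec v (Y \<omega>) (g j) (n + l)"
      using R.isrec_diag[OF rec Yd] by (simp add: g_def)
    have Y': "Y \<omega> (n + l) = z'" using Yd[of l] by (simp add: Yn z'_def)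
    have cr: "cvoid \<omega> (Wcross v z')"
    proof -
      \<comment> \<open>Particles unknown to the past of z are excluded by \<open>fresh\<close>,
        those touching it by \<Gamma>'.\<close>
      have "Wcross v z' \<subseteq> (Wcross v z' - tch (rcone v z)) \<union> cross z z'"
        by (auto simp: Wcross_eq_tch cross_def)
      then show ?thesis using void ok cvoid_Un cvoid_mono by metis
    qed
    have "cone v z' \<subseteq> cone v z" unfolding z'_def by (rule cone_mono[OF v(1) diag_z])
    moreover have "x \<in> Tres (- tch (rcone v z)) \<omega> \<longleftrightarrow> x \<in> Tset \<omega>" if "x \<in> cone v z'" for x
      unfolding Tset_eq_Tres
      by (rule Tres_cong[where C = "cone v z'"])
        (use that ok in \<open>auto simp: cross_def Int_commute intro: cvoid_mono\<close>)
    ultimately have "stay po pb (Tset \<omega>) (Unif \<omega>) z' (cone v z')"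
      using notin by (intro stay_cong[OF st]) (auto simp: Ures_def)
    then have "Y \<omega> (n + l + i) \<in> cone v z'" for i
      unfolding Yw_add[of \<omega> _ "n + l"] Y' by (simp add: stay_def Yw_def)
    then show ?thesis
      unfolding success_def using rec' Y' cr by (intro exI[of _ "n + l"]) auto
  qed
  have step: "prob (V (Suc j)) \<le> prob (V j) - \<delta> l * (prob (V j) / 2 - e)" if j: "j < J" for j
  proof -
    have U'V: "(\<Union>z. \<Gamma>' j z) \<subseteq> V j"
      using rec_less by (fastforce simp: V_def \<Gamma>'_def recat_def)
    have "V (Suc j) \<subseteq> V j - (\<Union>z. \<Gamma>' j z \<inter> fresh l z)"
    proof
      fix \<omega> assume \<omega>: "\<omega> \<in> V (Suc j)"
      then obtain n where "isrec v (Y \<omega>) (Suc j * M') n" "nosuc (Suc j) \<omega>" by (auto simp: V_def)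
      then have "\<exists>n. isrec v (Y \<omega>) (j * M') n" "nosuc j \<omega>" "\<not> success H (g j) \<omega>"
        using rec_less[of \<omega> "Suc j * M'" n "j * M'"] by (auto simp: nosuc_def)
      then show "\<omega> \<in> V j - (\<Union>z. \<Gamma>' j z \<inter> fresh l z)"
        unfolding V_def using main by blast
    qed
    then have "prob (V (Suc j)) \<le> prob (V j - (\<Union>z. \<Gamma>' j z \<inter> fresh l z))"
      using VM \<Gamma>'fM by (intro finite_measure_mono) auto
    also have "\<dots> = prob (V j) - prob (\<Union>z. \<Gamma>' j z \<inter> fresh l z)"
      using VM \<Gamma>'fM U'V by (intro finite_measure_Diff) auto
    finally have "prob (V (Suc j)) \<le> prob (V j) - prob (\<Union>z. \<Gamma>' j z \<inter> fresh l z)" .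
    moreover have "\<delta> l * prob (\<Union>z. \<Gamma>' j z) \<le> prob (\<Union>z. \<Gamma>' j z \<inter> fresh l z)"
      using \<delta>[of l] by (intro prob_Union_past_future(1) \<Gamma>' fresh_sets disj prob_fresh) auto
    ultimately have 1: "prob (V (Suc j)) \<le> prob (V j) - \<delta> l * prob (\<Union>z. \<Gamma>' j z)" by simp
    \<comment> \<open>Since \<open>bad y\<close> has probability at most 1/2 independently of the
      past of y, at least half of \<open>V j\<close>, up to e, reaches \<Gamma>'.\<close>
    have "V j \<subseteq> (\<Union>z. \<Gamma>' j z) \<union> ((\<Union>y. \<Gamma> j y \<inter> bad y) \<union> {\<omega>. \<not> good m N \<omega>})"
    proof (rule subsetI, rule ccontr)
      fix \<omega> assume \<omega>: "\<omega> \<in> V j" and not: "\<omega> \<notin> (\<Union>z. \<Gamma>' j z) \<union> ((\<Union>y. \<Gamma> j y \<inter> bad y) \<union> {\<omega>. \<not> good m N \<omega>})"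
      interpret R: walk_records v "Y \<omega>" by (rule walk_records_Y)
      have good: "good m N \<omega>" and no: "nosuc j \<omega>" using not \<omega> by (auto simp: V_def)
      have "j * M' \<le> J * M'" using j by (intro mult_le_mono1) auto
      then obtain n where n: "n \<le> N" "isrec v (Y \<omega>) (j * M') n" using rec_good[OF good] by blast
      define y where "y = Y \<omega> n"
      have "y \<in> nbox N (0, 0)" unfolding y_def by (rule in_box[OF n(1)])
      then have ball: "ball m y \<omega>" and far: "cvoid \<omega> (cross y (diag y (m - 1)))"
        using good by (auto simp: good_def)
      \<comment> \<open>In I steps the height grows by at least 2vI - m, which is at least m, so the
        wait ends within I steps and z lies in the box around y.\<close>
      have "(1 - v) * real (j * M' + m) \<le> ht v (Y \<omega> (n + I))"
      proof -
        have "(1 - v) * real (j * M') \<le> ht v y" using n(2) by (simp add: isrec_def y_def)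
        moreover have "(1 - v) * real m \<le> real m" using v by (simp add: mult_left_le_one_le)
        moreover have "ht v y + 2 * v * real I - real m \<le> ht v (Y \<omega> (n + I))"
          using ht_ball[OF ball, of I] by (simp add: Yw_add y_def)
        ultimately show ?thesis using I by (simp add: distrib_left)
      qed
      then obtain n' where n': "n' \<le> n + I" "isrec v (Y \<omega>) (j * M' + m) n'" by (rule isrec_exists)
      define z where "z = Y \<omega> n'"
      have "n \<le> n'" using isrec_mono[OF n(2) n'(2) _ v1] by simp
      then obtain i where i: "n' = n + i" "i \<le> I" using n'(1) by (auto simp: le_iff_add)
      have zbox: "z \<in> nbox I y" unfolding z_def i(1) Yw_add y_def by (rule Yw_in_nbox[OF i(2)])
      have "z \<in> cone v (diag y (m - 1))"
        unfolding z_def y_def by (rule R.isrec_cone[OF n(2) n'(2) m])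
      then have zc: "cone v (diag z l) \<subseteq> cone v (diag y (m - 1))"
        using cone_mono[OF v(1)] diag_in_cone[OF v(1) v1, of 0 l z] by (metis diag_simps(3) dual_order.trans le0)
      have "recat (j * M' + m) z \<omega>" "recat (j * M') y \<omega>"
        unfolding z_def y_def by (intro recatI n' n)+
      then have nv: "\<not> cvoid \<omega> (cross z (diag z l))" and nb: "\<omega> \<notin> bad y"
        using not no unfolding \<Gamma>'_def \<Gamma>_def by blast+
      \<comment> \<open>The two treatments of particles meet here: the first part is void since
        \<open>bad y\<close> fails, the second by \<open>good\<close>.\<close>
      have "cross z (diag z l) \<subseteq> (cross z (diag z l) - tch (rcone v y)) \<union> cross y (diag y (m - 1))"
        using tch_mono[OF zc] by (auto simp: cross_def)
      moreover have "cvoid \<omega> (cross z (diag z l) - tch (rcone v y))"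
        using nb zbox by (auto simp: bad_def)
      ultimately have "cvoid \<omega> (cross z (diag z l))"
        using far cvoid_Un cvoid_mono by metis
      then show False using nv by simp
    qed
    then have "prob (V j) \<le> prob ((\<Union>z. \<Gamma>' j z) \<union> ((\<Union>y. \<Gamma> j y \<inter> bad y) \<union> {\<omega>. \<not> good m N \<omega>}))"
      using \<Gamma>'UM \<Gamma>bM notgood by (intro finite_measure_mono sets.Un) auto
    also have "\<dots> \<le> prob (\<Union>z. \<Gamma>' j z) + prob ((\<Union>y. \<Gamma> j y \<inter> bad y) \<union> {\<omega>. \<not> good m N \<omega>})"
      using \<Gamma>'UM \<Gamma>bM notgood by (intro measure_Un_le sets.Un) auto
    also have "prob ((\<Union>y. \<Gamma> j y \<inter> bad y) \<union> {\<omega>. \<not> good m N \<omega>}) \<le> prob (\<Union>y. \<Gamma> j y \<inter> bad y) + prob {\<omega>. \<not> good m N \<omega>}"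
      using \<Gamma>bM notgood by (intro measure_Un_le) auto
    also have "prob (\<Union>y. \<Gamma> j y \<inter> bad y) \<le> 1 / 2 * prob (\<Union>y. \<Gamma> j y)"
      by (intro prob_Union_past_future(2) \<Gamma> bad disj prob_bad) auto
    finally have "prob (V j) / 2 - e \<le> prob (\<Union>z. \<Gamma>' j z)"
      using pe by (simp add: V_eq)
    then have "\<delta> l * (prob (V j) / 2 - e) \<le> \<delta> l * prob (\<Union>z. \<Gamma>' j z)"
      using \<delta>[of l] by (intro mult_left_mono) auto
    with 1 show ?thesis by linarith
  qed
  have pV: "prob (V J) \<le> (1 - \<delta> l / 2) ^ J + 2 * e"
    by (rule linear_recursion_bound[where a = "\<lambda>j. prob (V j)" and J = J, OF step])
       (use \<delta>[of l] e0 in auto)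
  show ?thesis
  proof (intro bexI conjI allI impI)
    show "V J \<union> {\<omega>. \<not> good m N \<omega>} \<in> events" using VM notgood by (intro sets.Un) auto
    have "prob (V J \<union> {\<omega>. \<not> good m N \<omega>}) \<le> prob (V J) + prob {\<omega>. \<not> good m N \<omega>}"
      using VM notgood by (intro measure_Un_le) auto
    then show "prob (V J \<union> {\<omega>. \<not> good m N \<omega>}) \<le> (1 - \<delta> l / 2) ^ J + 3 * eps m N"
      using pV pe by (simp add: e_def)
    fix \<omega> assume "\<omega> \<notin> V J \<union> {\<omega>. \<not> good m N \<omega>}"
    then have good: "good m N \<omega>" and nV: "\<omega> \<notin> V J" by auto
    obtain n where n: "n \<le> N" "isrec v (Y \<omega>) (J * M') n" using rec_good[OF good order_refl] by blast
    then obtain i where i: "i < J" "success H (g i) \<omega>" using nV by (auto simp: V_def nosuc_def)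
    then obtain n' where n': "isrec v (Y \<omega>) (g i) n'" "cvoid \<omega> (Wcross v (Y \<omega> n'))"
      "\<And>a. a \<le> H \<Longrightarrow> Y \<omega> (n' + a) \<in> cone v (Y \<omega> n')" by (auto simp: success_def)
    have "n' \<le> n" using isrec_mono[OF n'(1) n(2) _ v1] g[OF i(1)] by simp
    then have le: "n' \<le> N" using n(1) by simp
    then have ball: "ball m (Y \<omega> n') \<omega>" using good in_box by (auto simp: good_def)
    \<comment> \<open>Beyond the horizon, ballisticity with slack m takes over, since 2vH \<ge>
      m.\<close>
    have "Yw po pb \<omega> (Y \<omega> n') a \<in> cone v (Y \<omega> n')" for a
    proof (cases "a \<le> H")
      case True
      then show ?thesis using n'(3) by (simp add: Yw_add)
    next
      case False
      then have "2 * v * real H \<le> 2 * v * real a" using v by (intro mult_left_mono) auto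
      then have "real m \<le> 2 * v * real a" using H by simp
      then show ?thesis using ht_ball[OF ball, of a] by (simp add: mem_cone_iff[OF v(1)])
    qed
    then have "Aev po pb v \<omega> (Y \<omega> n')" by (simp add: Aev_def)
    \<comment> \<open>Level 0 is excluded in \<open>Iidx\<close>.\<close>
    moreover have "1 \<le> g i" using m by (simp add: g_def)
    ultimately have "tau po pb v \<omega> \<le> enat n'" using tau_le n' by blast
    then show "tau po pb v \<omega> \<le> enat N" using le by (meson enat_ord_simps(1) order_trans)
  qed
qed

lemma Bangle_sets: "Bangle po pb v \<in> events"
proof -
  have "Measurable.pred M (\<lambda>\<omega>. cvoid \<omega> (cross (0, 0) (0, 0)) \<and> (\<forall>i. Y \<omega> i \<in> cone v (0, 0)))"
    by measurable
  then show ?thesis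
    unfolding Bangle_def omega_count_eq_0 Wcross_eq_cross Aev_def by (rule events_Collect)
qed

end

section \<open>Choice of scales and the tail of the regeneration time\<close>

context random_walk
begin

text \<open>At scale \<open>m\<close> a trial succeeds with probability at least a power of \<open>1 / m\<close>, so polynomially many trials suffice; the
  remaining errors are those of the ballisticity condition at scale \<open>m\<close> up to polynomial factors.\<close>
lemma tau_tail:
  "\<exists>D\<ge>1. \<forall>\<^sub>F m in sequentially. \<exists>Z\<in>events. prob Z \<le> exp (- (c0 / 2) * ln (real m) powr \<gamma>)
     \<and> (\<forall>\<omega>. \<omega> \<notin> Z \<longrightarrow> tau po pb v \<omega> \<le> enat (m ^ D))"
proof -
  \<comment> \<open>Both the horizon H and the climbing time I will be B * m.\<close>
  obtain B :: nat where "1 / v < real B" using reals_Archimedean2 by blast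
  then have B: "1 \<le> v * real B" using v by (simp add: field_simps)
  define b where "b = real B"
  have b: "0 < b" using B v by (cases "B = 0") (auto simp: b_def)
  \<comment> \<open>Chosen so that one crossing has probability of order m^(-3), against about m^2
    sites in the box.\<close>
  define A where "A = 3 / (v * (1 - v))"
  have A: "0 < A" using v by (simp add: A_def)
  define l where "l = (\<lambda>m. nat \<lceil>A * ln (real m)\<rceil>)"
  \<comment> \<open>The forced diagonal then costs p^l \<ge> p m^(-E), and m^(E+1) trials give an
    expected number of successes of order m.\<close>
  define E where "E = nat \<lceil>- A * ln p\<rceil>"
  define J where "J = (\<lambda>m::nat. m ^ (E + 1))"
  define N where "N = (\<lambda>m. B * (J m * (m + l m + B * m + 1) + m))"
  \<comment> \<open>\<open>J m * m\<close> equals m^(E+2); one further power absorbs the constant B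
    (B + 4) in the bound for \<open>N m\<close>.\<close>
  define D where "D = E + 3"
  define k where "k = p * p ^ L2 * exp (- \<rho> * K) / 2"
  have k: "0 < k" using p by (simp add: k_def)
  have K: "0 < K" by (rule crossK_pos[OF v(1)])
  have l_ge: "A * ln (real m) \<le> real (l m)" for m unfolding l_def by linarith
  have l_le: "real (l m) \<le> A * ln (real m) + 1" if "1 \<le> m" for m
  proof -
    have "0 \<le> A * ln (real m)" using A that by (intro mult_nonneg_nonneg) auto
    then show ?thesis unfolding l_def by linarith
  qed
  have slope: "0 < v * (1 - v)" using v by simp
  define r where "r = v * (1 - v)"
  have r: "0 < r" using slope by (simp add: r_def)
  have small: "\<forall>\<^sub>F m in sequentially. (2 * (b * real m) + 1) * (b * real m + 1) * (\<rho> * (K * exp (- 3 * ln (real m)))) \<le> 1 / 2"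
  proof -
    have "((\<lambda>m::nat. (2 * (b * real m) + 1) * (b * real m + 1) * (\<rho> * (K * exp (- 3 * ln (real m))))) \<longlongrightarrow> 0) sequentially"
      using b rho K by real_asymp
    then have "\<forall>\<^sub>F m in sequentially. (2 * (b * real m) + 1) * (b * real m + 1) * (\<rho> * (K * exp (- 3 * ln (real m)))) < 1 / 2"
      by (rule order_tendstoD) simp
    then show ?thesis by eventually_elim simp
  qed
  have logl: "\<forall>\<^sub>F m in sequentially. A * ln (real m) + 1 \<le> real m"
    using A by real_asymp
  \<comment> \<open>Each of three error terms gets a third of the target. Giving up half of c0 pays
    for polynomial factors, as (ln m)^\<gamma> dominates ln m.\<close>
  have third: "\<forall>\<^sub>F m in sequentially. f m \<le> exp (- (c0 / 2) * ln (real m) powr \<gamma>) / 3"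
    if "((\<lambda>m. f m / exp (- (c0 / 2) * ln (real m) powr \<gamma>)) \<longlongrightarrow> 0) sequentially" for f :: "nat \<Rightarrow> real"
  proof -
    have "\<forall>\<^sub>F m in sequentially. f m / exp (- (c0 / 2) * ln (real m) powr \<gamma>) < 1 / 3"
      using that by (rule order_tendstoD) simp
    then show ?thesis by eventually_elim (simp add: divide_less_eq)
  qed
  have t1: "\<forall>\<^sub>F m::nat in sequentially. exp (- (k / 2) * real m) \<le> exp (- (c0 / 2) * ln (real m) powr \<gamma>) / 3"
    by (rule third, use k c0 gamma in real_asymp)
  have t2: "\<forall>\<^sub>F m::nat in sequentially. 18 * real m ^ (2 * D) * (\<rho> * (K * exp (- r * (real m - 1))))
      \<le> exp (- (c0 / 2) * ln (real m) powr \<gamma>) / 3"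
    by (rule third, use r rho K c0 gamma in real_asymp)
  have t3: "\<forall>\<^sub>F m::nat in sequentially. 18 * real m ^ (2 * D) * (exp (- c0 * ln (real m) powr \<gamma>) / c0)
      \<le> exp (- (c0 / 2) * ln (real m) powr \<gamma>) / 3"
    by (rule third, use c0 gamma in real_asymp)
  have "\<forall>\<^sub>F m in sequentially. \<exists>Z\<in>events. prob Z \<le> exp (- (c0 / 2) * ln (real m) powr \<gamma>)
     \<and> (\<forall>\<omega>. \<omega> \<notin> Z \<longrightarrow> tau po pb v \<omega> \<le> enat (m ^ D))"
    using small logl t1 t2 t3 eventually_ge_at_top[of "B * (B + 4)"] eventually_ge_at_top[of 1]
  proof eventually_elim
    case (elim m)
    have m: "1 \<le> m" and mB: "B * (B + 4) \<le> m" by fact+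
    have lm: "l m \<le> m" using l_le[OF m] elim(2) by simp
    have ND: "N m \<le> m ^ D"
    proof -
      have "m + l m + B * m + 1 \<le> (B + 3) * m" using lm m by (simp add: algebra_simps)
      then have "J m * (m + l m + B * m + 1) \<le> J m * ((B + 3) * m)" by (rule mult_le_mono2)
      moreover have "m \<le> J m * m" using m one_le_power[OF m, of "E + 1"] by (simp add: J_def)
      ultimately have "J m * (m + l m + B * m + 1) + m \<le> J m * ((B + 3) * m) + J m * m" by (rule add_mono)
      also have "\<dots> = (B + 4) * (J m * m)" by (simp add: algebra_simps)
      finally have "N m \<le> B * ((B + 4) * (J m * m))" unfolding N_def by (rule mult_le_mono2)
      also have "\<dots> = B * (B + 4) * (J m * m)" by simp
      also have "\<dots> \<le> m * (J m * m)" using mB by (rule mult_le_mono1)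
      also have "\<dots> = m ^ D" by (simp add: J_def D_def power_add power3_eq_cube)
      finally show ?thesis .
    qed
    have lnm: "0 \<le> ln (real m)" using m by simp
    have "\<exists>Z\<in>events. prob Z \<le> (1 - \<delta> (l m) / 2) ^ J m + 3 * eps m (N m)
      \<and> (\<forall>\<omega>. \<omega> \<notin> Z \<longrightarrow> tau po pb v \<omega> \<le> enat (N m))"
    proof (rule trial_bound[where l = "l m" and H = "B * m" and I = "B * m"])
      have vB: "real m \<le> v * real B * real m" using B m by simp
      then show "real m \<le> v * real (B * m)" by simp
      then show "real m \<le> 2 * v * real (B * m)" using v by simp
      have "1 * (real (J m * (m + l m + B * m + 1)) + real m) \<le> (2 * (v * real B)) * (real (J m * (m + l m + B * m + 1)) + real m)"
        using B by (intro mult_right_mono) auto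
      also have "\<dots> = 2 * v * real (N m)" by (simp add: N_def)
      finally show "real (J m * (m + l m + B * m + 1)) + real m \<le> 2 * v * real (N m)" by simp
      have "- v * ((1 - v) * real (l m)) \<le> - 3 * ln (real m)"
      proof -
        have "3 * ln (real m) = v * (1 - v) * (A * ln (real m))" using v by (simp add: A_def)
        also have "\<dots> \<le> v * (1 - v) * real (l m)" using l_ge slope by (intro mult_left_mono) auto
        finally show ?thesis by simp
      qed
      then have "(2 * (b * real m) + 1) * (b * real m + 1) * (\<rho> * (K * exp (- v * ((1 - v) * real (l m)))))
        \<le> (2 * (b * real m) + 1) * (b * real m + 1) * (\<rho> * (K * exp (- 3 * ln (real m))))"
        using b rho K by (intro mult_left_mono) auto
      with elim(1) have "(2 * (b * real m) + 1) * (b * real m + 1) * (\<rho> * (K * exp (- v * ((1 - v) * real (l m))))) \<le> 1 / 2"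
        by (rule order_trans[rotated])
      then show "real ((2 * (B * m) + 1) * (B * m + 1)) * (\<rho> * (K * exp (- v * ((1 - v) * real (l m))))) \<le> 1 / 2"
        unfolding b_def by (simp only: of_nat_mult of_nat_add of_nat_1 of_nat_numeral)
    qed (rule m)
    then obtain Z where Z: "Z \<in> events" "prob Z \<le> (1 - \<delta> (l m) / 2) ^ J m + 3 * eps m (N m)"
      "\<And>\<omega>. \<omega> \<notin> Z \<Longrightarrow> tau po pb v \<omega> \<le> enat (N m)" by blast
    have "k * real m \<le> \<delta> (l m) * real (J m)"
    proof -
      have "p * exp (- real E * ln (real m)) \<le> p ^ l m"
      proof -
        have lnp: "ln p \<le> 0" using p by (intro ln_le_zero_iff[THEN iffD2]) auto
        have "- A * ln p \<le> real E" unfolding E_def by linarith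
        then have "- real E * ln (real m) \<le> (A * ln p) * ln (real m)" using lnm by (intro mult_right_mono) auto
        moreover have "(A * ln (real m) + 1) * ln p \<le> real (l m) * ln p"
          using l_le[OF m] lnp by (rule mult_right_mono_neg)
        ultimately have "ln p + - real E * ln (real m) \<le> real (l m) * ln p" by (simp add: algebra_simps)
        then have "exp (ln p + - real E * ln (real m)) \<le> exp (real (l m) * ln p)" by simp
        then show ?thesis using p by (simp only: exp_add exp_of_nat_mult exp_ln)
      qed
      then have "p * exp (- real E * ln (real m)) * (p ^ L2 * exp (- \<rho> * K) / 2) \<le> p ^ l m * (p ^ L2 * exp (- \<rho> * K) / 2)"
        using p by (intro mult_right_mono) auto
      also have "\<dots> = \<delta> (l m)" by (simp add: \<delta>_def power_add)
      finally have "k * exp (- real E * ln (real m)) \<le> \<delta> (l m)" by (simp add: k_def mult_ac)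
      then have "k * exp (- real E * ln (real m)) * real (J m) \<le> \<delta> (l m) * real (J m)"
        by (intro mult_right_mono) auto
      moreover have "exp (- real E * ln (real m)) * real (J m) = real m"
      proof -
        have "exp (real E * ln (real m)) = real m ^ E" using m by (simp add: exp_of_nat_mult)
        then show ?thesis using m by (simp add: J_def exp_minus field_simps)
      qed
      ultimately show ?thesis by (simp add: mult.assoc)
    qed
    have "(1 - \<delta> (l m) / 2) ^ J m \<le> exp (- (k / 2) * real m)"
    proof -
      have "(1 - \<delta> (l m) / 2) ^ J m \<le> exp (- (\<delta> (l m) / 2)) ^ J m"
        using \<delta>[of "l m"] exp_ge_add_one_self[of "- (\<delta> (l m) / 2)"] by (intro power_mono) auto
      also have "\<dots> = exp (real (J m) * - (\<delta> (l m) / 2))" by (rule exp_of_nat_mult[symmetric])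
      also have "\<dots> \<le> exp (- (k / 2) * real m)"
        using \<open>k * real m \<le> \<delta> (l m) * real (J m)\<close> by (simp add: mult.commute)
      finally show ?thesis .
    qed
    moreover have "3 * eps m (N m) \<le> 18 * real m ^ (2 * D) * (\<rho> * (K * exp (- r * (real m - 1)))) + 18 * real m ^ (2 * D) * slow m"
    proof -
      have "(2 * N m + 1) * (N m + 1) \<le> (3 * m ^ D) * (2 * m ^ D)"
        using ND one_le_power[OF m, of D] by (intro mult_le_mono) linarith+
      also have "\<dots> = 6 * m ^ (2 * D)" by (simp add: mult_2 power_add)
      finally have "real ((2 * N m + 1) * (N m + 1)) \<le> real (6 * m ^ (2 * D))" by (simp only: of_nat_le_iff)
      then have "real ((2 * N m + 1) * (N m + 1)) \<le> 6 * real m ^ (2 * D)" by simp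
      then have "eps m (N m) \<le> 6 * real m ^ (2 * D) * (\<rho> * (K * exp (- v * ((1 - v) * real (m - 1)))) + slow m)"
        unfolding eps_def using rho K c0 by (intro mult_right_mono add_nonneg_nonneg mult_nonneg_nonneg) auto
      also have "- v * ((1 - v) * real (m - 1)) = - r * (real m - 1)" using m by (simp add: r_def of_nat_diff)
      finally show ?thesis by (simp add: distrib_left)
    qed
    ultimately have "prob Z \<le> exp (- (c0 / 2) * ln (real m) powr \<gamma>)"
      using Z(2) elim(3,4,5) by linarith
    moreover have "tau po pb v \<omega> \<le> enat (m ^ D)" if "\<omega> \<notin> Z" for \<omega>
      using Z(3)[OF that] ND by (meson enat_ord_simps(1) order_trans)
    ultimately show ?case using Z(1) by blast
  qed
  moreover have "1 \<le> D" by (simp add: D_def)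
  ultimately show ?thesis by blast
qed

section \<open>From tails at polynomial scales to the stretched moment\<close>

lemma tail_weight_le:
  assumes "0 \<le> c" "tau po pb v \<omega> \<le> enat (m ^ D)" "1 \<le> m"
  shows "tail_weight c \<gamma> (tau po pb v \<omega>) \<le> ennreal (exp (c * (real D * ln (real m)) powr \<gamma>))"
proof -
  obtain n where n: "tau po pb v \<omega> = enat n" "n \<le> m ^ D"
    using assms(2) by (cases "tau po pb v \<omega>") auto
  have "ln (real n) powr \<gamma> \<le> (real D * ln (real m)) powr \<gamma>"
  \<comment> \<open>For n = 0 the conventions \<open>ln 0 = 0\<close> and
    \<open>0 powr \<gamma> = 0\<close> apply.\<close>
  proof (cases "n = 0")
    case False
    have "ln (real n) \<le> ln (real (m ^ D))" using n(2) False assms(3) by (subst ln_le_cancel_iff) (auto simp del: of_nat_power)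
    also have "\<dots> = real D * ln (real m)" using assms(3) by (simp add: ln_realpow)
    finally show ?thesis using False gamma by (intro powr_mono2) auto
  qed simp
  then show ?thesis using assms(1) n(1) by (simp add: tail_weight_def mult_left_mono)
qed

theorem regeneration_tail:
  "\<exists>c>0. (\<integral>\<^sup>+\<omega>. tail_weight c \<gamma> (tau po pb v \<omega>) \<partial>M) < \<infinity>
    \<and> (AE \<omega> in M. tau po pb v \<omega> \<noteq> \<infinity>)
    \<and> (\<integral>\<^sup>+\<omega>. tail_weight c \<gamma> (tau po pb v \<omega>) \<partial>uniform_measure M (Bangle po pb v)) < \<infinity>
    \<and> (AE \<omega> in uniform_measure M (Bangle po pb v). tau po pb v \<omega> \<noteq> \<infinity>)"
proof -
  obtain D where D: "1 \<le> D" and tail: "\<forall>\<^sub>F m in sequentially. \<exists>Z\<in>events. prob Z \<le> exp (- (c0 / 2) * ln (real m) powr \<gamma>)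
     \<and> (\<forall>\<omega>. \<omega> \<notin> Z \<longrightarrow> tau po pb v \<omega> \<le> enat (m ^ D))"
    using tau_tail by blast
  \<comment> \<open>On \<open>tau\<close> \<le> m^D the logarithm is at most D ln m, so the weight
    is at most exp((c0/8)(ln m)^\<gamma>), with room against the tail exponent c0/2.\<close>
  define c where "c = c0 / (8 * real D powr \<gamma>)"
  have c: "0 < c" using c0 D by (simp add: c_def)
  define W where "W = (\<lambda>m. exp (c * (real D * ln (real m)) powr \<gamma>))"
  have W: "W m = exp (c0 / 8 * ln (real m) powr \<gamma>)" if "1 \<le> m" for m
  proof -
    have "(real D * ln (real m)) powr \<gamma> = real D powr \<gamma> * ln (real m) powr \<gamma>"
      by (rule powr_mult)
    then show ?thesis using D by (simp add: W_def c_def)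
  qed
  have sq: "\<forall>\<^sub>F m::nat in sequentially. exp (c0 / 8 * ln (real (m + 1)) powr \<gamma>) * exp (- (c0 / 2) * ln (real m) powr \<gamma>) \<le> 1 / real m ^ 2"
    using c0 gamma by real_asymp
  have "\<forall>\<^sub>F m in sequentially. 1 \<le> m \<and> (\<exists>Z\<in>events. prob Z \<le> exp (- (c0 / 2) * ln (real m) powr \<gamma>)
     \<and> (\<forall>\<omega>. \<omega> \<notin> Z \<longrightarrow> tau po pb v \<omega> \<le> enat (m ^ D)))
     \<and> exp (c0 / 8 * ln (real (m + 1)) powr \<gamma>) * exp (- (c0 / 2) * ln (real m) powr \<gamma>) \<le> 1 / real m ^ 2"
    using tail sq eventually_ge_at_top[of 1] by eventually_elim blast
  then obtain m1 where m1: "\<And>m. m1 \<le> m \<Longrightarrow> 1 \<le> m"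
    and ex: "\<And>m. m1 \<le> m \<Longrightarrow> \<exists>Z\<in>events. prob Z \<le> exp (- (c0 / 2) * ln (real m) powr \<gamma>)
     \<and> (\<forall>\<omega>. \<omega> \<notin> Z \<longrightarrow> tau po pb v \<omega> \<le> enat (m ^ D))"
    and sq: "\<And>m. m1 \<le> m \<Longrightarrow> exp (c0 / 8 * ln (real (m + 1)) powr \<gamma>) * exp (- (c0 / 2) * ln (real m) powr \<gamma>) \<le> 1 / real m ^ 2"
    unfolding eventually_sequentially by blast
  have "\<forall>i. \<exists>Z. Z \<in> events \<and> prob Z \<le> exp (- (c0 / 2) * ln (real (m1 + i)) powr \<gamma>)
     \<and> (\<forall>\<omega>. \<omega> \<notin> Z \<longrightarrow> tau po pb v \<omega> \<le> enat ((m1 + i) ^ D))"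
    using ex by (meson le_add1)
  then obtain Z where Z: "\<And>i. Z i \<in> events" "\<And>i. prob (Z i) \<le> exp (- (c0 / 2) * ln (real (m1 + i)) powr \<gamma>)"
    "\<And>i \<omega>. \<omega> \<notin> Z i \<Longrightarrow> tau po pb v \<omega> \<le> enat ((m1 + i) ^ D)" by metis
  note [measurable] = Z(1)
  \<comment> \<open>A measurable majorant: if i is the first index with \<omega> outside
    \<open>Z i\<close>, the weight is at most W (m1 + i), the constant for i = 0 and otherwise the
    term of index i - 1. Hence the shift by one.\<close>
  define h where "h = (\<lambda>\<omega>. ennreal (W m1) + (\<Sum>i. ennreal (W (m1 + i + 1)) * indicator (Z i) \<omega>))"
  have hM [measurable]: "h \<in> borel_measurable M" unfolding h_def by measurable
  have hint: "(\<integral>\<^sup>+\<omega>. h \<omega> \<partial>M) < \<infinity>"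
  proof -
    have "(\<integral>\<^sup>+\<omega>. h \<omega> \<partial>M) = ennreal (W m1) + (\<integral>\<^sup>+\<omega>. (\<Sum>i. ennreal (W (m1 + i + 1)) * indicator (Z i) \<omega>) \<partial>M)"
      unfolding h_def by (subst nn_integral_add) (auto simp: emeasure_space_1[simplified])
    also have "(\<integral>\<^sup>+\<omega>. (\<Sum>i. ennreal (W (m1 + i + 1)) * indicator (Z i) \<omega>) \<partial>M)
      = (\<Sum>i. \<integral>\<^sup>+\<omega>. ennreal (W (m1 + i + 1)) * indicator (Z i) \<omega> \<partial>M)"
      by (rule nn_integral_suminf) measurable
    also have "\<dots> \<le> (\<Sum>i. ennreal (1 / real (m1 + i) ^ 2))"
    proof (rule suminf_le)
      fix i
      have "(\<integral>\<^sup>+\<omega>. ennreal (W (m1 + i + 1)) * indicator (Z i) \<omega> \<partial>M) = ennreal (W (m1 + i + 1) * prob (Z i))"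
        by (subst nn_integral_cmult_indicator) (auto simp: emeasure_eq_measure ennreal_mult W_def)
      also have "\<dots> \<le> ennreal (1 / real (m1 + i) ^ 2)"
      proof (rule ennreal_leI)
        have "W (m1 + i + 1) * prob (Z i) \<le> W (m1 + i + 1) * exp (- (c0 / 2) * ln (real (m1 + i)) powr \<gamma>)"
          using Z(2)[of i] by (intro mult_left_mono) (auto simp: W_def)
        also have "\<dots> \<le> 1 / real (m1 + i) ^ 2" using sq[of "m1 + i"] W[of "m1 + i + 1"] by simp
        finally show "W (m1 + i + 1) * prob (Z i) \<le> 1 / real (m1 + i) ^ 2" .
      qed
      finally show "(\<integral>\<^sup>+\<omega>. ennreal (W (m1 + i + 1)) * indicator (Z i) \<omega> \<partial>M) \<le> ennreal (1 / real (m1 + i) ^ 2)" .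
    qed auto
    also have "\<dots> < \<infinity>"
    proof -
      have "summable (\<lambda>i. inverse (real (i + m1) ^ 2))"
        by (rule summable_ignore_initial_segment[OF inverse_power_summable]) simp
      then have "summable (\<lambda>i. 1 / real (m1 + i) ^ 2)" by (simp add: inverse_eq_divide add.commute)
      then have "(\<Sum>i. ennreal (1 / real (m1 + i) ^ 2)) \<noteq> \<top>" by (rule ennreal_suminf_neq_top) simp
      then show ?thesis by (simp add: less_top)
    qed
    finally show ?thesis by simp
  qed
  have AE_Z: "AE \<omega> in M. \<exists>i. \<omega> \<notin> Z i"
  proof -
    have "prob (\<Inter>i. Z i) \<le> exp (- (c0 / 2) * ln (real (m1 + i)) powr \<gamma>)" for i
      by (rule order_trans[OF finite_measure_mono Z(2)]) auto
    moreover have "((\<lambda>i::nat. exp (- (c0 / 2) * ln (real (m1 + i)) powr \<gamma>)) \<longlongrightarrow> 0) sequentially"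
      using c0 gamma by real_asymp
    ultimately have "prob (\<Inter>i. Z i) \<le> 0"
      by (intro LIMSEQ_le_const) auto
    then have "emeasure M (\<Inter>i. Z i) = 0" by (simp add: emeasure_eq_measure measure_le_0_iff)
    then show ?thesis by (intro AE_I[where N = "\<Inter>i. Z i"]) auto
  qed
  have fin: "tau po pb v \<omega> \<noteq> \<infinity>" if ex: "\<exists>i. \<omega> \<notin> Z i" for \<omega>
  proof -
    obtain i where "\<omega> \<notin> Z i" using ex by blast
    then have "tau po pb v \<omega> \<le> enat ((m1 + i) ^ D)" by (rule Z(3))
    then show ?thesis by (cases "tau po pb v \<omega>") auto
  qed
  have le_h: "tail_weight c \<gamma> (tau po pb v \<omega>) \<le> h \<omega>" if "\<exists>i. \<omega> \<notin> Z i" for \<omega>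
  proof -
    define i where "i = (LEAST i. \<omega> \<notin> Z i)"
    have i: "\<omega> \<notin> Z i" "\<And>j. j < i \<Longrightarrow> \<omega> \<in> Z j"
      unfolding i_def using LeastI_ex[OF that] not_less_Least by blast+
    have le: "tail_weight c \<gamma> (tau po pb v \<omega>) \<le> ennreal (W (m1 + i))"
      unfolding W_def using c m1[of "m1 + i"] by (intro tail_weight_le Z(3)[OF i(1)]) auto
    show ?thesis
    proof (cases i)
      case 0
      then show ?thesis using le by (auto simp: h_def intro: order_trans)
    next
      case (Suc j)
      then have "ennreal (W (m1 + i)) = (\<Sum>i\<in>{j}. ennreal (W (m1 + i + 1)) * indicator (Z i) \<omega>)"
        using i(2)[of j] by simp
      also have "\<dots> \<le> (\<Sum>i. ennreal (W (m1 + i + 1)) * indicator (Z i) \<omega>)"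
        by (intro sum_le_suminf) auto
      also have "\<dots> \<le> h \<omega>" by (simp add: h_def)
      finally show ?thesis using le by simp
    qed
  qed
  have AE_U: "AE \<omega> in uniform_measure M (Bangle po pb v). \<exists>i. \<omega> \<notin> Z i"
    using AE_Z by (intro AE_uniform_measureI[OF Bangle_sets]) auto
  have "(\<integral>\<^sup>+\<omega>. tail_weight c \<gamma> (tau po pb v \<omega>) \<partial>M) \<le> (\<integral>\<^sup>+\<omega>. h \<omega> \<partial>M)"
    using AE_Z by (intro nn_integral_mono_AE) (auto elim!: eventually_mono intro: le_h)
  moreover have "(\<integral>\<^sup>+\<omega>. tail_weight c \<gamma> (tau po pb v \<omega>) \<partial>uniform_measure M (Bangle po pb v))
      \<le> (\<integral>\<^sup>+\<omega>. h \<omega> \<partial>uniform_measure M (Bangle po pb v))"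
    using AE_U by (intro nn_integral_mono_AE) (auto elim!: eventually_mono intro: le_h)
  moreover have "(\<integral>\<^sup>+\<omega>. h \<omega> \<partial>uniform_measure M (Bangle po pb v)) < \<infinity>"
  \<comment> \<open>If the conditioning event is null, the integral is 0 / 0, which is 0 in
    \<open>ennreal\<close>; otherwise it is at most the integral under \<open>M\<close> divided by a
    positive number.\<close>
  proof (cases "emeasure M (Bangle po pb v) = 0")
    case True
    then have "AE \<omega> in M. \<omega> \<notin> Bangle po pb v" using Bangle_sets by (intro AE_not_in) (auto simp: null_sets_def)
    then have "(\<integral>\<^sup>+\<omega>. h \<omega> * indicator (Bangle po pb v) \<omega> \<partial>M) = 0"
      using Bangle_sets by (subst nn_integral_0_iff_AE) (auto elim!: eventually_mono)
    then show ?thesis by (simp add: nn_integral_uniform_measure[OF hM Bangle_sets])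
  next
    case False
    have "(\<integral>\<^sup>+\<omega>. h \<omega> * indicator (Bangle po pb v) \<omega> \<partial>M) \<le> (\<integral>\<^sup>+\<omega>. h \<omega> \<partial>M)"
      by (intro nn_integral_mono) (auto split: split_indicator)
    also have "\<dots> < \<infinity>" by (rule hint)
    finally show ?thesis using False
      by (simp add: nn_integral_uniform_measure[OF hM Bangle_sets] ennreal_divide_eq_top_iff less_top[symmetric])
  qed
  moreover note eventually_mono[OF AE_Z fin] eventually_mono[OF AE_U fin]
  ultimately show ?thesis using c hint by (intro exI[of _ c]) (auto intro: le_less_trans)
qed

end

theorem theorem4p2:
  fixes q \<rho> po pb vstar c0 \<gamma> :: real
  assumes q: "0 < q" "q < 1"
    and po: "0 \<le> po" "po \<le> 1" and pb: "0 \<le> pb" "pb \<le> 1"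
    and vb_pos: "2 * pb - 1 > 0" and vo: "2 * po - 1 > -1"
    and rho: "0 < \<rho>"
    and vstar: "0 < vstar" "vstar < 2 * pb - 1"
    and c0: "0 < c0" and gamma: "1 < \<gamma>"
    and ballistic: "\<forall>L::nat. 1 \<le> L \<longrightarrow>
        emeasure (PP \<rho> q) {\<omega> \<in> space (PP \<rho> q). \<exists>n::nat.
            real_of_int (Xw po pb \<omega> n) < real n * vstar - real L}
        \<le> ennreal (exp (- c0 * (ln (real L)) powr \<gamma>) / c0)"
  shows "\<exists>c>0.
      (\<integral>\<^sup>+\<omega>. tail_weight c \<gamma> (tau po pb (vstar / 3) \<omega>) \<partial>PP \<rho> q) < \<infinity>
    \<and> (AE \<omega> in PP \<rho> q. tau po pb (vstar / 3) \<omega> \<noteq> \<infinity>)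
    \<and> (\<integral>\<^sup>+\<omega>. tail_weight c \<gamma> (tau po pb (vstar / 3) \<omega>)
          \<partial>uniform_measure (PP \<rho> q) (Bangle po pb (vstar / 3) \<inter> space (PP \<rho> q))) < \<infinity>
    \<and> (AE \<omega> in uniform_measure (PP \<rho> q) (Bangle po pb (vstar / 3) \<inter> space (PP \<rho> q)).
          tau po pb (vstar / 3) \<omega> \<noteq> \<infinity>)"
proof -
  \<comment> \<open>The drift hypotheses give \<open>po\<close> > 0 and \<open>pb\<close> > 0, and
    \<open>vstar\<close> < 2 * pb - 1 \<le> 1 gives slope below 1/3.\<close>
  interpret random_walk q \<rho> po pb "vstar / 3" c0 \<gamma>
    using assms by unfold_locales auto
  show ?thesis unfolding space_PP Int_UNIV_right by (rule regeneration_tail)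
qed

end
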